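(* The map $\phi$ is a size-preserving bijection from rooted (closed) combinatorial maps to rooted indecomposable chord diagrams, and its restriction to bridgeless maps is equal to $\theta$. Consequently $\phi$ sends bridgeless maps to connected chord diagrams.
   Context: Chord diagrams: a diagram of size $n$ is a perfect matching of $2n$ linearly ordered points into chords (up to isomorphism); the root chord contains the first point; intervals are the $2n-1$ gaps between consecutive points, numbered $1,\dots,2n-1$ from left to right. Connected: the graph on chords joining crossing chords ($(a,b),(c,d)$ with $a<c<b<d$) is connected. Indecomposable: not a side-by-side concatenation of two nonempty diagrams. $R_k(C)$ adds a new root chord with left endpoint before all points and right endpoint in interval $k$ of $C$; $\mathrm{Ins}_{D',k}(C)$ places the whole diagram $D'$ inside interval $k$ of $C$. Maps: a rooted map is $(H,\sigma,\alpha,r)$, $\sigma$ a permutation, $\alpha$ an involution of the finite set $H$, $\alpha(r)=r$, $\langle\sigma,\alpha\rangle$ transitive, closed ($r$ the only fixed point of $\alpha$); vertices are $\sigma$-orbits, edges $\alpha$-orbits; size = number of edges (root included); bridgeless = no bridge in the underlying graph. Drawn with $\sigma$ counterclockwise; a corner lies between $h$ and $\sigma(h)$; root corner between $r$ and $\sigma(r)$; root edge contains $\sigma(r)$. Corners ($2n-1$ of them for size $n$) are numbered by the Bridge First Labeling: root corner gets $1$; from the corner labeled $k$, let $e$ be the edge adjacent to it counterclockwise: if $e$ is a bridge of the current map, go along $e$ to the next corner at its other end and label it $k+1$; if $e$ is dangling, label the next corner counterclockwise $k+1$; otherwise cut $e$ into two dangling edges and label the next corner counterclockwise $k+1$; stop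 upon reaching the root. $R_k(N)$ adds an edge joining the root corner to the $k$-th corner (it becomes the root edge); $\mathrm{Ins}_{M',k}(N)$ attaches map $M'$ by its root at the $k$-th corner of $N$, the root of $M'$ becoming a bridge. Boxed products: for connected diagrams $C_1,C_2$ and $1\le i\le 2|C_2|-1$, $C_1\star_i C_2=R_i(C_2)$ if $C_1$ is the one-chord diagram, and $C_1\star_iC_2=R_{i+\ell}(\mathrm{Ins}_{C_2,\ell}(\widehat{C_1}))$ if $C_1=R_\ell(\widehat{C_1})$. For bridgeless maps, identically $M_1\star_iM_2=R_i(M_2)$ if $M_1$ is the one-half-edge map and $R_{i+\ell}(\mathrm{Ins}_{M_2,\ell}(\widehat{M_1}))$ if $M_1=R_\ell(\widehat{M_1})$. Every connected diagram (resp. bridgeless map) of size $>1$ is uniquely of the form $C_1\star_iC_2$ (resp. $M_1\star_iM_2$) with $C_1,C_2$ connected (resp. $M_1,M_2$ bridgeless). $\theta$: $\theta$(one-half-edge map) = one-chord diagram, and $\theta(M_1\star_iM_2)=\theta(M_1)\star_i\theta(M_2)$. $\phi$: $\phi$(one-half-edge map) = one-chord diagram; if the root edge of $M$ is a bridge, write $M=\mathrm{Ins}_{M_\downarrow,1}(M_\uparrow)$ and set $\phi(M)=\mathrm{Ins}_{\phi(M_\downarrow),1}(\phi(M_\uparrow))$; otherwise write $M=R_k(M')$ and set $\phi(M)=R_k(\phi(M'))$. *)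

theory Defs
  imports Main
begin

section \<open>Chord diagrams\<close>

text \<open>A chord diagram of size n is represented canonically as a list D of length 2n:
  the points are 0,...,2n-1 (0-based, left to right) and D!i is the partner of point i.
  Since isomorphism of chord diagrams is order-preserving relabelling, this representation
  is unique per isomorphism class.  Interval k (1 <= k <= 2n-1) is the gap between
  points k-1 and k (0-based).\<close>

definition is_diagram :: "nat list \<Rightarrow> bool" where
  "is_diagram D \<longleftrightarrow> even (length D) \<and>
     (\<forall>i<length D. D!i < length D \<and> D!i \<noteq> i \<and> D!(D!i) = i)"

definition dsize :: "nat list \<Rightarrow> nat" where
  "dsize D = length D div 2"

definition one_chord :: "nat list" where
  "one_chord = [1, 0]"

definition chords :: "nat list \<Rightarrow> (nat \<times> nat) set" where
  "chords D = {(a, b). a < b \<and> b < length D \<and> D!a = b}"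

definition crosses :: "nat \<times> nat \<Rightarrow> nat \<times> nat \<Rightarrow> bool" where
  "crosses u v \<longleftrightarrow> fst u < fst v \<and> fst v < snd u \<and> snd u < snd v"

definition cross_rel :: "nat list \<Rightarrow> ((nat \<times> nat) \<times> (nat \<times> nat)) set" where
  "cross_rel D = {(u, v). u \<in> chords D \<and> v \<in> chords D \<and> (crosses u v \<or> crosses v u)}"

definition connected_diagram :: "nat list \<Rightarrow> bool" where
  "connected_diagram D \<longleftrightarrow> is_diagram D \<and> D \<noteq> [] \<and>
     (\<forall>u\<in>chords D. \<forall>v\<in>chords D. (u, v) \<in> (cross_rel D)\<^sup>*)"

text \<open>Indecomposable: not a side-by-side concatenation of two nonempty diagrams, i.e. no
  proper nonempty prefix of points is closed under the matching.\<close>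
definition indecomposable :: "nat list \<Rightarrow> bool" where
  "indecomposable D \<longleftrightarrow> is_diagram D \<and> D \<noteq> [] \<and>
     \<not> (\<exists>j. 0 < j \<and> j < length D \<and> (\<forall>i<j. D!i < j))"

text \<open>R_k(C): new root chord from a new first point to a new point in interval k of C.\<close>
definition dR :: "nat \<Rightarrow> nat list \<Rightarrow> nat list" where
  "dR k C = map (\<lambda>j. if j = 0 then k + 1 else if j = k + 1 then 0
       else (let i = C ! (if j \<le> k then j - 1 else j - 2) in if i < k then i + 1 else i + 2))
     [0..<length C + 2]"

text \<open>Ins_{D',k}(C): the whole diagram D' placed inside interval k of C.\<close>
definition dIns :: "nat list \<Rightarrow> nat \<Rightarrow> nat list \<Rightarrow> nat list" where
  "dIns D' k C = map (\<lambda>j.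
       if j < k then (let i = C!j in if i < k then i else i + length D')
       else if j < k + length D' then D' ! (j - k) + k
       else (let i = C!(j - length D') in if i < k then i else i + length D'))
     [0..<length C + length D']"

section \<open>Rooted maps\<close>

text \<open>A rooted map (H, sigma, alpha, r) with half-edges natural numbers; only the values of
  sigma and alpha on H matter (maps are considered up to isomorphism).\<close>
record rmap =
  mH :: "nat set"
  msig :: "nat \<Rightarrow> nat"
  malp :: "nat \<Rightarrow> nat"
  mroot :: nat

definition gen_rel :: "nat set \<Rightarrow> (nat \<Rightarrow> nat) \<Rightarrow> (nat \<Rightarrow> nat) \<Rightarrow> (nat \<times> nat) set" where
  "gen_rel H s a = {(h, s h) | h. h \<in> H} \<union> {(h, a h) | h. h \<in> H}"

definition rooted_map :: "rmap \<Rightarrow> bool" where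
  "rooted_map M \<longleftrightarrow> finite (mH M) \<and> mroot M \<in> mH M \<and>
     bij_betw (msig M) (mH M) (mH M) \<and>
     (\<forall>h\<in>mH M. malp M h \<in> mH M \<and> malp M (malp M h) = h) \<and>
     malp M (mroot M) = mroot M \<and>
     (\<forall>h\<in>mH M. malp M h = h \<longrightarrow> h = mroot M) \<and>
     (\<forall>x\<in>mH M. \<forall>y\<in>mH M. (x, y) \<in> (gen_rel (mH M) (msig M) (malp M))\<^sup>*)"

text \<open>Size = number of edges (alpha-orbits, root included).\<close>
definition msize :: "rmap \<Rightarrow> nat" where
  "msize M = card ((\<lambda>h. {h, malp M h}) ` mH M)"

definition miso :: "rmap \<Rightarrow> rmap \<Rightarrow> bool" where
  "miso M1 M2 \<longleftrightarrow> (\<exists>f. bij_betw f (mH M1) (mH M2) \<and>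
     (\<forall>h\<in>mH M1. f (msig M1 h) = msig M2 (f h) \<and> f (malp M1 h) = malp M2 (f h)) \<and>
     f (mroot M1) = mroot M2)"

definition one_map :: rmap where
  "one_map = \<lparr>mH = {0}, msig = id, malp = id, mroot = 0\<rparr>"

text \<open>Cutting the edge of h into two dangling half-edges.\<close>
definition cut :: "(nat \<Rightarrow> nat) \<Rightarrow> nat \<Rightarrow> (nat \<Rightarrow> nat)" where
  "cut a h = a(h := h, a h := a h)"

text \<open>The edge {h, a h} is a bridge of the (connected) map (H, s, a): it is a genuine
  (non-dangling) edge and deleting it disconnects its two ends.\<close>
definition is_bridge :: "nat set \<Rightarrow> (nat \<Rightarrow> nat) \<Rightarrow> (nat \<Rightarrow> nat) \<Rightarrow> nat \<Rightarrow> bool" where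
  "is_bridge H s a h \<longleftrightarrow> h \<in> H \<and> a h \<noteq> h \<and>
     (h, a h) \<notin> (gen_rel H s (cut a h))\<^sup>*"

definition bridgeless :: "rmap \<Rightarrow> bool" where
  "bridgeless M \<longleftrightarrow> (\<forall>h\<in>mH M. \<not> is_bridge (mH M) (msig M) (malp M) h)"

text \<open>Bridge First Labeling.  A corner is named by the half-edge h such that the corner lies
  between h and sigma h.  The state is (current corner, current involution).\<close>
definition bfl_step :: "rmap \<Rightarrow> nat \<times> (nat \<Rightarrow> nat) \<Rightarrow> nat \<times> (nat \<Rightarrow> nat)" where
  "bfl_step M st = (let h = fst st; a = snd st; e = msig M h in
     if a e = e then (e, a)
     else if is_bridge (mH M) (msig M) a e then (a e, a)
     else (e, cut a e))"

text \<open>The k-th corner (1 <= k <= 2 * msize M - 1).\<close>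
definition corner :: "rmap \<Rightarrow> nat \<Rightarrow> nat" where
  "corner M k = fst ((bfl_step M ^^ (k - 1)) (mroot M, malp M))"

text \<open>R_k(N): a new edge {x,y} joining the root corner to the k-th corner; it becomes the
  root edge (x is inserted right after the root half-edge).\<close>
definition mR :: "nat \<Rightarrow> rmap \<Rightarrow> rmap" where
  "mR k N = (let x = Suc (Max (mH N)); y = Suc x; c = corner N k; r = mroot N;
       s1 = (msig N)(r := x, x := msig N r);
       s2 = s1(c := y, y := s1 c)
     in \<lparr>mH = mH N \<union> {x, y}, msig = s2, malp = (malp N)(x := y, y := x), mroot = r\<rparr>)"

text \<open>Ins_{M',k}(N): a new half-edge y is inserted in the k-th corner of N and glued to the
  (dangling) root half-edge of a disjoint copy of M' (shifted by t).\<close>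
definition mIns :: "rmap \<Rightarrow> nat \<Rightarrow> rmap \<Rightarrow> rmap" where
  "mIns M' k N = (let y = Suc (Max (mH N)); t = Suc y; c = corner N k;
       S = (\<lambda>h. h + t) ` mH M'
     in \<lparr>mH = mH N \<union> {y} \<union> S,
         msig = (\<lambda>h. if h \<in> mH N then (if h = c then y else msig N h)
                     else if h = y then msig N c
                     else if h \<in> S then msig M' (h - t) + t else h),
         malp = (\<lambda>h. if h \<in> mH N then malp N h
                     else if h = y then mroot M' + t
                     else if h = mroot M' + t then y
                     else if h \<in> S then malp M' (h - t) + t else h),
         mroot = mroot N\<rparr>)"

section \<open>Boxed products and the bijections theta and phi\<close>

definition dstar_rel :: "nat list \<Rightarrow> nat \<Rightarrow> nat list \<Rightarrow> nat list \<Rightarrow> bool" where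
  "dstar_rel C1 i C2 C \<longleftrightarrow>
     (C1 = one_chord \<and> C = dR i C2) \<or>
     (\<exists>l Ch. is_diagram Ch \<and> Ch \<noteq> [] \<and> 1 \<le> l \<and> l \<le> 2 * dsize Ch - 1 \<and>
        C1 = dR l Ch \<and> C = dR (i + l) (dIns C2 l Ch))"

definition mstar_rel :: "rmap \<Rightarrow> nat \<Rightarrow> rmap \<Rightarrow> rmap \<Rightarrow> bool" where
  "mstar_rel M1 i M2 M \<longleftrightarrow>
     (miso M1 one_map \<and> miso M (mR i M2)) \<or>
     (\<exists>l Mh. rooted_map Mh \<and> 1 \<le> l \<and> l \<le> 2 * msize Mh - 1 \<and>
        miso M1 (mR l Mh) \<and> miso M (mR (i + l) (mIns M2 l Mh)))"

text \<open>theta, as a relation between rooted bridgeless maps and diagrams.\<close>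
inductive theta_rel :: "rmap \<Rightarrow> nat list \<Rightarrow> bool" where
  theta_one: "rooted_map M \<Longrightarrow> miso M one_map \<Longrightarrow> theta_rel M one_chord"
| theta_star: "theta_rel M1 C1 \<Longrightarrow> theta_rel M2 C2 \<Longrightarrow> bridgeless M1 \<Longrightarrow> bridgeless M2 \<Longrightarrow>
    1 \<le> i \<Longrightarrow> i \<le> 2 * msize M2 - 1 \<Longrightarrow> rooted_map M \<Longrightarrow> mstar_rel M1 i M2 M \<Longrightarrow>
    dstar_rel C1 i C2 C \<Longrightarrow> theta_rel M C"

text \<open>phi, as a relation between rooted maps and diagrams.\<close>
inductive phi_rel :: "rmap \<Rightarrow> nat list \<Rightarrow> bool" where
  phi_one: "rooted_map M \<Longrightarrow> miso M one_map \<Longrightarrow> phi_rel M one_chord"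
| phi_bridge: "phi_rel Md Dd \<Longrightarrow> phi_rel Mu Du \<Longrightarrow> rooted_map M \<Longrightarrow>
    miso M (mIns Md 1 Mu) \<Longrightarrow> phi_rel M (dIns Dd 1 Du)"
| phi_R: "phi_rel M' D' \<Longrightarrow> 1 \<le> k \<Longrightarrow> k \<le> 2 * msize M' - 1 \<Longrightarrow> rooted_map M \<Longrightarrow>
    miso M (mR k M') \<Longrightarrow> phi_rel M (dR k D')"

end

theory Submission
  imports Defs
begin

text \<open>Every rooted map other than the one-half-edge map is either an \<open>Ins\<close> at the root corner (root edge a
  bridge) or an \<open>R\<close> (root edge not a bridge), in exactly one way up to isomorphism, provided the Bridge
  First Labeling enumerates all corners; indecomposable diagrams decompose in the same way, according
  to whether the root chord, once removed, leaves an indecomposable diagram and ends inside it. Hence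
  \<open>\<phi>\<close> is a bijection. That the labeling is an enumeration is proved along the same decomposition, by
  following the walk through \<open>R\<close> and \<open>Ins\<close>. The resulting positions of the labels also show that
  \<open>\<phi>\<close> commutes with \<open>Ins\<close> at every corner, and therefore with the boxed product, so that it agrees with
  \<open>\<theta>\<close> on bridgeless maps. Connectivity is handled throughout by cut sets: an edge is a bridge iff some
  set of half-edges is closed under everything except crossing that edge.\<close>

section \<open>Fixed-point-free involutions\<close>

text \<open>The walk changes the map it explores: each non-bridge edge it meets is cut, and later
  bridge tests refer to the cut map. Two walks can therefore be compared only together with their
  current involutions; \<open>sim\<close> in the proof of \<open>isR_labels\<close> and
  \<open>simI\<close> are the invariants for this. The new root edge of an R is met at once and cut,
  and two dangling half-edges do not change which edges of the smaller map are bridges, so from then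
  on both walks run in parallel up to one stop at its other end. The attaching edge of an Ins stays
  a bridge, so it is never cut, and the walk tours the whole attached map between its two crossings.
  \<open>mR\<close> and \<open>mIns\<close> choose concrete fresh half-edges, so iterated
  constructions agree only up to isomorphism. \<open>isR\<close> and \<open>isI\<close> leave the
  names free; one map can then be read as an R and as an Ins at once, which is how the constructions
  are commuted. Corners are named by half-edges: a map of size n has 2n-1 of both, as many as a
  diagram with 2n points has intervals. The equation \<open>length D = card (mH M) + 1\<close> keeps
  labels and intervals in step.\<close>

lemma card_involution:
  assumes "finite A" "\<And>h. h \<in> A \<Longrightarrow> f h \<in> A" "\<And>h. h \<in> A \<Longrightarrow> f (f h) = h" "\<And>h. h \<in> A \<Longrightarrow> f h \<noteq> h"
  shows "card A = 2 * card ((\<lambda>h. {h, f h}) ` A)"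
proof -
  let ?C = "(\<lambda>h. {h, f h}) ` A"
  have u: "\<Union>?C = A" using assms(2) by auto
  have "2 * card ?C = card (\<Union>?C)"
  proof (rule card_partition)
    show "finite ?C" "finite (\<Union>?C)" using assms(1) u by auto
    show "card c = 2" if "c \<in> ?C" for c
    proof -
      obtain h where h: "h \<in> A" "c = {h, f h}" using \<open>c \<in> ?C\<close> by auto
      then show ?thesis using assms(4)[of h] by (metis card_2_iff)
    qed
    show "c1 \<inter> c2 = {}" if c: "c1 \<in> ?C" "c2 \<in> ?C" "c1 \<noteq> c2" for c1 c2
    proof -
      obtain h k where h: "h \<in> A" "c1 = {h, f h}" "k \<in> A" "c2 = {k, f k}" using c by auto
      moreover have "h \<noteq> k" using h c(3) by auto
      moreover have "h \<noteq> f k" using h c(3) assms(3)[of k] by (metis insert_commute)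
      moreover have "f h \<noteq> k" using h c(3) assms(3)[of h] by (metis insert_commute)
      moreover have "f h \<noteq> f k" using calculation assms(3) by metis
      ultimately show ?thesis by auto
    qed
  qed
  then show ?thesis using u by simp
qed

section \<open>Chord diagrams\<close>

lemma diagramD:
  assumes "is_diagram D" "i < length D"
  shows "D ! i < length D" "D ! i \<noteq> i" "D ! (D ! i) = i"
  using assms unfolding is_diagram_def by auto

text \<open>A fixed-point-free involution forces an even number of points, so parity never has to be
  checked by hand.\<close>

lemma is_diagramI:
  assumes "\<And>i. i < length D \<Longrightarrow> D ! i < length D \<and> D ! i \<noteq> i \<and> D ! (D ! i) = i"
  shows "is_diagram D"
proof -
  have "card {..<length D} = 2 * card ((\<lambda>h. {h, D ! h}) ` {..<length D})"
    by (rule card_involution) (use assms in auto)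
  then have "even (length D)" by (metis card_lessThan dvd_triv_left)
  then show ?thesis using assms unfolding is_diagram_def by auto
qed

lemma length_dR [simp]: "length (dR k C) = length C + 2"
  unfolding dR_def by simp

lemma length_dIns [simp]: "length (dIns D k C) = length C + length D"
  unfolding dIns_def by simp

text \<open>\<open>liftR k\<close> and \<open>liftI k n\<close> say where the points of \<open>C\<close> end up in \<open>dR k C\<close> and in
  \<open>dIns D k C\<close> with \<open>n = length D\<close>.\<close>

definition liftR :: "nat \<Rightarrow> nat \<Rightarrow> nat" where
  "liftR k i = (if i < k then i + 1 else i + 2)"

definition liftI :: "nat \<Rightarrow> nat \<Rightarrow> nat \<Rightarrow> nat" where
  "liftI k n i = (if i < k then i else i + n)"

lemma dR_root [simp]: "dR k C ! 0 = k + 1"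
  unfolding dR_def by (simp add: nth_append del: upt_Suc)

lemma dR_root_end: "k \<le> length C \<Longrightarrow> dR k C ! (k + 1) = 0"
  unfolding dR_def by (simp add: nth_append del: upt_Suc)

lemma dR_lift: "i < length C \<Longrightarrow> dR k C ! liftR k i = liftR k (C ! i)"
  unfolding dR_def liftR_def by (simp add: Let_def nth_append del: upt_Suc)

lemma dR_index_cases:
  assumes "n < length C + 2" "k \<le> length C"
  obtains "n = 0" | "n = k + 1" | i where "i < length C" "n = liftR k i"
proof -
  consider "n = 0" | "n = k + 1" | "0 < n" "n \<le> k" | "k + 1 < n" by linarith
  then show ?thesis
  proof cases
    case 3
    then have "n = liftR k (n - 1)" by (auto simp: liftR_def)
    then show ?thesis using 3 assms that(3)[of "n - 1"] by linarith
  next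
    case 4
    then have "n = liftR k (n - 2)" by (auto simp: liftR_def)
    then show ?thesis using 4 assms that(3)[of "n - 2"] by linarith
  qed (use that in auto)
qed

lemma dIns_lift: "i < length C \<Longrightarrow> dIns D k C ! liftI k (length D) i = liftI k (length D) (C ! i)"
  unfolding dIns_def liftI_def by (simp add: Let_def)

lemma dIns_inner: "j < length D \<Longrightarrow> k \<le> length C \<Longrightarrow> dIns D k C ! (k + j) = k + D ! j"
  unfolding dIns_def by simp

lemma dIns_index_cases:
  assumes "n < length C + m" "k \<le> length C"
  obtains i where "i < length C" "n = liftI k m i" | j where "j < m" "n = k + j"
proof -
  consider "n < k" | "k \<le> n" "n < k + m" | "k + m \<le> n" by linarith
  then show ?thesis
  proof cases
    case 1 then show ?thesis using assms that(1)[of n] by (simp add: liftI_def)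
  next
    case 2 then show ?thesis using that(2)[of "n - k"] by simp
  next
    case 3 then show ?thesis using assms that(1)[of "n - m"] by (simp add: liftI_def)
  qed
qed

lemma liftR_inj [simp]: "liftR k i = liftR k j \<longleftrightarrow> i = j"
  unfolding liftR_def by auto

lemma liftI_inj [simp]: "liftI k n i = liftI k n j \<longleftrightarrow> i = j"
  unfolding liftI_def by auto

lemma is_diagram_dR:
  assumes "is_diagram C" "k \<le> length C"
  shows "is_diagram (dR k C)"
proof (rule is_diagramI)
  fix n assume "n < length (dR k C)"
  then have n: "n < length C + 2" by simp
  show "dR k C ! n < length (dR k C) \<and> dR k C ! n \<noteq> n \<and> dR k C ! (dR k C ! n) = n"
  proof (cases rule: dR_index_cases[OF n assms(2)])
    case 1 then show ?thesis using dR_root_end[OF assms(2)] assms(2) by simp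
  next
    case 2 then show ?thesis using dR_root_end[OF assms(2)] assms(2) by simp
  next
    case (3 i)
    then show ?thesis using dR_lift[of i C k] dR_lift[of "C ! i" C k] diagramD[OF assms(1), of i]
      by (auto simp: liftR_def)
  qed
qed

lemma is_diagram_dIns:
  assumes "is_diagram C" "is_diagram D" "k \<le> length C"
  shows "is_diagram (dIns D k C)"
proof (rule is_diagramI)
  fix n assume "n < length (dIns D k C)"
  then have n: "n < length C + length D" by simp
  show "dIns D k C ! n < length (dIns D k C) \<and> dIns D k C ! n \<noteq> n \<and> dIns D k C ! (dIns D k C ! n) = n"
  proof (cases rule: dIns_index_cases[OF n assms(3)])
    case (1 i)
    then show ?thesis using dIns_lift[of i C D k] dIns_lift[of "C ! i" C D k] diagramD[OF assms(1), of i]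
      by (auto simp: liftI_def)
  next
    case (2 j)
    then show ?thesis using dIns_inner[of j D k C] dIns_inner[of "D ! j" D k C]
        diagramD[OF assms(2), of j] assms(3)
      by auto
  qed
qed

section \<open>Indecomposability of the composite diagrams\<close>

lemma indecomposableD:
  assumes "indecomposable D"
  shows "is_diagram D" "D \<noteq> []" "\<lbrakk>0 < j; j < length D; \<And>i. i < j \<Longrightarrow> D ! i < j\<rbrakk> \<Longrightarrow> False"
  using assms unfolding indecomposable_def by auto

lemma length_indecomposable: "indecomposable D \<Longrightarrow> length D \<ge> 2"
  using indecomposableD[of D] unfolding is_diagram_def
  by (metis One_nat_def Suc_leI dvd_imp_le length_greater_0_conv)

lemma indecomposableI:
  assumes "is_diagram D" "D \<noteq> []"
    "\<And>j. \<lbrakk>0 < j; j < length D; \<And>i. i < j \<Longrightarrow> D ! i < j\<rbrakk> \<Longrightarrow> False"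
  shows "indecomposable D"
  using assms unfolding indecomposable_def by auto

lemma indecomposable_one_chord: "indecomposable one_chord"
proof (rule indecomposableI)
  show "is_diagram one_chord" by (rule is_diagramI) (auto simp: one_chord_def less_Suc_eq)
  fix j assume "0 < j" "j < length one_chord" "\<And>i. i < j \<Longrightarrow> one_chord ! i < j"
  from this(1,2) this(3)[of 0] show False by (simp add: one_chord_def)
qed (simp add: one_chord_def)

text \<open>A closed prefix of \<open>dR k C\<close> contains the root, hence also its end
  \<open>k + 1\<close>. Dropping these two points leaves a closed prefix of \<open>C\<close>, which
  is nonempty because k is at least 1.\<close>

lemma indecomposable_dR:
  assumes "indecomposable C" "1 \<le> k" "k < length C"
  shows "indecomposable (dR k C)"
proof (rule indecomposableI)
  show "is_diagram (dR k C)" using assms indecomposableD(1) is_diagram_dR by auto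
  show "dR k C \<noteq> []" by (metis length_dR list.size(3) add_is_0 zero_neq_numeral)
  fix j assume j: "0 < j" "j < length (dR k C)" "\<And>i. i < j \<Longrightarrow> dR k C ! i < j"
  have kj: "k + 1 < j" using j(3)[of 0] j(1) by simp
  show False
  proof (rule indecomposableD(3)[OF assms(1)])
    show "0 < j - 2" "j - 2 < length C" using kj j(2) assms(2) by auto
    fix i assume i: "i < j - 2"
    then have "liftR k i < j" by (auto simp: liftR_def)
    from j(3)[OF this] i j(2) show "C ! i < j - 2"
      using dR_lift[of i C k] kj by (auto simp: liftR_def split: if_splits)
  qed
qed

text \<open>The first point of \<open>C\<close> is matched beyond the inserted copy of
  \<open>D\<close>, so a closed prefix contains that whole copy; removing it leaves a closed prefix
  of \<open>C\<close>.\<close>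

lemma indecomposable_dIns:
  assumes "indecomposable D" "indecomposable C"
  shows "indecomposable (dIns D 1 C)"
proof (rule indecomposableI)
  note l = length_indecomposable[OF assms(2)]
  show "is_diagram (dIns D 1 C)" using assms indecomposableD(1) is_diagram_dIns l by auto
  show "dIns D 1 C \<noteq> []" using l by (metis length_dIns list.size(3) add_is_0 not_numeral_le_zero)
  fix j assume j: "0 < j" "j < length (dIns D 1 C)" "\<And>i. i < j \<Longrightarrow> dIns D 1 C ! i < j"
  have c0: "C ! 0 \<noteq> 0" using diagramD(2)[of C 0] indecomposableD(1,2)[OF assms(2)] by simp
  then have "dIns D 1 C ! 0 \<ge> 1 + length D" using dIns_lift[of 0 C D 1] indecomposableD(2)[OF assms(2)] by (simp add: liftI_def)
  then have kj: "1 + length D < j" using j(3)[of 0] j(1) by linarith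
  show False
  proof (rule indecomposableD(3)[OF assms(2)])
    show "0 < j - length D" "j - length D < length C" using kj j(2) by auto
    fix i assume i: "i < j - length D"
    then have "liftI 1 (length D) i < j" by (auto simp: liftI_def)
    from j(3)[OF this] i j(2) show "C ! i < j - length D"
      using dIns_lift[of i C D 1] kj by (auto simp: liftI_def split: if_splits)
  qed
qed

section \<open>Unique decomposition of indecomposable diagrams\<close>

lemma dR_eq_iff:
  assumes "dR k C = dR k' C'"
  shows "k = k' \<and> C = C'"
proof -
  have k: "k = k'" using arg_cong[OF assms, of "\<lambda>l. l ! 0"] by simp
  have l: "length C = length C'" using arg_cong[OF assms, of length] by simp
  have "C = C'"
  proof (rule nth_equalityI[OF l])
    fix i assume "i < length C"
    then show "C ! i = C' ! i" using dR_lift[of i C k] dR_lift[of i C' k] assms k l by simp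
  qed
  with k show ?thesis by simp
qed

text \<open>Both inserted blocks start right after the first point. If \<open>D\<close> were the
  shorter one, its points would form a closed proper prefix of \<open>D'\<close>.\<close>

lemma dIns_eq_length:
  assumes "dIns D 1 C = dIns D' 1 C'" "indecomposable D" "indecomposable C"
    "indecomposable D'" "indecomposable C'"
  shows "length D' \<le> length D"
proof (rule ccontr)
  note ll = length_indecomposable[OF assms(2)] length_indecomposable[OF assms(3)]
    length_indecomposable[OF assms(5)]
  assume n: "\<not> length D' \<le> length D"
  show False
  proof (rule indecomposableD(3)[OF assms(4)])
    show "0 < length D" "length D < length D'" using ll n by auto
    fix i assume i: "i < length D"
    then have "1 + D ! i = 1 + D' ! i"
      using dIns_inner[of i D 1 C] dIns_inner[of i D' 1 C'] assms(1) n ll by simp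
    then show "D' ! i < length D" using diagramD(1)[of D i] indecomposableD(1)[OF assms(2)] i by simp
  qed
qed

lemma dIns_eq_iff:
  assumes "dIns D 1 C = dIns D' 1 C'" "indecomposable D" "indecomposable C"
    "indecomposable D'" "indecomposable C'"
  shows "D = D' \<and> C = C'"
proof -
  note ll = length_indecomposable[OF assms(3)] length_indecomposable[OF assms(5)]
  have l: "length D = length D'"
    using dIns_eq_length[OF assms(1-5)] dIns_eq_length[OF assms(1)[symmetric]] assms(2-5) by simp
  have l2: "length C = length C'" using arg_cong[OF assms(1), of length] l by simp
  have "D = D'"
  proof (rule nth_equalityI[OF l])
    fix i assume "i < length D"
    then show "D ! i = D' ! i"
      using dIns_inner[of i D 1 C] dIns_inner[of i D' 1 C'] assms(1) l ll by simp
  qed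
  moreover have "C = C'"
  proof (rule nth_equalityI[OF l2])
    fix i assume "i < length C"
    then show "C ! i = C' ! i"
      using dIns_lift[of i C D 1] dIns_lift[of i C' D' 1] assms(1) l l2 by simp
  qed
  ultimately show ?thesis by simp
qed

text \<open>In \<open>dIns D 1 C'\<close> the block \<open>D\<close> follows the first point and
  lies under its chord. Read inside \<open>dR k C\<close>, it would be a closed prefix of
  \<open>C\<close>, and a proper one because \<open>length D\<close> is at most
  \<open>k\<close>.\<close>

lemma dR_neq_dIns:
  assumes "indecomposable C" "1 \<le> k" "k < length C" "indecomposable D" "indecomposable C'"
  shows "dR k C \<noteq> dIns D 1 C'"
proof
  assume eq: "dR k C = dIns D 1 C'"
  note ll = length_indecomposable[OF assms(4)] length_indecomposable[OF assms(5)]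
  have c0: "C' ! 0 \<noteq> 0" using diagramD(2)[of C' 0] indecomposableD(1,2)[OF assms(5)] by simp
  then have "dIns D 1 C' ! 0 \<ge> 1 + length D" using dIns_lift[of 0 C' D 1] indecomposableD(2)[OF assms(5)] by (simp add: liftI_def)
  then have k: "length D \<le> k" using eq dR_root[of k C] by simp
  show False
  proof (rule indecomposableD(3)[OF assms(1)])
    show "0 < length D" "length D < length C" using ll k assms by auto
    fix i assume i: "i < length D"
    have "dIns D 1 C' ! (1 + i) = 1 + D ! i" using dIns_inner[of i D 1 C'] i ll by simp
    moreover have "dR k C ! (1 + i) = liftR k (C ! i)"
      using dR_lift[of i C k] i k assms(3) by (simp add: liftR_def)
    ultimately have "liftR k (C ! i) = 1 + D ! i" using eq by simp
    then have "C ! i \<le> D ! i" by (auto simp: liftR_def split: if_splits)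
    then show "C ! i < length D" using diagramD(1)[of D i] indecomposableD(1)[OF assms(4)] i by simp
  qed
qed

lemma indecomposable_cases:
  assumes D: "indecomposable D"
  obtains "D = one_chord"
  | Dd Du where "indecomposable Dd" "indecomposable Du" "D = dIns Dd 1 Du"
  | k C where "indecomposable C" "1 \<le> k" "k < length C" "D = dR k C"
proof -
  note dg = indecomposableD(1)[OF D] and l2 = length_indecomposable[OF D]
  define m where "m = D ! 0"
  have m: "m < length D" "m \<noteq> 0" "D ! m = 0" using diagramD[OF dg, of 0] indecomposableD(2)[OF D] by (auto simp: m_def)
  have inj: "i = j" if "D ! i = D ! j" "i < length D" "j < length D" for i j
    using diagramD(3)[OF dg] that by metis
  \<comment> \<open>\<open>?cl q\<close>: the points from 1 to \<open>q - 1\<close> lie under the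
    root chord and are matched among themselves, so they form an inserted block.\<close>
  let ?cl = "\<lambda>q. 1 < q \<and> q \<le> m \<and> (\<forall>i. 1 \<le> i \<and> i < q \<longrightarrow> D ! i < q)"
  consider (one) "length D = 2" | (ins) q where "length D > 2" "?cl q"
    | (R) "length D > 2" "\<And>q. \<not> ?cl q" using l2 by fastforce
  then show thesis
  proof cases
    case one
    then have "D ! 0 = 1" "D ! 1 = 0" using m by (auto simp: m_def less_2_cases_iff)
    then have "D = one_chord" using one
      by (auto intro!: nth_equalityI simp: one_chord_def less_2_cases_iff)
    then show ?thesis by (rule that(1))
  next
    case (ins q0)
    \<comment> \<open>The shortest block is chosen: a closed proper prefix of \<open>Dd\<close>
      would yield a smaller \<open>q\<close>, so \<open>Dd\<close> is indecomposable.\<close>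
    define q where "q = (LEAST q. ?cl q)"
    have q: "?cl q" unfolding q_def by (rule LeastI[of ?cl, OF ins(2)])
    have least: "\<not> ?cl q'" if "q' < q" for q' using that not_less_Least[of q' ?cl] by (simp add: q_def)
    define n where "n = q - 1"
    have n: "n \<ge> 1" "n < m" "\<And>i. 1 \<le> i \<Longrightarrow> i \<le> n \<Longrightarrow> 1 \<le> D ! i \<and> D ! i \<le> n"
    proof -
      show "n \<ge> 1" "n < m" using q by (auto simp: n_def)
      fix i assume i: "1 \<le> i" "i \<le> n"
      then have "D ! i < q" using q by (auto simp: n_def)
      moreover have "D ! i \<noteq> 0" using inj[of i m] m i \<open>n < m\<close> by auto
      ultimately show "1 \<le> D ! i \<and> D ! i \<le> n" by (auto simp: n_def)
    qed
    have out: "D ! i = 0 \<or> D ! i > n" if "i = 0 \<or> n < i" "i < length D" for i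
    proof (rule ccontr)
      assume "\<not> ?thesis"
      then have "1 \<le> D ! (D ! i)" "D ! (D ! i) \<le> n" using n(3)[of "D ! i"] by auto
      then show False using that diagramD(3)[OF dg, of i] by auto
    qed
    define Dd where "Dd = map (\<lambda>i. D ! (i + 1) - 1) [0..<n]"
    \<comment> \<open>Left inverse of \<open>liftI 1 n\<close>. It is applied only to values outside
      the block, where \<open>liftI 1 n\<close> also undoes it.\<close>
    define un where "un = (\<lambda>v. if v < 1 then v else v - n :: nat)"
    define Du where "Du = map (\<lambda>i. un (D ! liftI 1 n i)) [0..<length D - n]"
    have lDd: "length Dd = n" and lDu: "length Du = length D - n" by (auto simp: Dd_def Du_def)
    have Dd: "Dd ! i = D ! (i + 1) - 1" if "i < n" for i using that by (simp add: Dd_def)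
    have Dd1: "1 + Dd ! i = D ! (i + 1)" if "i < n" for i using Dd[OF that] n(3)[of "i + 1"] that by auto
    have Du: "Du ! i = un (D ! liftI 1 n i)" if "i < length D - n" for i using that by (simp add: Du_def)
    have Du1: "liftI 1 n (Du ! i) = D ! liftI 1 n i" if "i < length D - n" for i
    proof -
      have "liftI 1 n i = 0 \<or> n < liftI 1 n i" "liftI 1 n i < length D" using that by (auto simp: liftI_def)
      moreover have "liftI 1 n (un v) = v" if "v = 0 \<or> n < v" for v using that by (auto simp: un_def liftI_def)
      ultimately show ?thesis using Du[OF that] out by simp
    qed
    have eq: "D = dIns Dd 1 Du"
    proof (rule nth_equalityI)
      show len: "length D = length (dIns Dd 1 Du)" using n m by (simp add: lDd lDu)
      fix i assume "i < length D"
      then have i: "i < length Du + n" using len by (simp add: lDd)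
      have l1: "1 \<le> length Du" using n m by (simp add: lDu)
      show "D ! i = dIns Dd 1 Du ! i"
      proof (cases rule: dIns_index_cases[OF i l1])
        case (1 j) then show ?thesis using dIns_lift[of j Du Dd 1] Du1[of j] by (simp add: lDd lDu)
      next
        case (2 j) then show ?thesis using dIns_inner[of j Dd 1 Du] Dd1[of j] l1 by (simp add: lDd)
      qed
    qed
    have "is_diagram Dd"
    proof (rule is_diagramI, unfold lDd)
      fix i assume i: "i < n"
      then show "Dd ! i < n \<and> Dd ! i \<noteq> i \<and> Dd ! (Dd ! i) = i"
        using n(3)[of "i + 1"] Dd[OF i] Dd1[of i] Dd1[of "Dd ! i"] diagramD[OF dg, of "i + 1"] n(2) m(1) by auto
    qed
    have "is_diagram Du"
    proof (rule is_diagramI, unfold lDu)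
      fix i assume i: "i < length D - n"
      then have li: "liftI 1 n i < length D" by (auto simp: liftI_def)
      have "liftI 1 n (Du ! i) < length D" using Du1[OF i] diagramD(1)[OF dg li] by simp
      then have lt: "Du ! i < length D - n" using n m by (auto simp: liftI_def split: if_splits)
      moreover have "Du ! i \<noteq> i" using Du1[OF i] diagramD(2)[OF dg li] by auto
      moreover have "liftI 1 n (Du ! (Du ! i)) = liftI 1 n i"
        using Du1[OF lt] Du1[OF i] diagramD(3)[OF dg li] by simp
      ultimately show "Du ! i < length D - n \<and> Du ! i \<noteq> i \<and> Du ! (Du ! i) = i" by simp
    qed
    have "indecomposable Dd"
    proof (rule indecomposableI[OF \<open>is_diagram Dd\<close>])
      show "Dd \<noteq> []" using lDd n(1) by auto
      fix j assume j: "0 < j" "j < length Dd" "\<And>i. i < j \<Longrightarrow> Dd ! i < j"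
      have "?cl (j + 1)"
      proof (intro conjI allI impI)
        show "1 < j + 1" "j + 1 \<le> m" using j(1,2) lDd n(2) by auto
        fix i assume i: "1 \<le> i \<and> i < j + 1"
        then have "Dd ! (i - 1) < j" using j(3)[of "i - 1"] by linarith
        moreover have "i - 1 < n" using i j(2) lDd by linarith
        ultimately show "D ! i < j + 1" using Dd1[of "i - 1"] i by simp
      qed
      moreover have "j + 1 < q" using j(2) lDd n_def by simp
      ultimately show False using least by blast
    qed
    moreover have "indecomposable Du"
    proof (rule indecomposableI[OF \<open>is_diagram Du\<close>])
      show "Du \<noteq> []" using lDu n(2) m(1) by auto
      fix j assume j: "0 < j" "j < length Du" "\<And>i. i < j \<Longrightarrow> Du ! i < j"
      show False
      proof (rule indecomposableD(3)[OF D])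
        show "0 < j + n" "j + n < length D" using j(1,2) lDu by auto
        fix i assume i: "i < j + n"
        have "i < length Du + n" "1 \<le> length Du" using i j(1,2) by linarith+
        then show "D ! i < j + n"
        proof (cases rule: dIns_index_cases)
          case (1 h)
          then have "h < j" using i j(1) by (auto simp: liftI_def split: if_splits)
          then have "Du ! h < j" "D ! i = liftI 1 n (Du ! h)" using 1 j(3) Du1[of h] lDu by auto
          then show ?thesis by (auto simp: liftI_def)
        next
          case (2 h) then show ?thesis using n(3)[of i] j(1) by auto
        qed
      qed
    qed
    ultimately show ?thesis using eq that(2) by blast
  next
    case R
    define k where "k = m - 1"
    define un where "un = (\<lambda>v. if v \<le> k then v - 1 else v - 2 :: nat)"
    define C where "C = map (\<lambda>i. un (D ! liftR k i)) [0..<length D - 2]"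
    have lC: "length C = length D - 2" by (simp add: C_def)
    have mk: "m = k + 1" using m by (simp add: k_def)
    \<comment> \<open>A root chord ending at point 1 would split off as a closed prefix of length
      2.\<close>
    have "m \<noteq> 1"
    proof
      assume m1: "m = 1"
      show False
      proof (rule indecomposableD(3)[OF D])
        show "0 < (2::nat)" "2 < length D" using R by auto
        fix i :: nat assume "i < 2"
        then show "D ! i < 2" using m m1 by (auto simp: m_def less_2_cases_iff)
      qed
    qed
    then have k1: "1 \<le> k" using m by (simp add: k_def)
    have lift_neq: "liftR k i \<noteq> 0" "liftR k i \<noteq> m" for i unfolding liftR_def mk by auto
    have Dn: "D ! i \<noteq> 0" "D ! i \<noteq> m" if "i < length D" "i \<noteq> 0" "i \<noteq> m" for i
      using inj[of i m] inj[of i 0] that m l2 by (metis, metis m_def gr0I less_nat_zero_code)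
    have C1: "liftR k (C ! i) = D ! liftR k i" if "i < length D - 2" for i
    proof -
      have "liftR k i < length D" using that by (auto simp: liftR_def)
      from Dn[OF this lift_neq] have "D ! liftR k i \<noteq> 0" "D ! liftR k i \<noteq> k + 1" by (simp_all add: mk)
      moreover have "liftR k (un v) = v" if "v \<noteq> 0" "v \<noteq> k + 1" for v
        using that by (auto simp: un_def liftR_def)
      ultimately show ?thesis using that by (simp add: C_def)
    qed
    \<comment> \<open>A root chord ending at the last point would enclose all other points, and
      these would form a block, which case \<open>R\<close> excludes.\<close>
    have "m \<noteq> length D - 1"
    proof
      assume ml: "m = length D - 1"
      have "?cl m"
      proof (intro conjI allI impI)
        show "1 < m" "m \<le> m" using mk k1 by auto
        fix i assume i: "1 \<le> i \<and> i < m"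
        then show "D ! i < m" using Dn(2)[of i] diagramD(1)[OF dg, of i] ml m by fastforce
      qed
      then show False using R by blast
    qed
    then have kC: "k < length C" using m mk lC by auto
    have eq: "D = dR k C"
    proof (rule nth_equalityI)
      show len: "length D = length (dR k C)" using R by (simp add: lC)
      fix i assume "i < length D"
      then have i: "i < length C + 2" using len by simp
      have kl: "k \<le> length C" using kC by simp
      show "D ! i = dR k C ! i"
      proof (cases rule: dR_index_cases[OF i kl])
        case 1 then show ?thesis by (simp add: mk m_def[symmetric])
      next
        case 2 then show ?thesis using dR_root_end[OF kl] m by (simp add: mk)
      next
        case (3 j) then show ?thesis using dR_lift[of j C k] C1[of j] by (simp add: lC)
      qed
    qed
    have "is_diagram C"
    proof (rule is_diagramI, unfold lC)
      fix i assume i: "i < length D - 2"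
      then have li: "liftR k i < length D" by (auto simp: liftR_def)
      have "liftR k (C ! i) < length D" using C1[OF i] diagramD(1)[OF dg li] by simp
      then have lt: "C ! i < length D - 2" using kC lC by (auto simp: liftR_def split: if_splits)
      moreover have "C ! i \<noteq> i" using C1[OF i] diagramD(2)[OF dg li] by auto
      moreover have "liftR k (C ! (C ! i)) = liftR k i"
        using C1[OF lt] C1[OF i] diagramD(3)[OF dg li] by simp
      ultimately show "C ! i < length D - 2 \<and> C ! i \<noteq> i \<and> C ! (C ! i) = i" by simp
    qed
    have "indecomposable C"
    proof (rule indecomposableI[OF \<open>is_diagram C\<close>])
      show "C \<noteq> []" using lC R by auto
      fix j assume j: "0 < j" "j < length C" "\<And>i. i < j \<Longrightarrow> C ! i < j"
      show False
      \<comment> \<open>The closed prefix of \<open>C\<close> either ends before the root chord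
        does, and is then a block after the root, or it reaches past that end, and together with the
        root chord it is a closed prefix of \<open>D\<close>.\<close>
      proof (cases "j \<le> k")
        case True
        have "?cl (j + 1)"
        proof (intro conjI allI impI)
          show "1 < j + 1" "j + 1 \<le> m" using j(1,2) mk True by auto
          fix i assume i: "1 \<le> i \<and> i < j + 1"
          then have "C ! (i - 1) < j" using j(3)[of "i - 1"] by linarith
          moreover have "i - 1 < length D - 2" "liftR k (i - 1) = i" using i j(2) lC True by (auto simp: liftR_def)
          ultimately show "D ! i < j + 1" using C1[of "i - 1"] True by (simp add: liftR_def)
        qed
        then show False using R by blast
      next
        case False
        show False
        proof (rule indecomposableD(3)[OF D])
          show "0 < j + 2" "j + 2 < length D" using j(1,2) lC by auto
          fix i assume i: "i < j + 2"
          have kl: "k \<le> length C" using kC by simp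
          have i': "i < length C + 2" using i j by simp
          show "D ! i < j + 2"
          proof (cases rule: dR_index_cases[OF i' kl])
            case 1 then show ?thesis using False mk by (simp add: m_def[symmetric])
          next
            case 2 then show ?thesis using m by (simp add: mk)
          next
            case (3 h)
            then have "h < j" using i False by (auto simp: liftR_def split: if_splits)
            then have "C ! h < j" "D ! i = liftR k (C ! h)" using C1[of h] 3 j(3)[of h] lC by auto
            then show ?thesis by (auto simp: liftR_def)
          qed
        qed
      qed
    qed
    then show ?thesis using that(3) k1 kC eq by blast
  qed
qed

text \<open>The four identities from here on cover every interval but the first of a decomposed
  diagram. Their index shifts are those of the labels in \<open>isI_labels\<close> and
  \<open>isR_labels\<close>, which is what \<open>phi_rel_mIns\<close> rests on.\<close>

lemma dIns_dIns_inner: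
  assumes "1 \<le> k" "k \<le> length Dd" "1 \<le> length Du"
  shows "dIns D (k + 1) (dIns Dd 1 Du) = dIns (dIns D k Dd) 1 Du"
proof (rule nth_equalityI)
  fix n assume "n < length (dIns D (k + 1) (dIns Dd 1 Du))"
  then have n: "n < length Du + length (dIns D k Dd)" by simp
  show "dIns D (k + 1) (dIns Dd 1 Du) ! n = dIns (dIns D k Dd) 1 Du ! n"
  proof (cases rule: dIns_index_cases[OF n assms(3)])
    case (1 i)
    have "n = liftI (k + 1) (length D) (liftI 1 (length Dd) i)"
      using 1 assms by (auto simp: liftI_def)
    moreover have "liftI 1 (length Dd) i < length Du + length Dd" using 1 assms by (auto simp: liftI_def)
    ultimately have "dIns D (k + 1) (dIns Dd 1 Du) ! n
        = liftI (k + 1) (length D) (liftI 1 (length Dd) (Du ! i))"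
      using 1 by (simp add: dIns_lift)
    then show ?thesis using 1 dIns_lift[of i Du "dIns D k Dd" 1] assms by (auto simp: liftI_def)
  next
    case (2 j)
    then have j: "j < length Dd + length D" by simp
    show ?thesis
    proof (cases rule: dIns_index_cases[OF j assms(2)])
      case (1 i)
      then have "n = liftI (k + 1) (length D) (1 + i)" using 2 by (auto simp: liftI_def)
      then have "dIns D (k + 1) (dIns Dd 1 Du) ! n = liftI (k + 1) (length D) (1 + Dd ! i)"
        using 1 assms dIns_lift[of "1 + i" "dIns Dd 1 Du" D "k + 1"] dIns_inner[of i Dd 1 Du] by simp
      then show ?thesis using 1 2 dIns_inner[of j "dIns D k Dd" 1 Du] assms dIns_lift[of i Dd D k]
        by (auto simp: liftI_def)
    next
      case i: (2 i)
      then show ?thesis using 2 assms dIns_inner[of i D "k + 1" "dIns Dd 1 Du"]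
          dIns_inner[of j "dIns D k Dd" 1 Du] dIns_inner[of i D k Dd] by simp
    qed
  qed
qed simp

lemma dIns_dIns_outer:
  assumes "1 \<le> k" "k \<le> length Du" "is_diagram Dd"
  shows "dIns D (k + length Dd) (dIns Dd 1 Du) = dIns Dd 1 (dIns D k Du)"
proof (rule nth_equalityI)
  fix n assume "n < length (dIns D (k + length Dd) (dIns Dd 1 Du))"
  then have n: "n < length (dIns D k Du) + length Dd" by simp
  have l1: "1 \<le> length (dIns D k Du)" using assms by simp
  show "dIns D (k + length Dd) (dIns Dd 1 Du) ! n = dIns Dd 1 (dIns D k Du) ! n"
  proof (cases rule: dIns_index_cases[OF n l1])
    case (2 j)
    then have "n = liftI (k + length Dd) (length D) (1 + j)" using assms by (auto simp: liftI_def)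
    then have "dIns D (k + length Dd) (dIns Dd 1 Du) ! n = liftI (k + length Dd) (length D) (1 + Dd ! j)"
      using 2 assms dIns_lift[of "1 + j" "dIns Dd 1 Du" D "k + length Dd"] dIns_inner[of j Dd 1 Du] by simp
    then show ?thesis using 2 assms diagramD(1)[OF assms(3), of j] dIns_inner[of j Dd 1 "dIns D k Du"]
      by (auto simp: liftI_def)
  next
    case (1 i)
    then have i: "i < length Du + length D" by simp
    show ?thesis
    proof (cases rule: dIns_index_cases[OF i assms(2)])
      case j: (1 j)
      have "n = liftI (k + length Dd) (length D) (liftI 1 (length Dd) j)" using 1 j assms by (auto simp: liftI_def)
      moreover have "liftI 1 (length Dd) j < length Du + length Dd" using j by (auto simp: liftI_def)
      ultimately have "dIns D (k + length Dd) (dIns Dd 1 Du) ! n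
          = liftI (k + length Dd) (length D) (liftI 1 (length Dd) (Du ! j))"
        using j by (simp add: dIns_lift)
      then show ?thesis using 1 j assms dIns_lift[of i "dIns D k Du" Dd 1] dIns_lift[of j Du D k]
        by (auto simp: liftI_def)
    next
      case j: (2 j)
      then have "n = k + length Dd + j" using 1 assms by (auto simp: liftI_def)
      then show ?thesis using 1 j assms dIns_inner[of j D "k + length Dd" "dIns Dd 1 Du"]
          dIns_lift[of i "dIns D k Du" Dd 1] dIns_inner[of j D k Du] by (auto simp: liftI_def ac_simps)
    qed
  qed
qed simp

text \<open>The end of the root chord splits interval \<open>j\<close> of \<open>C\<close> into the
  intervals \<open>j + 1\<close> and \<open>j + 2\<close> of \<open>dR j C\<close>. The left half is
  covered here, the right half by \<open>dIns_dR_after\<close>; only from the left does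
  \<open>D\<close> push the end of the root chord away.\<close>

lemma dIns_dR_before:
  assumes "1 \<le> k" "k \<le> j" "j \<le> length C" "is_diagram D"
  shows "dIns D (k + 1) (dR j C) = dR (j + length D) (dIns D k C)"
proof (rule nth_equalityI)
  fix n assume "n < length (dIns D (k + 1) (dR j C))"
  then have n: "n < length (dIns D k C) + 2" by simp
  have l: "j + length D \<le> length (dIns D k C)" using assms by simp
  show "dIns D (k + 1) (dR j C) ! n = dR (j + length D) (dIns D k C) ! n"
  proof (cases rule: dR_index_cases[OF n l])
    case 1
    then show ?thesis using dIns_lift[of 0 "dR j C" D "k + 1"] assms by (auto simp: liftI_def)
  next
    case 2
    then show ?thesis using dIns_lift[of "j + 1" "dR j C" D "k + 1"] assms dR_root_end[of j C]
        dR_root_end[OF l] by (auto simp: liftI_def)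
  next
    case (3 i)
    then have i: "i < length C + length D" by simp
    have kC: "k \<le> length C" using assms by simp
    show ?thesis
    proof (cases rule: dIns_index_cases[OF i kC])
      case h: (1 h)
      have "n = liftI (k + 1) (length D) (liftR j h)" using 3 h assms by (auto simp: liftI_def liftR_def)
      moreover have "liftR j h < length C + 2" using h by (auto simp: liftR_def)
      ultimately have "dIns D (k + 1) (dR j C) ! n = liftI (k + 1) (length D) (liftR j (C ! h))"
        using h by (simp add: dIns_lift dR_lift)
      then show ?thesis using 3 h assms dR_lift[of i "dIns D k C" "j + length D"] dIns_lift[of h C D k]
        by (auto simp: liftI_def liftR_def)
    next
      case h: (2 h)
      have "n = k + 1 + h" using 3 h assms by (auto simp: liftR_def)
      then have "dIns D (k + 1) (dR j C) ! n = k + 1 + D ! h"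
        using h assms dIns_inner[of h D "k + 1" "dR j C"] by simp
      then show ?thesis using 3 h assms dR_lift[of i "dIns D k C" "j + length D"] dIns_inner[of h D k C]
          diagramD(1)[OF assms(4), of h]
        by (auto simp: liftR_def)
    qed
  qed
qed simp

lemma dIns_dR_after:
  assumes "j \<le> k" "k \<le> length C"
  shows "dIns D (k + 2) (dR j C) = dR j (dIns D k C)"
proof (rule nth_equalityI)
  fix n assume "n < length (dIns D (k + 2) (dR j C))"
  then have n: "n < length (dIns D k C) + 2" by simp
  have l: "j \<le> length (dIns D k C)" using assms by simp
  show "dIns D (k + 2) (dR j C) ! n = dR j (dIns D k C) ! n"
  proof (cases rule: dR_index_cases[OF n l])
    case 1
    then show ?thesis using dIns_lift[of 0 "dR j C" D "k + 2"] assms by (auto simp: liftI_def)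
  next
    case 2
    then show ?thesis using dIns_lift[of "j + 1" "dR j C" D "k + 2"] assms dR_root_end[of j C]
        dR_root_end[OF l] by (auto simp: liftI_def)
  next
    case (3 i)
    then have i: "i < length C + length D" by simp
    show ?thesis
    proof (cases rule: dIns_index_cases[OF i assms(2)])
      case h: (1 h)
      have "n = liftI (k + 2) (length D) (liftR j h)" using 3 h assms by (auto simp: liftI_def liftR_def)
      moreover have "liftR j h < length C + 2" using h by (auto simp: liftR_def)
      ultimately have "dIns D (k + 2) (dR j C) ! n = liftI (k + 2) (length D) (liftR j (C ! h))"
        using h by (simp add: dIns_lift dR_lift)
      then show ?thesis using 3 h assms dR_lift[of i "dIns D k C" j] dIns_lift[of h C D k]
        by (auto simp: liftI_def liftR_def)
    next
      case h: (2 h)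
      have "n = k + 2 + h" using 3 h assms by (auto simp: liftR_def)
      then have "dIns D (k + 2) (dR j C) ! n = k + 2 + D ! h"
        using h assms dIns_inner[of h D "k + 2" "dR j C"] by simp
      then show ?thesis using 3 h assms dR_lift[of i "dIns D k C" j] dIns_inner[of h D k C]
        by (auto simp: liftR_def)
    qed
  qed
qed simp

section \<open>Connected diagrams\<close>

lemma cross_rel_embed:
  assumes f: "\<And>i j. i < j \<Longrightarrow> j < length C \<Longrightarrow> f i < f j"
    and len: "\<And>i. i < length C \<Longrightarrow> f i < length D"
    and nth: "\<And>i. i < length C \<Longrightarrow> D ! f i = f (C ! i)"
  shows "(u, v) \<in> (cross_rel C)\<^sup>* \<Longrightarrow> (map_prod f f u, map_prod f f v) \<in> (cross_rel D)\<^sup>*"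
proof (induction rule: rtrancl_induct)
  case (step v w)
  have ch: "map_prod f f p \<in> chords D" if "p \<in> chords C" for p
    using that f nth len unfolding chords_def by (cases p) auto
  have cr: "crosses (map_prod f f p) (map_prod f f q)" if "crosses p q" "p \<in> chords C" "q \<in> chords C" for p q
    using that f unfolding crosses_def chords_def by (cases p; cases q) auto
  have "(map_prod f f v, map_prod f f w) \<in> cross_rel D"
    using step(2) ch[of v] ch[of w] cr[of v w] cr[of w v] unfolding cross_rel_def by blast
  with step(3) show ?case by simp
qed simp

lemma sym_cross_rel: "sym (cross_rel D)"
  unfolding cross_rel_def sym_def by auto

text \<open>Every chord comes from the copy of \<open>A\<close> or from that of \<open>B\<close>,
  each copy is connected in itself, and the crossing of \<open>p\<close> and \<open>q\<close> links
  them. Both shapes of the boxed product are instances.\<close>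

lemma connected_diagram_amalgam:
  assumes D: "is_diagram D" "D \<noteq> []" and con: "connected_diagram A" "connected_diagram B"
    and f: "\<And>i j. i < j \<Longrightarrow> j < length A \<Longrightarrow> f i < f j"
    and flen: "\<And>i. i < length A \<Longrightarrow> f i < length D"
    and fnth: "\<And>i. i < length A \<Longrightarrow> D ! f i = f (A ! i)"
    and g: "\<And>i j. i < j \<Longrightarrow> j < length B \<Longrightarrow> g i < g j"
    and glen: "\<And>i. i < length B \<Longrightarrow> g i < length D"
    and gnth: "\<And>i. i < length B \<Longrightarrow> D ! g i = g (B ! i)"
    and cover: "\<And>n. n < length D \<Longrightarrow> n \<in> f ` {..<length A} \<union> g ` {..<length B}"
    and p: "p \<in> chords A" and q: "q \<in> chords B" and pq: "crosses (map_prod f f p) (map_prod g g q)"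
  shows "connected_diagram D"
proof -
  have dA: "is_diagram A" and dB: "is_diagram B" using con by (auto simp: connected_diagram_def)
  have chf: "map_prod f f u \<in> chords D" if "u \<in> chords A" for u
    using that f flen fnth unfolding chords_def by (cases u) auto
  have chg: "map_prod g g u \<in> chords D" if "u \<in> chords B" for u
    using that g glen gnth unfolding chords_def by (cases u) auto
  have sy: "sym ((cross_rel D)\<^sup>*)" using sym_cross_rel by (rule sym_rtrancl)
  let ?p = "map_prod f f p"
  have qp: "(map_prod g g q, ?p) \<in> (cross_rel D)\<^sup>*"
    using pq chf[OF p] chg[OF q] unfolding cross_rel_def by auto
  have reach: "(u, ?p) \<in> (cross_rel D)\<^sup>*" if "u \<in> chords D" for u
  proof -
    obtain a b where u: "u = (a, b)" "a < b" "b < length D" "D ! a = b" using \<open>u \<in> chords D\<close> unfolding chords_def by auto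
    from cover[of a] u consider i where "i < length A" "a = f i" | i where "i < length B" "a = g i" by fastforce
    then show ?thesis
    proof cases
      case 1
      then have "b = f (A ! i)" using fnth u by simp
      moreover have "i < A ! i"
        using f[of "A ! i" i] 1 u(2) \<open>b = f (A ! i)\<close> diagramD(2)[OF dA, of i] by (metis linorder_neqE_nat order.asym)
      ultimately have "u = map_prod f f (i, A ! i)" "(i, A ! i) \<in> chords A"
        using u 1 diagramD(1)[OF dA, of i] by (auto simp: chords_def)
      then show ?thesis using cross_rel_embed[of A f D, OF f flen fnth] con(1) p
        unfolding connected_diagram_def by metis
    next
      case 2
      then have "b = g (B ! i)" using gnth u by simp
      moreover have "i < B ! i"
        using g[of "B ! i" i] 2 u(2) \<open>b = g (B ! i)\<close> diagramD(2)[OF dB, of i] by (metis linorder_neqE_nat order.asym)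
      ultimately have "u = map_prod g g (i, B ! i)" "(i, B ! i) \<in> chords B"
        using u 2 diagramD(1)[OF dB, of i] by (auto simp: chords_def)
      then have "(u, map_prod g g q) \<in> (cross_rel D)\<^sup>*" using cross_rel_embed[of B g D, OF g glen gnth] con(2) q
        unfolding connected_diagram_def by metis
      then show ?thesis using qp by (rule rtrancl_trans)
    qed
  qed
  show ?thesis unfolding connected_diagram_def
    using D reach symD[OF sy] rtrancl_trans by metis
qed

lemma connected_one_chord: "connected_diagram one_chord"
proof -
  have "chords one_chord = {(0, 1)}"
    unfolding chords_def one_chord_def by (auto simp: less_Suc_eq nth_Cons split: nat.splits)
  then show ?thesis unfolding connected_diagram_def
    using indecomposableD(1,2)[OF indecomposable_one_chord] by auto
qed

text \<open>The prefix of length \<open>i\<close> is not closed, so some chord passes over interval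
  \<open>i\<close>; a root chord ending in that interval crosses it.\<close>

lemma indecomposable_chord_over:
  assumes "indecomposable C" "1 \<le> i" "i < length C"
  obtains a b where "(a, b) \<in> chords C" "a < i" "i \<le> b"
proof -
  obtain a where "a < i" "\<not> C ! a < i" using indecomposableD(3)[OF assms(1), of i] assms(2,3) by fastforce
  then show ?thesis using that[of a "C ! a"] diagramD(1)[of C a] indecomposableD(1)[OF assms(1)] assms(3)
    by (auto simp: chords_def)
qed

lemma connected_dR:
  assumes C: "connected_diagram C" "indecomposable C" and i: "1 \<le> i" "i < length C"
  shows "connected_diagram (dR i C)"
proof -
  define f where "f = (\<lambda>n::nat. if n = 0 then 0 else i + 1)"
  obtain a b where ab: "(a, b) \<in> chords C" "a < i" "i \<le> b" using indecomposable_chord_over[OF C(2) i] .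
  have dg: "is_diagram C" using C(2) indecomposableD by auto
  have il: "i \<le> length C" using i by simp
  show ?thesis
  proof (rule connected_diagram_amalgam[OF _ _ connected_one_chord C(1), where f=f and g="liftR i" and p="(0,1)" and q="(a,b)"])
    show "is_diagram (dR i C)" using is_diagram_dR[OF dg il] .
    show "dR i C \<noteq> []" by (metis length_dR list.size(3) add_is_0 zero_neq_numeral)
    fix n assume n: "n < length (dR i C)"
    then have n': "n < length C + 2" by simp
    show "n \<in> f ` {..<length one_chord} \<union> liftR i ` {..<length C}"
      by (cases rule: dR_index_cases[OF n' il]) (auto simp: one_chord_def f_def image_iff)
  next
    fix n assume "n < length one_chord"
    then show "dR i C ! f n = f (one_chord ! n)"
      using dR_root_end[OF il] by (auto simp: one_chord_def f_def less_Suc_eq)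
  qed (use i ab dR_lift in \<open>auto simp: f_def one_chord_def liftR_def chords_def crosses_def\<close>)
qed

lemma connected_star:
  assumes C1: "connected_diagram (dR l Ch)" "is_diagram Ch" "1 \<le> l" "l \<le> length Ch"
    and C2: "connected_diagram C2" "indecomposable C2" and i: "1 \<le> i" "i < length C2"
  shows "connected_diagram (dR (i + l) (dIns C2 l Ch))" (is "connected_diagram ?D")
proof -
  let ?m = "length C2"
  have dg: "is_diagram C2" using C2(2) indecomposableD by auto
  have il: "i + l \<le> length (dIns C2 l Ch)" using i C1 by simp
  \<comment> \<open>The end of the root chord of \<open>dR l Ch\<close> sits in interval
    \<open>l\<close> of \<open>Ch\<close>, where \<open>C2\<close> is inserted. \<open>f\<close>
    slides it into interval \<open>i\<close> of \<open>C2\<close>, past points of \<open>C2\<close>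
    only, so the order of the points of \<open>dR l Ch\<close> is kept.\<close>
  define f where "f = (\<lambda>n. if n \<le> l then n else if n = l + 1 then i + l + 1 else n + ?m)"
  define g where "g = (\<lambda>n. liftR (i + l) (l + n))"
  have fl: "f (liftR l n) = liftR (i + l) (liftI l ?m n)" for n
    using i by (auto simp: f_def liftR_def liftI_def)
  have f0: "f 0 = 0" "f (l + 1) = i + l + 1" by (auto simp: f_def)
  obtain a b where ab: "(a, b) \<in> chords C2" "a < i" "i \<le> b" using indecomposable_chord_over[OF C2(2) i] .
  show ?thesis
  proof (rule connected_diagram_amalgam[OF _ _ C1(1) C2(1), where f=f and g=g and p="(0,l+1)" and q="(a,b)"])
    show "is_diagram ?D" using is_diagram_dR[OF is_diagram_dIns[OF C1(2) dg C1(4)] il] .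
    show "?D \<noteq> []" by (metis length_dR list.size(3) add_is_0 zero_neq_numeral)
    show "f m < f n" if "m < n" "n < length (dR l Ch)" for m n
      using that i by (auto simp: f_def)
    show "f n < length ?D" if "n < length (dR l Ch)" for n using that i C1 by (auto simp: f_def)
    show "?D ! f n = f (dR l Ch ! n)" if n: "n < length (dR l Ch)" for n
    proof -
      have n': "n < length Ch + 2" using n by simp
      show ?thesis
      proof (cases rule: dR_index_cases[OF n' C1(4)])
        case 1 then show ?thesis using f0 by simp
      next
        case 2 then show ?thesis using f0 dR_root_end[OF C1(4)] dR_root_end[OF il] by simp
      next
        case (3 h)
        have "liftI l ?m h < length (dIns C2 l Ch)" using 3 by (auto simp: liftI_def)
        then have "?D ! f n = liftR (i + l) (liftI l ?m (Ch ! h))"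
          using 3 by (simp add: fl dR_lift dIns_lift)
        then show ?thesis using 3 by (simp add: fl dR_lift)
      qed
    qed
    show "g m < g n" if "m < n" "n < length C2" for m n using that by (auto simp: g_def liftR_def)
    show "g n < length ?D" if "n < length C2" for n using that C1 by (auto simp: g_def liftR_def)
    show "?D ! g n = g (C2 ! n)" if "n < length C2" for n
      using that C1 unfolding g_def by (simp add: dR_lift dIns_inner)
    show "n \<in> f ` {..<length (dR l Ch)} \<union> g ` {..<length C2}" if n: "n < length ?D" for n
    proof -
      have n': "n < length (dIns C2 l Ch) + 2" using n by simp
      show ?thesis
      proof (cases rule: dR_index_cases[OF n' il])
        case 1 then show ?thesis using f0(1) by (metis UnCI imageI lessThan_iff length_dR add_2_eq_Suc' zero_less_Suc)
      next
        case 2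
        moreover have "l + 1 < length (dR l Ch)" using C1 by simp
        ultimately show ?thesis using f0(2) by (metis UnCI imageI lessThan_iff)
      next
        case (3 h)
        then have h: "h < length Ch + ?m" by simp
        show ?thesis
        proof (cases rule: dIns_index_cases[OF h C1(4)])
          case (1 j)
          then have "n = f (liftR l j)" "liftR l j < length Ch + 2" using 3 fl by (auto simp: liftR_def)
          then show ?thesis by auto
        next
          case (2 j) then show ?thesis using 3 by (auto simp: g_def)
        qed
      qed
    qed
    show "(0, l + 1) \<in> chords (dR l Ch)" using C1 by (simp add: chords_def)
    show "crosses (map_prod f f (0, l + 1)) (map_prod g g (a, b))"
      using ab f0 by (auto simp: crosses_def g_def liftR_def)
  qed (use ab in auto)
qed

section \<open>Rooted maps, bridges and isomorphisms\<close>

text \<open>Cutting leaves dangling half-edges besides the root, so the maps met by the labeling are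
  no longer closed. These are the properties that the cut set argument needs and that cutting
  preserves.\<close>

definition perm_inv :: "nat set \<Rightarrow> (nat \<Rightarrow> nat) \<Rightarrow> (nat \<Rightarrow> nat) \<Rightarrow> bool" where
  "perm_inv H s a \<longleftrightarrow> (\<forall>h\<in>H. s h \<in> H \<and> a h \<in> H \<and> a (a h) = h)"

text \<open>\<open>U\<close> is the side of \<open>e\<close> once its edge is removed: the only exit
  from \<open>U\<close> is \<open>a\<close> at \<open>e\<close>. As \<open>e\<close> is inside and
  \<open>a e\<close> outside, dangling half-edges have no cut set.\<close>

definition cutset :: "nat set \<Rightarrow> (nat \<Rightarrow> nat) \<Rightarrow> (nat \<Rightarrow> nat) \<Rightarrow> nat \<Rightarrow> nat set \<Rightarrow> bool" where
  "cutset H s a e U \<longleftrightarrow> U \<subseteq> H \<and> e \<in> U \<and> a e \<notin> U \<and>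
     (\<forall>u\<in>U. s u \<in> U) \<and> (\<forall>u\<in>U. u \<noteq> e \<longrightarrow> a u \<in> U)"

abbreviation "mcutset M \<equiv> cutset (mH M) (msig M)"
abbreviation "mbridge M \<equiv> is_bridge (mH M) (msig M)"
abbreviation "mperm_inv M \<equiv> perm_inv (mH M) (msig M)"

lemma rtrancl_gen_rel_closed:
  assumes "(x, y) \<in> (gen_rel H s a)\<^sup>*" "x \<in> U" "\<And>u. u \<in> U \<Longrightarrow> s u \<in> U \<and> a u \<in> U"
  shows "y \<in> U"
  using assms(1,2) by (induction rule: rtrancl_induct) (auto simp: gen_rel_def assms(3))

text \<open>The half-edges reachable from \<open>e\<close> after the cut form a cut set; conversely
  no path leaves a cut set once its edge is cut.\<close>

lemma is_bridge_iff:
  assumes "perm_inv H s a"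
  shows "is_bridge H s a e \<longleftrightarrow> (\<exists>U. cutset H s a e U)"
proof
  assume b: "is_bridge H s a e"
  let ?R = "gen_rel H s (cut a e)"
  let ?U = "{u. (e, u) \<in> ?R\<^sup>*}"
  have e: "e \<in> H" "a e \<noteq> e" "a e \<notin> ?U" using b by (auto simp: is_bridge_def)
  have sub: "?U \<subseteq> H"
  proof
    fix u assume "u \<in> ?U"
    then have "(e, u) \<in> ?R\<^sup>*" by simp
    then show "u \<in> H"
      by (rule rtrancl_gen_rel_closed) (use e assms in \<open>auto simp: cut_def perm_inv_def\<close>)
  qed
  have "s u \<in> ?U" if "u \<in> ?U" for u
    using that sub by (auto simp: gen_rel_def intro: rtrancl_into_rtrancl)
  moreover have "a u \<in> ?U" if "u \<in> ?U" "u \<noteq> e" for u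
  proof -
    have "(u, cut a e u) \<in> ?R" using that sub by (auto simp: gen_rel_def)
    \<comment> \<open>\<open>cut a e\<close> differs from \<open>a\<close> only at \<open>e\<close>
      and \<open>a e\<close>: the former is excluded by assumption, the latter is not
      reachable.\<close>
    moreover have "cut a e u = a u" using that e(3) by (auto simp: cut_def)
    ultimately show ?thesis using that(1) by (auto intro: rtrancl_into_rtrancl)
  qed
  ultimately have "cutset H s a e ?U" using e sub unfolding cutset_def by blast
  then show "\<exists>U. cutset H s a e U" by blast
next
  assume "\<exists>U. cutset H s a e U"
  then obtain U where U: "cutset H s a e U" by blast
  have "a e \<in> U" if "(e, a e) \<in> (gen_rel H s (cut a e))\<^sup>*"
    by (rule rtrancl_gen_rel_closed[OF that]) (use U in \<open>auto simp: cutset_def cut_def\<close>)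
  then show "is_bridge H s a e" using U unfolding is_bridge_def cutset_def by auto
qed

text \<open>On a finite set an injective map sends a closed subset onto itself, so closure under
  \<open>s\<close> also holds backwards. This permits the passage to complements in
  \<open>cutset_compl\<close>.\<close>

lemma closed_perm_backward:
  assumes "finite H" "bij_betw s H H" "U \<subseteq> H" "\<And>u. u \<in> U \<Longrightarrow> s u \<in> U" "h \<in> H" "s h \<in> U"
  shows "h \<in> U"
proof -
  have inj: "inj_on s H" using assms(2) by (simp add: bij_betw_def)
  have "s ` U = U"
    using assms(1,3,4) inj by (intro endo_inj_surj) (auto intro: finite_subset inj_on_subset)
  then obtain u where "u \<in> U" "s u = s h" using assms(6) by (metis imageE)
  then show ?thesis using inj_onD[OF inj, of u h] assms(3,5) by auto
qed

lemma cutset_compl: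
  assumes "perm_inv H s a" "finite H" "bij_betw s H H" "cutset H s a e U"
  shows "cutset H s a (a e) (H - U)"
proof -
  note c = assms(4)[unfolded cutset_def] and p = assms(1)[unfolded perm_inv_def]
  have e: "e \<in> H" "a (a e) = e" using c p by auto
  have "s u \<in> H - U" if "u \<in> H - U" for u
    using closed_perm_backward[OF assms(2,3), of U u] c p that by auto
  moreover have "a u \<in> H - U" if "u \<in> H - U" "u \<noteq> a e" for u
  proof -
    have "a u \<in> H" "a (a u) = u" using p that by auto
    then show ?thesis using that c by (metis DiffE DiffI)
  qed
  ultimately show ?thesis using c p e unfolding cutset_def by auto
qed

text \<open>Transitivity becomes an induction principle, a nonempty closed set being everything; it
  is used below only in this form.\<close>

lemma rooted_map_iff:
  "rooted_map M \<longleftrightarrow> finite (mH M) \<and> mroot M \<in> mH M \<and> bij_betw (msig M) (mH M) (mH M) \<and>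
     (\<forall>h\<in>mH M. malp M h \<in> mH M \<and> malp M (malp M h) = h) \<and> malp M (mroot M) = mroot M \<and>
     (\<forall>h\<in>mH M. malp M h = h \<longrightarrow> h = mroot M) \<and>
     (\<forall>U. U \<subseteq> mH M \<and> U \<noteq> {} \<and> (\<forall>u\<in>U. msig M u \<in> U \<and> malp M u \<in> U) \<longrightarrow> U = mH M)"
  (is "_ \<longleftrightarrow> ?A \<and> ?r \<and> ?B \<and> ?C \<and> ?D \<and> ?E \<and> ?F")
proof -
  let ?R = "gen_rel (mH M) (msig M) (malp M)"
  have key: "(\<forall>x\<in>mH M. \<forall>y\<in>mH M. (x, y) \<in> ?R\<^sup>*) \<longleftrightarrow> ?F" (is "?L \<longleftrightarrow> _") if B: ?B and C: ?C
  proof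
    assume L: ?L
    show ?F
    proof (intro allI impI)
      fix U assume U: "U \<subseteq> mH M \<and> U \<noteq> {} \<and> (\<forall>u\<in>U. msig M u \<in> U \<and> malp M u \<in> U)"
      then obtain u where u: "u \<in> U" by blast
      have "y \<in> U" if "y \<in> mH M" for y
        using rtrancl_gen_rel_closed[of u y "mH M" "msig M" "malp M" U] L U u that by blast
      then show "U = mH M" using U by blast
    qed
  next
    assume F: ?F
    show ?L
    proof (intro ballI)
      fix x y assume x: "x \<in> mH M" and y: "y \<in> mH M"
      let ?U = "{u \<in> mH M. (x, u) \<in> ?R\<^sup>*}"
      have "msig M u \<in> ?U \<and> malp M u \<in> ?U" if "u \<in> ?U" for u
        using that B C bij_betwE[OF B] by (auto simp: gen_rel_def intro: rtrancl_into_rtrancl)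
      then have "?U \<subseteq> mH M \<and> ?U \<noteq> {} \<and> (\<forall>u\<in>?U. msig M u \<in> ?U \<and> malp M u \<in> ?U)"
        using x by blast
      then have "?U = mH M" by (rule F[THEN spec, THEN mp])
      then show "(x, y) \<in> ?R\<^sup>*" using y by blast
    qed
  qed
  have "(A \<and> r \<and> B \<and> C \<and> D \<and> E \<and> L) = (A \<and> r \<and> B \<and> C \<and> D \<and> E \<and> F)"
    if "B \<Longrightarrow> C \<Longrightarrow> L = F" for A r B C D E L F using that by blast
  then show ?thesis unfolding rooted_map_def using key .
qed

lemma rooted_mapD:
  assumes "rooted_map M"
  shows "finite (mH M)" "mroot M \<in> mH M" "bij_betw (msig M) (mH M) (mH M)"
    "mperm_inv M (malp M)" "malp M (mroot M) = mroot M"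
    "h \<in> mH M \<Longrightarrow> malp M h = h \<Longrightarrow> h = mroot M"
    "h \<in> mH M \<Longrightarrow> msig M h \<in> mH M" "h \<in> mH M \<Longrightarrow> malp M h \<in> mH M"
    "h \<in> mH M \<Longrightarrow> malp M (malp M h) = h"
    "h \<in> mH M \<Longrightarrow> k \<in> mH M \<Longrightarrow> msig M h = msig M k \<Longrightarrow> h = k"
    "\<lbrakk>U \<subseteq> mH M; U \<noteq> {}; \<And>u. u \<in> U \<Longrightarrow> msig M u \<in> U; \<And>u. u \<in> U \<Longrightarrow> malp M u \<in> U\<rbrakk> \<Longrightarrow> U = mH M"
proof -
  have b: "bij_betw (msig M) (mH M) (mH M)" using assms rooted_map_iff by blast
  show "h \<in> mH M \<Longrightarrow> k \<in> mH M \<Longrightarrow> msig M h = msig M k \<Longrightarrow> h = k"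
    using b by (meson bij_betw_def inj_onD)
  show "mperm_inv M (malp M)" "h \<in> mH M \<Longrightarrow> msig M h \<in> mH M"
    using assms bij_betwE[OF b] unfolding rooted_map_iff perm_inv_def by auto
qed (use assms in \<open>auto simp: rooted_map_iff\<close>)

lemma rooted_mapI:
  assumes "finite (mH M)" "mroot M \<in> mH M" "\<And>h. h \<in> mH M \<Longrightarrow> msig M h \<in> mH M"
    "inj_on (msig M) (mH M)" "\<And>h. h \<in> mH M \<Longrightarrow> malp M h \<in> mH M \<and> malp M (malp M h) = h"
    "malp M (mroot M) = mroot M" "\<And>h. h \<in> mH M \<Longrightarrow> malp M h = h \<Longrightarrow> h = mroot M"
    "\<And>U. \<lbrakk>U \<subseteq> mH M; U \<noteq> {}; \<And>u. u \<in> U \<Longrightarrow> msig M u \<in> U; \<And>u. u \<in> U \<Longrightarrow> malp M u \<in> U\<rbrakk>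
      \<Longrightarrow> mH M \<subseteq> U"
  shows "rooted_map M"
proof -
  have "msig M ` mH M = mH M" using assms(1,3,4) by (intro endo_inj_surj) auto
  then have "bij_betw (msig M) (mH M) (mH M)" using assms(4) by (simp add: bij_betw_def)
  then show ?thesis unfolding rooted_map_iff using assms by (metis subset_antisym)
qed

text \<open>Off the root the half-edges come in pairs, while the root is an edge by itself. Corners
  being named by half-edges, this is the bound \<open>2 * msize M - 1\<close> on labels.\<close>

lemma rooted_card_msize:
  assumes "rooted_map M"
  shows "card (mH M) = 2 * msize M - 1" "msize M \<ge> 1"
proof -
  note r = rooted_mapD[OF assms]
  let ?A = "mH M - {mroot M}"
  let ?f = "\<lambda>h. {h, malp M h}"
  have inv: "malp M h \<in> ?A" "malp M h \<noteq> h" if "h \<in> ?A" for h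
  proof -
    have "malp M h \<noteq> mroot M" using that r(9)[of h] r(5) by auto
    then show "malp M h \<in> ?A" using that r(8)[of h] by auto
    show "malp M h \<noteq> h" using that r(6)[of h] by auto
  qed
  have "card ?A = 2 * card (?f ` ?A)"
    by (rule card_involution) (use r(1,9) inv in auto)
  moreover have "?f ` mH M = insert {mroot M} (?f ` ?A)" using r(2,5) by auto
  moreover have "{mroot M} \<notin> ?f ` ?A" by auto
  ultimately have "msize M = card ?A div 2 + 1" "even (card ?A)" using r(1) by (simp_all add: msize_def)
  moreover have "card (mH M) = card ?A + 1" using r(1,2) by (metis Suc_eq_plus1 card_Suc_Diff1)
  ultimately show "card (mH M) = 2 * msize M - 1" "msize M \<ge> 1" by auto
qed

text \<open>The bijection hidden in \<open>miso\<close> is made explicit because corners have to be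
  transported along it.\<close>

definition iso_by :: "(nat \<Rightarrow> nat) \<Rightarrow> rmap \<Rightarrow> rmap \<Rightarrow> bool" where
  "iso_by f M1 M2 \<longleftrightarrow> bij_betw f (mH M1) (mH M2) \<and>
     (\<forall>h\<in>mH M1. f (msig M1 h) = msig M2 (f h) \<and> f (malp M1 h) = malp M2 (f h)) \<and>
     f (mroot M1) = mroot M2"

lemma miso_iff: "miso M1 M2 \<longleftrightarrow> (\<exists>f. iso_by f M1 M2)"
  unfolding miso_def iso_by_def by simp

lemma iso_byD:
  assumes "iso_by f M1 M2"
  shows "bij_betw f (mH M1) (mH M2)" "h \<in> mH M1 \<Longrightarrow> f (msig M1 h) = msig M2 (f h)"
    "h \<in> mH M1 \<Longrightarrow> f (malp M1 h) = malp M2 (f h)" "f (mroot M1) = mroot M2"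
    "h \<in> mH M1 \<Longrightarrow> f h \<in> mH M2" "h \<in> mH M1 \<Longrightarrow> k \<in> mH M1 \<Longrightarrow> f h = f k \<longleftrightarrow> h = k"
    "f ` mH M1 = mH M2"
proof -
  show b: "bij_betw f (mH M1) (mH M2)" using assms by (simp add: iso_by_def)
  show "h \<in> mH M1 \<Longrightarrow> f h \<in> mH M2" "f ` mH M1 = mH M2" using b by (auto simp: bij_betw_def)
  show "h \<in> mH M1 \<Longrightarrow> k \<in> mH M1 \<Longrightarrow> f h = f k \<longleftrightarrow> h = k"
    using b by (meson bij_betw_def inj_onD)
qed (use assms in \<open>auto simp: iso_by_def\<close>)

lemma miso_refl: "miso M M"
  unfolding miso_iff iso_by_def by (rule exI[of _ id]) auto

lemma miso_trans: "miso M1 M2 \<Longrightarrow> miso M2 M3 \<Longrightarrow> miso M1 M3"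
proof -
  assume "miso M1 M2" "miso M2 M3"
  then obtain f g where f: "iso_by f M1 M2" and g: "iso_by g M2 M3" unfolding miso_iff by blast
  have "iso_by (g \<circ> f) M1 M3" unfolding iso_by_def
    using bij_betw_trans[OF iso_byD(1)[OF f] iso_byD(1)[OF g]] iso_byD(2-5)[OF f] iso_byD(2-4)[OF g] by simp
  then show ?thesis unfolding miso_iff by blast
qed

lemma iso_by_inv:
  assumes "iso_by f M1 M2" "rooted_map M1"
  shows "iso_by (inv_into (mH M1) f) M2 M1"
proof -
  let ?g = "inv_into (mH M1) f"
  note f = iso_byD[OF assms(1)] and r = rooted_mapD[OF assms(2)]
  have g: "?g h \<in> mH M1" "f (?g h) = h" if "h \<in> mH M2" for h
    using that f(7) by (metis inv_into_into, metis f_inv_into_f)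
  have gf: "?g (f h) = h" if "h \<in> mH M1" for h using that f(1) by (simp add: bij_betw_inv_into_left)
  have "?g (msig M2 h) = msig M1 (?g h)" "?g (malp M2 h) = malp M1 (?g h)" if "h \<in> mH M2" for h
    using gf[of "msig M1 (?g h)"] gf[of "malp M1 (?g h)"] g[OF that] f(2,3)[of "?g h"] r(7,8) by auto
  then show ?thesis unfolding iso_by_def
    using bij_betw_inv_into[OF f(1)] gf[OF r(2)] f(4) by auto
qed

lemma miso_sym: "miso M1 M2 \<Longrightarrow> rooted_map M1 \<Longrightarrow> miso M2 M1"
  using iso_by_inv unfolding miso_iff by blast

lemma rooted_map_iso:
  assumes "iso_by f M1 M2" "rooted_map M1"
  shows "rooted_map M2"
proof (rule rooted_mapI)
  let ?g = "inv_into (mH M1) f"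
  note f = iso_byD[OF assms(1)] and r = rooted_mapD[OF assms(2)]
  have im: "\<exists>k\<in>mH M1. h = f k" if "h \<in> mH M2" for h using that f(7) by blast
  show "finite (mH M2)" using r(1) f(7) by (metis finite_imageI)
  show "mroot M2 \<in> mH M2" using f(4,5) r(2) by metis
  show "msig M2 h \<in> mH M2" if "h \<in> mH M2" for h using im[OF that] f(2,5) r(7) by metis
  show "inj_on (msig M2) (mH M2)"
  proof (rule inj_onI)
    fix h k assume h: "h \<in> mH M2" "k \<in> mH M2" "msig M2 h = msig M2 k"
    obtain h' k' where h': "h' \<in> mH M1" "h = f h'" "k' \<in> mH M1" "k = f k'" using im h by meson
    then have "f (msig M1 h') = f (msig M1 k')" using f(2) h by simp
    then show "h = k" using f(6) r(7,10) h' by metis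
  qed
  show "malp M2 h \<in> mH M2 \<and> malp M2 (malp M2 h) = h" if "h \<in> mH M2" for h
    using im[OF that] f(3,5) r(8,9) by metis
  show "malp M2 (mroot M2) = mroot M2" using f(3,4) r(2,5) by metis
  show "h = mroot M2" if "h \<in> mH M2" "malp M2 h = h" for h
    using im[OF that(1)] that(2) f(3,4,6) r(6,8) by metis
  show "mH M2 \<subseteq> U" if U: "U \<subseteq> mH M2" "U \<noteq> {}" "\<And>u. u \<in> U \<Longrightarrow> msig M2 u \<in> U" "\<And>u. u \<in> U \<Longrightarrow> malp M2 u \<in> U" for U
  proof -
    have "{h \<in> mH M1. f h \<in> U} = mH M1"
    proof (rule r(11))
      show "{h \<in> mH M1. f h \<in> U} \<noteq> {}" using U(1,2) im by blast
      show "msig M1 u \<in> {h \<in> mH M1. f h \<in> U}" "malp M1 u \<in> {h \<in> mH M1. f h \<in> U}"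
        if "u \<in> {h \<in> mH M1. f h \<in> U}" for u
        using that U(3,4)[of "f u"] f(2,3)[of u] r(7,8)[of u] by auto
    qed auto
    then show ?thesis using im by blast
  qed
qed

lemma miso_card: "miso M1 M2 \<Longrightarrow> card (mH M1) = card (mH M2)"
  unfolding miso_iff using iso_byD(1) bij_betw_same_card by blast

text \<open>The involutions are arbitrary compatible ones, because \<open>crn_iso\<close> compares
  bridges after edges have been cut.\<close>

lemma is_bridge_iso:
  assumes f: "iso_by f M1 M2" and r: "rooted_map M1" and e: "e \<in> mH M1"
    and a: "mperm_inv M1 a1" "mperm_inv M2 a2"
    and eq: "\<And>h. h \<in> mH M1 \<Longrightarrow> a2 (f h) = f (a1 h)"
  shows "mbridge M2 a2 (f e) \<longleftrightarrow> mbridge M1 a1 e"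
proof
  note ff = iso_byD[OF f] and rr = rooted_mapD[OF r]
  have a1: "a1 h \<in> mH M1" if "h \<in> mH M1" for h using a(1) that by (simp add: perm_inv_def)
  {
    assume "mbridge M2 a2 (f e)"
    then obtain U where U: "mcutset M2 a2 (f e) U" using is_bridge_iff[OF a(2)] by blast
    have "mcutset M1 a1 e {h \<in> mH M1. f h \<in> U}"
      unfolding cutset_def
    proof (intro conjI ballI impI)
      show "e \<in> {h \<in> mH M1. f h \<in> U}" "a1 e \<notin> {h \<in> mH M1. f h \<in> U}"
        using U e eq[of e] by (auto simp: cutset_def)
      fix u assume u: "u \<in> {h \<in> mH M1. f h \<in> U}"
      show "msig M1 u \<in> {h \<in> mH M1. f h \<in> U}" using u U ff(2)[of u] rr(7)[of u] by (auto simp: cutset_def)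
      assume "u \<noteq> e"
      then show "a1 u \<in> {h \<in> mH M1. f h \<in> U}" using u U eq[of u] a1[of u] ff(6)[of u e] e by (auto simp: cutset_def)
    qed auto
    then show "mbridge M1 a1 e" using is_bridge_iff[OF a(1)] by blast
  next
    assume "mbridge M1 a1 e"
    then obtain U where U: "mcutset M1 a1 e U" using is_bridge_iff[OF a(1)] by blast
    have sub: "U \<subseteq> mH M1" using U by (simp add: cutset_def)
    then have mem: "f h \<in> f ` U \<longleftrightarrow> h \<in> U" if "h \<in> mH M1" for h
      using that ff(6) by (smt (verit) image_iff subsetD)
    have "mcutset M2 a2 (f e) (f ` U)"
      unfolding cutset_def
    proof (intro conjI ballI impI)
      show "f ` U \<subseteq> mH M2" using sub ff(5) by auto
      show "f e \<in> f ` U" using U by (simp add: cutset_def)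
      show "a2 (f e) \<notin> f ` U" using U e eq mem a1 by (simp add: cutset_def)
      fix v assume "v \<in> f ` U"
      then obtain u where u: "u \<in> U" "v = f u" "u \<in> mH M1" using sub by blast
      show "msig M2 v \<in> f ` U" using u U ff(2) by (metis cutset_def image_eqI)
      assume "v \<noteq> f e"
      then show "a2 v \<in> f ` U" using u U eq by (metis cutset_def image_eqI)
    qed
    then show "mbridge M2 a2 (f e)" using is_bridge_iff[OF a(2)] by blast
  }
qed

section \<open>The Bridge First Labeling\<close>

definition bfl_state :: "rmap \<Rightarrow> nat \<Rightarrow> nat \<times> (nat \<Rightarrow> nat)" where
  "bfl_state M i = (bfl_step M ^^ i) (mroot M, malp M)"

text \<open>\<open>crn\<close> counts the corners from 0, whereas \<open>corner\<close> follows the labels and counts from 1.\<close>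

abbreviation "crn M i \<equiv> fst (bfl_state M i)"
abbreviation "inv_at M i \<equiv> snd (bfl_state M i)"

lemma bfl_state_0 [simp]: "bfl_state M 0 = (mroot M, malp M)"
  by (simp add: bfl_state_def)

lemma bfl_state_Suc: "bfl_state M (Suc i) = bfl_step M (crn M i, inv_at M i)"
  by (simp add: bfl_state_def)

lemma corner_crn: "corner M k = crn M (k - 1)"
  by (simp add: corner_def bfl_state_def)

text \<open>Invariant of the walk. The root stays a fixed point of the current involution, so it can
  be reached only by rotating onto it.\<close>

definition bfl_valid :: "rmap \<Rightarrow> nat \<Rightarrow> (nat \<Rightarrow> nat) \<Rightarrow> bool" where
  "bfl_valid M h a \<longleftrightarrow> h \<in> mH M \<and> mperm_inv M a \<and> a (mroot M) = mroot M"

lemma perm_inv_cut: "perm_inv H s a \<Longrightarrow> e \<in> H \<Longrightarrow> perm_inv H s (cut a e)"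
proof -
  assume p: "perm_inv H s a" and e: "e \<in> H"
  have "cut a e h \<in> H \<and> cut a e (cut a e h) = h" if h: "h \<in> H" for h
  proof (cases "h = e \<or> h = a e")
    case True
    then show ?thesis using p e by (auto simp: cut_def perm_inv_def)
  next
    case False
    then have "cut a e h = a h" by (simp add: cut_def)
    moreover have "a h \<noteq> e" "a h \<noteq> a e" using False p e h unfolding perm_inv_def by metis+
    ultimately show ?thesis using p h by (simp add: cut_def perm_inv_def)
  qed
  then show ?thesis using p by (simp add: perm_inv_def)
qed

lemma bfl_valid_step:
  assumes "rooted_map M" "bfl_valid M h a" "bfl_step M (h, a) = (h', a')"
  shows "bfl_valid M h' a'"
proof -
  have e: "msig M h \<in> mH M" using assms(1,2) rooted_mapD(7) by (auto simp: bfl_valid_def)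
  then have "a (msig M h) \<in> mH M" "mperm_inv M (cut a (msig M h))"
    using assms(2) perm_inv_cut[OF _ e] by (auto simp: bfl_valid_def) (simp add: perm_inv_def)
  moreover have "cut a (msig M h) (mroot M) = mroot M" using assms(2)
    by (auto simp: cut_def bfl_valid_def)
  ultimately show ?thesis using assms(2,3) e by (auto simp: bfl_step_def Let_def bfl_valid_def split: if_splits)
qed

lemma bfl_valid_state: "rooted_map M \<Longrightarrow> bfl_valid M (crn M i) (inv_at M i)"
proof (induction i)
  case 0
  then show ?case using rooted_mapD(2,4,5)[of M] by (simp add: bfl_valid_def)
next
  case (Suc i)
  then show ?case using bfl_valid_step[OF Suc(2) Suc(1)[OF Suc(2)]] bfl_state_Suc[of M i] by (metis prod.collapse)
qed

lemma crn_in: "rooted_map M \<Longrightarrow> crn M i \<in> mH M"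
  using bfl_valid_state by (simp add: bfl_valid_def)

lemma crn_iso:
  assumes f: "iso_by f M1 M2" and r: "rooted_map M1"
  shows "crn M2 i = f (crn M1 i) \<and> (\<forall>h\<in>mH M1. inv_at M2 i (f h) = f (inv_at M1 i h))"
proof (induction i)
  case 0
  then show ?case using iso_byD(3,4)[OF f] by auto
next
  case (Suc i)
  have r2: "rooted_map M2" using rooted_map_iso[OF f r] .
  note v1 = bfl_valid_state[OF r, of i, unfolded bfl_valid_def] and v2 = bfl_valid_state[OF r2, of i, unfolded bfl_valid_def]
  define e where "e = msig M1 (crn M1 i)"
  have e: "e \<in> mH M1" using v1 rooted_mapD(7)[OF r] by (simp add: e_def)
  have fe: "msig M2 (crn M2 i) = f e" using Suc v1 iso_byD(2)[OF f] by (simp add: e_def)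
  have ae: "inv_at M1 i e \<in> mH M1" using v1 e by (simp add: perm_inv_def)
  have d: "inv_at M2 i (f e) = f e \<longleftrightarrow> inv_at M1 i e = e" using Suc e ae iso_byD(6)[OF f] by simp
  have b: "mbridge M2 (inv_at M2 i) (f e) \<longleftrightarrow> mbridge M1 (inv_at M1 i) e"
    by (rule is_bridge_iso[OF f r e]) (use v1 v2 Suc in auto)
  have c: "cut (inv_at M2 i) (f e) (f h) = f (cut (inv_at M1 i) e h)" if "h \<in> mH M1" for h
    using Suc that e ae iso_byD(6)[OF f] by (simp add: cut_def)
  show ?case unfolding bfl_state_Suc bfl_step_def Let_def fst_conv snd_conv fe e_def[symmetric]
    using d b c Suc e by simp
qed

lemma corner_iso: "iso_by f M1 M2 \<Longrightarrow> rooted_map M1 \<Longrightarrow> corner M2 k = f (corner M1 k)"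
  using crn_iso by (simp add: corner_crn)

text \<open>There are as many steps as half-edges, so injectivity makes the walk an enumeration of
  all corners; the second conjunct says that it then closes up at the root.\<close>

definition bfl_good :: "rmap \<Rightarrow> bool" where
  "bfl_good M \<longleftrightarrow> inj_on (crn M) {..<card (mH M)} \<and> crn M (card (mH M)) = mroot M"

lemma bfl_good_surj:
  assumes "bfl_good M" "rooted_map M" "h \<in> mH M"
  obtains i where "i < card (mH M)" "h = crn M i"
proof -
  have "crn M ` {..<card (mH M)} = mH M"
    by (rule card_subset_eq)
      (use assms(1) crn_in[OF assms(2)] rooted_mapD(1)[OF assms(2)] in \<open>auto simp: bfl_good_def card_image\<close>)
  then show ?thesis using that assms(3) by blast
qed

text \<open>The root is reached only by rotation, and by injectivity this happens at the last step
  alone. \<open>isI_labels\<close> needs the exact place: in an attached copy of the map the root is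
  the end of a bridge, and there the two walks part.\<close>

lemma bfl_good_msig_root:
  assumes "bfl_good M" "rooted_map M" "i < card (mH M)"
  shows "msig M (crn M i) = mroot M \<longleftrightarrow> i = card (mH M) - 1"
proof -
  note v = bfl_valid_state[OF assms(2), of i, unfolded bfl_valid_def]
  let ?e = "msig M (crn M i)" and ?a = "inv_at M i"
  have e: "?e \<in> mH M" using v rooted_mapD(7)[OF assms(2)] by simp
  have st: "crn M (Suc i) = ?e \<or> crn M (Suc i) = ?a ?e"
    unfolding bfl_state_Suc by (simp add: bfl_step_def Let_def)
  have "?e = mroot M \<longleftrightarrow> crn M (Suc i) = mroot M"
    using st v e unfolding perm_inv_def by metis
  also have "\<dots> \<longleftrightarrow> i = card (mH M) - 1"
  proof
    assume "crn M (Suc i) = mroot M"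
    then have "crn M (Suc i) = crn M 0" by simp
    then have "\<not> Suc i < card (mH M)" using assms(1) unfolding bfl_good_def inj_on_def by fastforce
    then show "i = card (mH M) - 1" using assms(3) by simp
  next
    assume "i = card (mH M) - 1"
    then have "Suc i = card (mH M)" using assms(3) by simp
    then show "crn M (Suc i) = mroot M" using assms(1) by (simp add: bfl_good_def)
  qed
  finally show ?thesis .
qed

section \<open>Adding a root edge and attaching a map\<close>

text \<open>\<open>isR M N c x y\<close>: up to the names of the new half-edges, \<open>M\<close> is \<open>R\<close> of \<open>N\<close> with the new root edge
  \<open>{x, y}\<close>, where \<open>x\<close> follows the root and \<open>y\<close> lies in the corner \<open>c\<close>. If \<open>c\<close> is the root corner, the
  new edge is a loop and \<open>y\<close> directly follows \<open>x\<close>.\<close>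

definition isR :: "rmap \<Rightarrow> rmap \<Rightarrow> nat \<Rightarrow> nat \<Rightarrow> nat \<Rightarrow> bool" where
  "isR M N c x y \<longleftrightarrow> x \<notin> mH N \<and> y \<notin> mH N \<and> x \<noteq> y \<and> c \<in> mH N \<and>
     mH M = mH N \<union> {x, y} \<and> mroot M = mroot N \<and> malp M x = y \<and> malp M y = x \<and>
     (\<forall>h\<in>mH N. malp M h = malp N h) \<and> msig M (mroot N) = x \<and>
     msig M x = (if c = mroot N then y else msig N (mroot N)) \<and> msig M y = msig N c \<and>
     (\<forall>h\<in>mH N. h \<noteq> mroot N \<longrightarrow> msig M h = (if h = c then y else msig N h))"

text \<open>\<open>isI M M' N c z g\<close>: \<open>M\<close> is \<open>N\<close> with the copy of \<open>M'\<close> under \<open>g\<close> attached by the bridge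
  \<open>{z, g (mroot M')}\<close>, where \<open>z\<close> lies in the corner \<open>c\<close> of \<open>N\<close>.\<close>

definition isI :: "rmap \<Rightarrow> rmap \<Rightarrow> rmap \<Rightarrow> nat \<Rightarrow> nat \<Rightarrow> (nat \<Rightarrow> nat) \<Rightarrow> bool" where
  "isI M M' N c z g \<longleftrightarrow> c \<in> mH N \<and> z \<notin> mH N \<and> inj_on g (mH M') \<and> z \<notin> g ` mH M' \<and>
     mH N \<inter> g ` mH M' = {} \<and> mH M = mH N \<union> {z} \<union> g ` mH M' \<and> mroot M = mroot N \<and>
     malp M z = g (mroot M') \<and> malp M (g (mroot M')) = z \<and>
     (\<forall>h\<in>mH M'. h \<noteq> mroot M' \<longrightarrow> malp M (g h) = g (malp M' h)) \<and>
     (\<forall>h\<in>mH M'. msig M (g h) = g (msig M' h)) \<and>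
     (\<forall>h\<in>mH N. malp M h = malp N h \<and> msig M h = (if h = c then z else msig N h)) \<and>
     msig M z = msig N c"

lemma isRD:
  assumes "isR M N c x y"
  shows "x \<notin> mH N" "y \<notin> mH N" "x \<noteq> y" "c \<in> mH N" "mH M = mH N \<union> {x, y}" "mroot M = mroot N"
    "malp M x = y" "malp M y = x" "h \<in> mH N \<Longrightarrow> malp M h = malp N h" "msig M (mroot N) = x"
    "msig M x = (if c = mroot N then y else msig N (mroot N))" "msig M y = msig N c"
    "h \<in> mH N \<Longrightarrow> h \<noteq> mroot N \<Longrightarrow> msig M h = (if h = c then y else msig N h)"
  using assms unfolding isR_def by blast+

lemma isID:
  assumes "isI M M' N c z g"
  shows "c \<in> mH N" "z \<notin> mH N" "inj_on g (mH M')" "h \<in> mH M' \<Longrightarrow> g h \<noteq> z" "h \<in> mH M' \<Longrightarrow> g h \<notin> mH N"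
    "mH M = mH N \<union> {z} \<union> g ` mH M'" "mroot M = mroot N"
    "malp M z = g (mroot M')" "malp M (g (mroot M')) = z"
    "h \<in> mH M' \<Longrightarrow> h \<noteq> mroot M' \<Longrightarrow> malp M (g h) = g (malp M' h)"
    "h \<in> mH M' \<Longrightarrow> msig M (g h) = g (msig M' h)"
    "h \<in> mH N \<Longrightarrow> malp M h = malp N h" "h \<in> mH N \<Longrightarrow> msig M h = (if h = c then z else msig N h)"
    "msig M z = msig N c"
  using assms unfolding isI_def by blast+

lemma isI_inj: "isI M M' N c z g \<Longrightarrow> h \<in> mH M' \<Longrightarrow> k \<in> mH M' \<Longrightarrow> g h = g k \<longleftrightarrow> h = k"
  using isID(3) by (meson inj_onD)

lemma isR_card:
  assumes "isR M N c x y" "rooted_map N"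
  shows "card (mH M) = card (mH N) + 2"
proof -
  have "mH M = insert x (insert y (mH N))" using isRD(5)[OF assms(1)] by auto
  then show ?thesis using isRD(1-3)[OF assms(1)] rooted_mapD(1)[OF assms(2)] by simp
qed

lemma isI_card:
  assumes "isI M M' N c z g" "rooted_map N" "rooted_map M'"
  shows "card (mH M) = card (mH N) + 1 + card (mH M')"
proof -
  note d = isID[OF assms(1)]
  have f: "finite (mH N)" "finite (g ` mH M')" using rooted_mapD(1) assms(2,3) by auto
  have "mH M = insert z (mH N \<union> g ` mH M')" using d(6) by auto
  moreover have "z \<notin> mH N \<union> g ` mH M'" "mH N \<inter> g ` mH M' = {}" using d(2,4,5) by auto
  ultimately show ?thesis using f card_image[OF d(3)] by (simp add: card_Un_disjoint)
qed

text \<open>A step of \<open>msig N\<close> is a walk in \<open>M\<close> that passes over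
  \<open>x\<close> and \<open>y\<close> where they are in the way, so a closed set of
  \<open>M\<close> meets \<open>N\<close> in a closed set.\<close>

lemma isR_rooted:
  assumes "isR M N c x y" "rooted_map N"
  shows "rooted_map M"
proof (rule rooted_mapI)
  note d = isRD[OF assms(1)] and r = rooted_mapD[OF assms(2)]
  have cs: "h \<in> mH N \<or> h = x \<or> h = y" if "h \<in> mH M" for h using that d(5) by auto
  have sx: "msig N h \<noteq> x" "msig N h \<noteq> y" if "h \<in> mH N" for h using r(7)[OF that] d(1,2) by auto
  show "finite (mH M)" using d(5) r(1) by simp
  show "mroot M \<in> mH M" using d(5,6) r(2) by simp
  have cs4: "(h \<in> mH N \<and> h \<noteq> mroot N) \<or> h = mroot N \<or> h = x \<or> h = y" if "h \<in> mH M" for h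
    using cs[OF that] by blast
  have mx: "x \<in> mH M" "y \<in> mH M" "\<And>h. h \<in> mH N \<Longrightarrow> h \<in> mH M" using d(5) by simp_all
  note sr = sx[OF r(2)] and sc = sx[OF d(4)]
  show "msig M h \<in> mH M" if "h \<in> mH M" for h
    using cs4[OF that]
  proof (elim disjE)
    assume "h \<in> mH N \<and> h \<noteq> mroot N"
    then show ?thesis using d(13)[of h] r(7)[of h] mx by simp
  qed (use d(4,10-12) mx r(2,7) in simp_all)
  show "inj_on (msig M) (mH M)"
  proof (rule inj_onI)
    fix h k assume hk: "h \<in> mH M" "k \<in> mH M" "msig M h = msig M k"
    \<comment> \<open>\<open>x\<close> is the image of the root. \<open>N1\<close> to
      \<open>N6\<close> compare the images of the four kinds of half-edges: ordinary ones, the root,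
      \<open>x\<close> and \<open>y\<close>.\<close>
    have N1: "msig M h \<noteq> x" if "h \<in> mH N" "h \<noteq> mroot N" for h using d(3) d(13)[OF that] sx[OF that(1)] by simp
    have N2: "msig M x \<noteq> x" "msig M y \<noteq> x" using d(3,11,12) sr sc by simp_all
    have N3: "msig M x \<noteq> msig M y" using d(11,12) r(10)[OF r(2) d(4)] sc by (cases "c = mroot N") auto
    have N4: "msig M h \<noteq> msig M x" if "h \<in> mH N" "h \<noteq> mroot N" for h
      using d(13)[OF that] sx[OF that(1)] sr r(10)[OF that(1) r(2)] that(2) d(11) by (cases "h = c"; cases "c = mroot N") auto
    have N5: "msig M h \<noteq> msig M y" if "h \<in> mH N" "h \<noteq> mroot N" for h
      using d(13)[OF that] sx[OF that(1)] sc r(10)[OF that(1) d(4)] d(12) by (cases "h = c") auto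
    have N6: "h = k" if "h \<in> mH N" "h \<noteq> mroot N" "k \<in> mH N" "k \<noteq> mroot N" "msig M h = msig M k" for h k
      using that(5) d(13)[OF that(1,2)] d(13)[OF that(3,4)] sx[OF that(1)] sx[OF that(3)] r(10)[OF that(1,3)]
      by (cases "h = c"; cases "k = c") simp_all
    show "h = k" using cs4[OF hk(1)] cs4[OF hk(2)] hk(3) N1 N2 N3 N4 N5 N6 d(10) by metis
  qed
  show "malp M h \<in> mH M \<and> malp M (malp M h) = h" if "h \<in> mH M" for h
    using cs[OF that] by (elim disjE) (use d(7,8,9) r(8,9) mx in simp_all)
  show "malp M (mroot M) = mroot M" using d(6) d(9)[OF r(2)] r(5) by simp
  show "h = mroot M" if "h \<in> mH M" "malp M h = h" for h
    using cs[OF that(1)] by (elim disjE) (use that(2) d(3,6-9) r(6) in simp_all)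
  fix U assume U: "U \<subseteq> mH M" "U \<noteq> {}" "\<And>u. u \<in> U \<Longrightarrow> msig M u \<in> U" "\<And>u. u \<in> U \<Longrightarrow> malp M u \<in> U"
  let ?W = "U \<inter> mH N"
  have sN: "msig N h \<in> ?W" if "h \<in> ?W" for h
  proof -
    have y: "msig N c \<in> U" if "y \<in> U" using U(3)[OF that] d(12) by simp
    have "msig N h \<in> U"
    proof (cases "h = mroot N")
      case True
      then have "msig M x \<in> U" using U(3)[of h] U(3)[of x] that d(10) by simp
      then show ?thesis using True d(11) y by (cases "c = mroot N") simp_all
    next
      case False
      then show ?thesis using U(3)[of h] d(13)[of h] that y by (cases "h = c") simp_all
    qed
    then show ?thesis using that r(7) by simp
  qed
  have "?W \<noteq> {}"
  proof -
    obtain u where u: "u \<in> U" using U(2) by auto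
    have "y \<in> U" if "x \<in> U" using U(4)[OF that] d(7) by simp
    then have "u \<in> mH N \<or> msig N c \<in> U" using U(3)[of y] cs[of u] u U(1) d(12) by (metis subsetD)
    then show ?thesis using u r(7)[OF d(4)] by blast
  qed
  moreover have "malp N h \<in> ?W" if "h \<in> ?W" for h using that U(4)[of h] d(9)[of h] r(8)[of h] by simp
  ultimately have "?W = mH N" using sN by (intro r(11)) simp_all
  then have "mH N \<subseteq> U" by auto
  then have "x \<in> U" using U(3)[of "mroot N"] r(2) d(10) by (metis subsetD)
  then have "y \<in> U" using U(4)[of x] d(7) by simp
  then show "mH M \<subseteq> U" using d(5) \<open>x \<in> U\<close> \<open>mH N \<subseteq> U\<close> by auto
qed

lemma isI_rooted:
  assumes "isI M M' N c z g" "rooted_map N" "rooted_map M'"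
  shows "rooted_map M"
proof (rule rooted_mapI)
  note d = isID[OF assms(1)] and r = rooted_mapD[OF assms(2)] and r' = rooted_mapD[OF assms(3)]
  note gi = isI_inj[OF assms(1)]
  have cs: "h \<in> mH N \<or> h = z \<or> (\<exists>k\<in>mH M'. h = g k)" if "h \<in> mH M" for h using that d(6) by auto
  have mem: "h \<in> mH M" if "h \<in> mH N" for h using that d(6) by simp
  have memz: "z \<in> mH M" using d(6) by simp
  have memg: "g h \<in> mH M" if "h \<in> mH M'" for h using that d(6) by simp
  have sx: "msig N h \<noteq> z" if "h \<in> mH N" for h using r(7)[OF that] d(2) by auto
  show "finite (mH M)" using d(6) r(1) r'(1) by simp
  show "mroot M \<in> mH M" using d(7) r(2) mem by simp
  show sM: "msig M h \<in> mH M" if "h \<in> mH M" for h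
    using cs[OF that] d(11,13,14) r(7) r'(7) mem memz memg d(1) by (metis (full_types))
  show "inj_on (msig M) (mH M)"
  proof (rule inj_onI)
    fix h k assume hk: "h \<in> mH M" "k \<in> mH M" "msig M h = msig M k"
    have ng: "msig M h = g (msig M' k) \<Longrightarrow> k \<in> mH M' \<Longrightarrow> h \<in> mH M \<Longrightarrow> h = g k" for h k
    proof -
      assume e: "msig M h = g (msig M' k)" and k: "k \<in> mH M'" and h: "h \<in> mH M"
      have gk: "g (msig M' k) \<notin> mH N" "g (msig M' k) \<noteq> z" using d(4,5) r'(7)[OF k] by auto
      then have "msig M h \<notin> mH N" "msig M h \<noteq> z" using e by auto
      then have "h \<notin> mH N" "h \<noteq> z" using d(13)[of h] d(14) r(7)[of h] r(7)[OF d(1)] by (auto split: if_splits)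
      then obtain l where l: "l \<in> mH M'" "h = g l" using cs[OF h] by auto
      then have "msig M' l = msig M' k" using e d(11) gi[of "msig M' l" "msig M' k"] r'(7) k by simp
      then show "h = g k" using r'(10) l k by metis
    qed
    have I1: "msig M h \<noteq> msig M z" if "h \<in> mH N" for h
      using d(13)[OF that] sx[OF that] sx[OF d(1)] r(10)[OF that d(1)] d(14) by (cases "h = c") auto
    have I2: "h = k" if "h \<in> mH N" "k \<in> mH N" "msig M h = msig M k" for h k
      using that(3) d(13)[OF that(1)] d(13)[OF that(2)] sx[OF that(1)] sx[OF that(2)] r(10)[OF that(1,2)]
      by (cases "h = c"; cases "k = c") simp_all
    show "h = k" using cs[OF hk(1)] cs[OF hk(2)] hk I1 I2 ng d(11) by metis
  qed
  have anr: "malp M' h \<in> mH M' \<and> malp M' h \<noteq> mroot M'" if "h \<in> mH M'" "h \<noteq> mroot M'" for h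
    using that r'(5,8,9) by metis
  show "malp M h \<in> mH M \<and> malp M (malp M h) = h" if "h \<in> mH M" for h
  proof -
    from cs[OF that] consider "h \<in> mH N" | "h = z" | "h = g (mroot M')" 
      | k where "k \<in> mH M'" "k \<noteq> mroot M'" "h = g k" by metis
    then show ?thesis
    proof cases
      case 1 then show ?thesis using d(12) r(8,9) mem by simp
    next
      case 2 then show ?thesis using d(8,9) memg[OF r'(2)] by simp
    next
      case 3 then show ?thesis using d(8,9) memz by simp
    next
      case (4 k)
      then show ?thesis using d(10)[of k] d(10)[of "malp M' k"] anr[of k] r'(9)[of k] memg by simp
    qed
  qed
  show "malp M (mroot M) = mroot M" using d(7) d(12)[OF r(2)] r(5) by simp
  show "h = mroot M" if "h \<in> mH M" "malp M h = h" for h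
  proof -
    from cs[OF that(1)] consider "h \<in> mH N" | "h = z" | "h = g (mroot M')" 
      | k where "k \<in> mH M'" "k \<noteq> mroot M'" "h = g k" by metis
    then show ?thesis
    proof cases
      case 1 then show ?thesis using d(7,12) r(6) that by simp
    next
      case 2 then show ?thesis using d(8) d(4)[OF r'(2)] that by simp
    next
      case 3 then show ?thesis using d(9) d(4)[OF r'(2)] that by simp
    next
      case (4 k)
      then have "malp M' k = k" using that d(10)[of k] gi[of "malp M' k" k] r'(8)[of k] by simp
      then show ?thesis using 4 r'(6) by simp
    qed
  qed
  fix U assume U: "U \<subseteq> mH M" "U \<noteq> {}" "\<And>u. u \<in> U \<Longrightarrow> msig M u \<in> U" "\<And>u. u \<in> U \<Longrightarrow> malp M u \<in> U"
  let ?W = "U \<inter> mH N"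
  have zc: "msig N c \<in> U" if "z \<in> U" using U(3)[OF that] d(14) by simp
  have N: "mH N \<subseteq> U" if ne: "?W \<noteq> {}"
  proof -
    have "?W = mH N"
    proof (rule r(11)[OF _ ne])
      fix h assume h: "h \<in> ?W"
      show "malp N h \<in> ?W" using h U(4)[of h] d(12)[of h] r(8)[of h] by auto
      show "msig N h \<in> ?W" using h U(3)[of h] d(13)[of h] r(7)[of h] zc by (auto split: if_splits)
    qed auto
    then show ?thesis by auto
  qed
  let ?V = "{h \<in> mH M'. g h \<in> U}"
  have V: "mH M' \<subseteq> ?V" if ne: "?V \<noteq> {}"
  proof -
    have "?V = mH M'"
    proof (rule r'(11)[OF _ ne])
      fix h assume h: "h \<in> ?V"
      show "malp M' h \<in> ?V" using h U(4)[of "g h"] d(10)[of h] r'(8)[of h] r'(5) by (cases "h = mroot M'") auto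
      show "msig M' h \<in> ?V" using h U(3)[of "g h"] d(11)[of h] r'(7)[of h] by auto
    qed auto
    then show ?thesis by auto
  qed
  have gz: "z \<in> U \<longleftrightarrow> g (mroot M') \<in> U" using U(4)[of z] U(4)[of "g (mroot M')"] d(8,9) by auto
  obtain u where u: "u \<in> U" using U(2) by auto
  from cs[of u] u U(1) have "?W \<noteq> {} \<or> z \<in> U \<or> ?V \<noteq> {}" by auto
  moreover have "z \<in> U" if "?V \<noteq> {}" using V[OF that] gz r'(2) by auto
  moreover have "?W \<noteq> {}" if "z \<in> U" using zc[OF that] r(7)[OF d(1)] by auto
  ultimately have "?W \<noteq> {}" by auto
  then have sub: "mH N \<subseteq> U" by (rule N)
  then have z: "z \<in> U" using U(3)[of c] d(1) d(13)[of c] by auto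
  then have "?V \<noteq> {}" using gz r'(2) by auto
  from V[OF this] show "mH M \<subseteq> U" using sub z d(6) by auto
qed

lemma isR_mR:
  assumes "rooted_map N"
  obtains x y where "isR (mR k N) N (corner N k) x y"
proof -
  note r = rooted_mapD[OF assms]
  define x where "x = Suc (Max (mH N))"
  have new: "x \<notin> mH N" "Suc x \<notin> mH N" using Max_ge[OF r(1)] by (auto simp: x_def Suc_le_eq dest!: Max_ge[OF r(1)])
  then have ne: "h \<noteq> x" "h \<noteq> Suc x" if "h \<in> mH N" for h using that by auto
  have c: "corner N k \<in> mH N" using crn_in[OF assms] by (simp add: corner_crn)
  note nn = ne[OF c] ne[OF r(2)]
  show ?thesis
  proof (cases "corner N k = mroot N")
    case True
    \<comment> \<open>If the corner is the root corner, the second update in \<open>mR\<close> puts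
      \<open>y = Suc x\<close> directly after the root and \<open>x\<close> behind it, so the two
      names change roles.\<close>
    have "isR (mR k N) N (corner N k) (Suc x) x"
      unfolding isR_def mR_def Let_def x_def[symmetric] using True new ne nn c by auto
    then show ?thesis by (rule that)
  next
    case False
    have "isR (mR k N) N (corner N k) x (Suc x)"
      unfolding isR_def mR_def Let_def x_def[symmetric] using False new ne nn c by auto
    then show ?thesis by (rule that)
  qed
qed

lemma isI_mIns:
  assumes "rooted_map N" "rooted_map M'"
  obtains z g where "isI (mIns M' k N) M' N (corner N k) z g"
proof -
  note r = rooted_mapD[OF assms(1)]
  define z where "z = Suc (Max (mH N))"
  let ?g = "\<lambda>h. h + Suc z"
  have le: "h < z" if "h \<in> mH N" for h using that Max_ge[OF r(1)] by (auto simp: z_def less_Suc_eq_le)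
  have c: "corner N k \<in> mH N" using crn_in[OF assms(1)] by (simp add: corner_crn)
  have n: "?g h \<notin> mH N" for h using le[of "?g h"] by auto
  have nz: "z \<notin> mH N" using le by blast
  have "isI (mIns M' k N) M' N (corner N k) z ?g"
    unfolding isI_def mIns_def Let_def z_def[symmetric]
    using le c n nz rooted_mapD(2)[OF assms(2)] by (auto simp: inj_on_def image_iff)
  then show ?thesis by (rule that)
qed

text \<open>The new names \<open>z\<close> and \<open>g\<close> are prescribed, so that a smaller
  map can share its half-edges with a larger one already given.\<close>

lemma ex_isI:
  assumes "c \<in> mH N" "z \<notin> mH N" "inj_on g (mH M')" "z \<notin> g ` mH M'" "mH N \<inter> g ` mH M' = {}" "mroot M' \<in> mH M'"
  obtains M where "isI M M' N c z g"
proof -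
  let ?i = "inv_into (mH M') g"
  define M where "M = \<lparr>mH = mH N \<union> {z} \<union> g ` mH M',
     msig = (\<lambda>h. if h \<in> mH N then if h = c then z else msig N h else if h = z then msig N c else g (msig M' (?i h))),
     malp = (\<lambda>h. if h \<in> mH N then malp N h else if h = z then g (mroot M')
        else if h = g (mroot M') then z else g (malp M' (?i h))), mroot = mroot N\<rparr>"
  have g: "g h \<notin> mH N" "g h \<noteq> z" "?i (g h) = h" if "h \<in> mH M'" for h using that assms(3-5) by auto
  have gi: "g h = g (mroot M') \<longleftrightarrow> h = mroot M'" if "h \<in> mH M'" for h using that assms(3,6) by (meson inj_onD)
  have "isI M M' N c z g" unfolding isI_def M_def using assms g gi by simp
  then show ?thesis by (rule that)
qed

section \<open>Extending and restricting isomorphisms\<close>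

lemma isR_iso_ext:
  assumes f: "iso_by f N1 N2" and R1: "isR M1 N1 c1 x1 y1" and R2: "isR M2 N2 c2 x2 y2"
    and c: "f c1 = c2" and r: "rooted_map N1"
  shows "miso M1 M2"
proof -
  note F = iso_byD[OF f] and d1 = isRD[OF R1] and d2 = isRD[OF R2] and r1 = rooted_mapD[OF r]
  define F' where "F' = (\<lambda>h. if h = x1 then x2 else if h = y1 then y2 else f h)"
  have fN: "F' h = f h" if "h \<in> mH N1" for h using that d1(1,2) by (auto simp: F'_def)
  have fx: "F' x1 = x2" "F' y1 = y2" using d1(3) by (auto simp: F'_def)
  have cr: "c1 = mroot N1 \<longleftrightarrow> c2 = mroot N2" using F(4,6) c d1(4) r1(2) by metis
  have "bij_betw F' (mH M1) (mH M2)"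
  proof -
    have "bij_betw F' (mH N1) (mH N2)" using F(1) fN by (simp cong: bij_betw_cong)
    moreover have "bij_betw F' {x1, y1} {x2, y2}" using fx d2(3) by (auto simp: bij_betw_def inj_on_def)
    ultimately show ?thesis unfolding d1(5) d2(5) by (rule bij_betw_combine) (use d2(1,2) in auto)
  qed
  moreover have "F' (msig M1 h) = msig M2 (F' h) \<and> F' (malp M1 h) = malp M2 (F' h)" if h: "h \<in> mH M1" for h
  proof -
    consider "h \<in> mH N1" "h \<noteq> mroot N1" | "h = mroot N1" | "h = x1" | "h = y1" using h d1(5) by auto
    then show ?thesis
    proof cases
      case 1
      then have "f h \<in> mH N2" "f h \<noteq> mroot N2" "f h = c2 \<longleftrightarrow> h = c1"
        using F(5) F(6)[of h "mroot N1"] F(6)[of h c1] F(4) c d1(4) r1(2) by auto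
      then show ?thesis using 1 d1(9,13)[of h] d2(9,13)[of "f h"] fN r1(7,8)[of h] fx F(2,3)[of h] by auto
    next
      case 2
      then show ?thesis using d1(9)[of h] d1(10) d2(9)[of "f h"] d2(10) fN r1(2,5) fx F(3,5)[of h] F(4) by simp
    next
      case 3
      then show ?thesis using d1(7,11) d2(7,11) fx fN[OF r1(7)[OF r1(2)]] cr F(2)[OF r1(2)] F(4) by auto
    next
      case 4
      then show ?thesis using d1(8,12) d2(8,12) fx fN[OF r1(7)[OF d1(4)]] F(2)[OF d1(4)] c by auto
    qed
  qed
  moreover have "F' (mroot M1) = mroot M2" using fN[OF r1(2)] F(4) d1(6) d2(6) by simp
  ultimately have "iso_by F' M1 M2" by (simp add: iso_by_def)
  then show ?thesis by (auto simp: miso_iff)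
qed

text \<open>The root determines \<open>x\<close> as its successor and \<open>y\<close> as the
  partner of \<open>x\<close>; an isomorphism therefore respects the added edge, and with it the
  corner that holds \<open>y\<close>.\<close>

lemma isR_iso_restrict:
  assumes f: "iso_by f M1 M2" and R1: "isR M1 N1 c1 x1 y1" and R2: "isR M2 N2 c2 x2 y2"
    and r: "rooted_map N1" "rooted_map N2"
  shows "iso_by f N1 N2" "f c1 = c2"
proof -
  note F = iso_byD[OF f] and d1 = isRD[OF R1] and d2 = isRD[OF R2]
    and r1 = rooted_mapD[OF r(1)] and r2 = rooted_mapD[OF r(2)]
  have M1: "h \<in> mH M1" if "h \<in> mH N1" for h using that d1(5) by simp
  have xy1: "x1 \<in> mH M1" "y1 \<in> mH M1" using d1(5) by auto
  have rt: "f (mroot N1) = mroot N2" using F(4) d1(6) d2(6) by simp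
  have fx: "f x1 = x2" using F(2)[OF M1[OF r1(2)]] d1(10) d2(10) rt by simp
  have fy: "f y1 = y2" using F(3)[OF xy1(1)] fx d1(7) d2(7) by simp
  have fN: "f h \<in> mH N2" if "h \<in> mH N1" for h
  proof -
    have "f h \<noteq> x2" "f h \<noteq> y2" using F(6)[OF M1[OF that]] xy1 fx fy that d1(1,2) by metis+
    then show ?thesis using F(5)[OF M1[OF that]] d2(5) by auto
  qed
  have im: "f ` mH N1 = mH N2"
  proof
    show "f ` mH N1 \<subseteq> mH N2" using fN by auto
    show "mH N2 \<subseteq> f ` mH N1"
    proof
      fix h assume h: "h \<in> mH N2"
      then obtain k where k: "k \<in> mH M1" "h = f k" using F(7) d2(5) by (metis UnCI imageE)
      then have "k \<noteq> x1" "k \<noteq> y1" using h fx fy d2(1,2) by auto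
      then show "h \<in> f ` mH N1" using k d1(5) by auto
    qed
  qed
  \<comment> \<open>The corner is read off as the half-edge before \<open>y\<close>, except that for
    the root corner \<open>x\<close> stands in between.\<close>
  show c: "f c1 = c2"
  proof (cases "c1 = mroot N1")
    case True
    then have "msig M2 x2 = y2" using F(2)[OF xy1(1)] fx fy d1(11) by simp
    then have "c2 = mroot N2" using d2(2,11) r2(2,7) by (metis)
    then show ?thesis using True rt by simp
  next
    case False
    then have "f c1 \<noteq> mroot N2" using rt F(6)[OF M1[OF d1(4)] M1[OF r1(2)]] by simp
    moreover have "msig M2 (f c1) = y2" using F(2)[OF M1[OF d1(4)]] d1(13)[OF d1(4)] False fy by simp
    ultimately show ?thesis using d2(13)[of "f c1"] fN[OF d1(4)] d2(2) r2(7) by (metis)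
  qed
  have "f (msig N1 h) = msig N2 (f h) \<and> f (malp N1 h) = malp N2 (f h)" if h: "h \<in> mH N1" for h
  proof
    show "f (malp N1 h) = malp N2 (f h)" using F(3)[OF M1[OF h]] d1(9)[OF h] d2(9)[OF fN[OF h]] by simp
    show "f (msig N1 h) = msig N2 (f h)"
    proof (cases "h = c1")
      case True
      then show ?thesis using F(2)[OF xy1(2)] d1(12) d2(12) c fy by simp
    next
      case False
      then have hc: "f h \<noteq> c2" using F(6)[OF M1[OF h] M1[OF d1(4)]] c by simp
      show ?thesis
      proof (cases "h = mroot N1")
        case True
        then show ?thesis using F(2)[OF xy1(1)] d1(11) d2(11) hc rt fx False by simp
      next
        case hr: False
        then have "f h \<noteq> mroot N2" using F(6)[OF M1[OF h] M1[OF r1(2)]] rt by simp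
        then show ?thesis using F(2)[OF M1[OF h]] d1(13)[OF h] d2(13)[OF fN[OF h]] hr False hc by simp
      qed
    qed
  qed
  moreover have "inj_on f (mH N1)" using F(6) M1 by (auto intro: inj_onI)
  ultimately show "iso_by f N1 N2" using im rt by (simp add: iso_by_def bij_betw_def)
qed

lemma isI_iso_ext:
  assumes f: "iso_by f N1 N2" and f': "iso_by f' M1' M2'"
    and I1: "isI M1 M1' N1 c1 z1 g1" and I2: "isI M2 M2' N2 c2 z2 g2"
    and c: "f c1 = c2" and r: "rooted_map N1" "rooted_map M1'"
  shows "miso M1 M2"
proof -
  note F = iso_byD[OF f] and F' = iso_byD[OF f'] and d1 = isID[OF I1] and d2 = isID[OF I2]
    and r1 = rooted_mapD[OF r(1)] and r1' = rooted_mapD[OF r(2)]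
  define G where "G = (\<lambda>h. if h \<in> mH N1 then f h else if h = z1 then z2 else g2 (f' (inv_into (mH M1') g1 h)))"
  have GN: "G h = f h" if "h \<in> mH N1" for h using that by (auto simp: G_def)
  have Gz: "G z1 = z2" using d1(2) by (auto simp: G_def)
  have Gg: "G (g1 h) = g2 (f' h)" if "h \<in> mH M1'" for h using d1(3) d1(4,5)[OF that] that by (auto simp: G_def)
  have "bij_betw G (mH M1) (mH M2)"
  proof -
    have "bij_betw G (mH N1) (mH N2)" using F(1) GN by (simp cong: bij_betw_cong)
    moreover have "bij_betw G {z1} {z2}" using Gz by (auto simp: bij_betw_def)
    ultimately have 1: "bij_betw G (mH N1 \<union> {z1}) (mH N2 \<union> {z2})" by (rule bij_betw_combine) (use d2(2) in auto)
    have "bij_betw G (g1 ` mH M1') (g2 ` mH M2')"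
    proof (rule bij_betw_imageI)
      show "inj_on G (g1 ` mH M1')"
        using Gg isI_inj[OF I2] F'(5,6) by (auto intro!: inj_onI)
      show "G ` g1 ` mH M1' = g2 ` mH M2'"
        using Gg F'(7) by (simp add: image_image cong: image_cong) (metis image_image)
    qed
    from bij_betw_combine[OF 1 this] show ?thesis unfolding d1(6) d2(6) using d2(4,5) by blast
  qed
  moreover have "G (msig M1 h) = msig M2 (G h) \<and> G (malp M1 h) = malp M2 (G h)" if h: "h \<in> mH M1" for h
  proof -
    consider "h \<in> mH N1" | "h = z1" | k where "k \<in> mH M1'" "h = g1 k" using h d1(6) by auto
    then show ?thesis
    proof cases
      case 1
      then have "f h \<in> mH N2" "f h = c2 \<longleftrightarrow> h = c1" using F(5) F(6)[of h c1] c d1(1) by auto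
      then show ?thesis using 1 d1(12,13)[of h] d2(12,13)[of "f h"] GN r1(7,8)[of h] Gz F(2,3)[of h] by auto
    next
      case 2
      then show ?thesis using d1(8,14) d2(8,14) Gz Gg[OF r1'(2)] F'(4) GN[OF r1(7)[OF d1(1)]] F(2)[OF d1(1)] c by auto
    next
      case (3 k)
      have s: "G (msig M1 h) = msig M2 (G h)"
        using 3 d1(11)[of k] d2(11)[of "f' k"] F'(2,5)[of k] Gg r1'(7)[of k] by simp
      have "G (malp M1 h) = malp M2 (G h)"
      proof (cases "k = mroot M1'")
        case True
        then show ?thesis using 3 d1(9) d2(9) Gz Gg F'(4) by simp
      next
        case False
        then have "f' k \<noteq> mroot M2'" using F'(6)[of k "mroot M1'"] F'(4) 3 r1'(2) by simp
        then show ?thesis using 3 d1(10)[of k] d2(10)[of "f' k"] F'(3,5)[of k] Gg r1'(8)[of k] False by simp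
      qed
      then show ?thesis using s by simp
    qed
  qed
  moreover have "G (mroot M1) = mroot M2" using GN[OF r1(2)] F(4) d1(7) d2(7) by simp
  ultimately have "iso_by G M1 M2" by (simp add: iso_by_def)
  then show ?thesis by (auto simp: miso_iff)
qed

text \<open>On both sides \<open>z\<close> is the successor of the root. The half-edges of
  \<open>N1\<close> that \<open>f\<close> sends into \<open>N2\<close> form a closed set containing
  the root, and similarly for the attached maps, so transitivity keeps \<open>f\<close> from mixing
  the two sides.\<close>

lemma isI_iso_restrict:
  assumes f: "iso_by f M1 M2" and I1: "isI M1 M1' N1 (mroot N1) z1 g1" and I2: "isI M2 M2' N2 (mroot N2) z2 g2"
    and r: "rooted_map N1" "rooted_map M1'" "rooted_map N2" "rooted_map M2'"
  shows "miso N1 N2" "miso M1' M2'"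
proof -
  note F = iso_byD[OF f] and d1 = isID[OF I1] and d2 = isID[OF I2]
    and r1 = rooted_mapD[OF r(1)] and r1' = rooted_mapD[OF r(2)] and r2 = rooted_mapD[OF r(3)] and r2' = rooted_mapD[OF r(4)]
  have M1: "h \<in> mH M1" if "h \<in> mH N1" for h using that d1(6) by simp
  have M1g: "g1 h \<in> mH M1" if "h \<in> mH M1'" for h using that d1(6) by simp
  have z1: "z1 \<in> mH M1" using d1(6) by auto
  have rt: "f (mroot N1) = mroot N2" using F(4) d1(7) d2(7) by simp
  have fz: "f z1 = z2" using F(2)[OF M1[OF r1(2)]] d1(13)[OF r1(2)] d2(13)[OF r2(2)] rt by simp
  have fg: "f (g1 (mroot M1')) = g2 (mroot M2')" using F(3)[OF z1] fz d1(8) d2(8) by simp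
  have sN: "f (msig N1 h) = msig N2 (f h)" if h: "h \<in> mH N1" "f h \<in> mH N2" for h
  proof (cases "h = mroot N1")
    case True
    then show ?thesis using F(2)[OF z1] d1(14) d2(14) rt fz by simp
  next
    case False
    then have "f h \<noteq> mroot N2" using F(6)[OF M1[OF h(1)] M1[OF r1(2)]] rt by simp
    then show ?thesis using F(2)[OF M1[OF h(1)]] d1(13)[OF h(1)] d2(13)[OF h(2)] False by simp
  qed
  have aN: "f (malp N1 h) = malp N2 (f h)" if h: "h \<in> mH N1" "f h \<in> mH N2" for h
    using F(3)[OF M1[OF h(1)]] d1(12)[OF h(1)] d2(12)[OF h(2)] by simp
  have N: "{h \<in> mH N1. f h \<in> mH N2} = mH N1"
  proof (rule r1(11))
    show "{h \<in> mH N1. f h \<in> mH N2} \<noteq> {}" using r1(2) rt r2(2) by auto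
    show "msig N1 u \<in> {h \<in> mH N1. f h \<in> mH N2}" "malp N1 u \<in> {h \<in> mH N1. f h \<in> mH N2}"
      if "u \<in> {h \<in> mH N1. f h \<in> mH N2}" for u
      using that sN aN r1(7,8) r2(7,8) by auto
  qed auto
  then have fN: "f h \<in> mH N2" if "h \<in> mH N1" for h using that by blast
  let ?V = "{h \<in> mH M1'. f (g1 h) \<in> g2 ` mH M2'}"
  have V: "?V = mH M1'"
  proof (rule r1'(11))
    show "?V \<noteq> {}" using r1'(2) fg r2'(2) by auto
    fix u assume u: "u \<in> ?V"
    then obtain v where v: "v \<in> mH M2'" "f (g1 u) = g2 v" by auto
    show "msig M1' u \<in> ?V" using u v F(2)[OF M1g, of u] d1(11)[of u] d2(11)[of v] r1'(7) r2'(7) by auto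
    show "malp M1' u \<in> ?V"
    proof (cases "u = mroot M1'")
      case True
      then show ?thesis using u r1'(5) by simp
    next
      case False
      then have "v \<noteq> mroot M2'" using v fg F(6)[OF M1g M1g, of u "mroot M1'"] isI_inj[OF I1] u r1'(2) by auto
      then show ?thesis using u v F(3)[OF M1g, of u] d1(10)[of u] d2(10)[of v] r1'(8) r2'(8) False by auto
    qed
  qed auto
  then have fM: "f (g1 h) \<in> g2 ` mH M2'" if "h \<in> mH M1'" for h using that by blast
  have pre: "\<exists>k. (k \<in> mH N1 \<and> h = f k) \<or> (k = z1 \<and> h = z2) \<or> (\<exists>l\<in>mH M1'. k = g1 l \<and> h = f k)" if "h \<in> mH M2" for h
    using that F(7) d1(6) fz by (smt (verit) Un_iff image_iff singletonD)
  have imN: "f ` mH N1 = mH N2"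
  proof
    show "f ` mH N1 \<subseteq> mH N2" using fN by auto
    show "mH N2 \<subseteq> f ` mH N1"
    proof
      fix h assume h: "h \<in> mH N2"
      then have "h \<noteq> z2" "h \<notin> g2 ` mH M2'" "h \<in> mH M2" using d2(2,5,6) by auto
      then show "h \<in> f ` mH N1" using pre[of h] fM by auto
    qed
  qed
  define f' where "f' = (\<lambda>h. inv_into (mH M2') g2 (f (g1 h)))"
  have f': "f' h \<in> mH M2'" "g2 (f' h) = f (g1 h)" if "h \<in> mH M1'" for h
    using fM[OF that] by (auto simp: f'_def inv_into_into f_inv_into_f)
  have f'e: "f' h = k" if "h \<in> mH M1'" "k \<in> mH M2'" "f (g1 h) = g2 k" for h k
    using f'[OF that(1)] that isI_inj[OF I2] by metis
  have "inj_on f (mH N1)" using F(6) M1 by (auto intro: inj_onI)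
  then have "iso_by f N1 N2" using imN rt sN aN fN by (simp add: iso_by_def bij_betw_def)
  then show "miso N1 N2" by (auto simp: miso_iff)
  have rt': "f' (mroot M1') = mroot M2'" using f'e[OF r1'(2) r2'(2)] fg by simp
  have "inj_on f' (mH M1')"
  proof (rule inj_onI)
    fix h k assume h: "h \<in> mH M1'" "k \<in> mH M1'" "f' h = f' k"
    then have "f (g1 h) = f (g1 k)" using f'(2) by metis
    then show "h = k" using F(6)[OF M1g M1g] isI_inj[OF I1] h by auto
  qed
  moreover have "f' ` mH M1' = mH M2'"
  proof
    show "f' ` mH M1' \<subseteq> mH M2'" using f' by auto
    show "mH M2' \<subseteq> f' ` mH M1'"
    proof
      fix h assume h: "h \<in> mH M2'"
      then have "g2 h \<in> mH M2" using d2(6) by auto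
      then obtain l where "l \<in> mH M1'" "g2 h = f (g1 l)"
        using pre[of "g2 h"] d2(4,5)[OF h] fN by metis
      then show "h \<in> f' ` mH M1'" using f'e[of l h] h by auto
    qed
  qed
  moreover have "f' (msig M1' h) = msig M2' (f' h) \<and> f' (malp M1' h) = malp M2' (f' h)" if h: "h \<in> mH M1'" for h
  proof
    show "f' (msig M1' h) = msig M2' (f' h)"
      using f'e[of "msig M1' h" "msig M2' (f' h)"] h f'[OF h] F(2)[OF M1g[OF h]] d1(11)[OF h] d2(11)[of "f' h"] r1'(7)[OF h] r2'(7) by simp
    show "f' (malp M1' h) = malp M2' (f' h)"
    proof (cases "h = mroot M1'")
      case True
      then show ?thesis using rt' r1'(5) r2'(5) by simp
    next
      case False
      then have "f' h \<noteq> mroot M2'" using \<open>inj_on f' (mH M1')\<close> rt' h r1'(2) by (metis inj_onD)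
      then show ?thesis
        using f'e[of "malp M1' h" "malp M2' (f' h)"] h f'[OF h] F(3)[OF M1g[OF h]] d1(10)[OF h] d2(10)[of "f' h"] r1'(8)[OF h] r2'(8) False by simp
    qed
  qed
  ultimately have "iso_by f' M1' M2'" using rt' by (simp add: iso_by_def bij_betw_def)
  then show "miso M1' M2'" by (auto simp: miso_iff)
qed

section \<open>Decomposing a map at a bridge or at its root edge\<close>

text \<open>Without the edge the connected map \<open>N\<close> still joins its ends. In terms of a
  cut set \<open>U\<close> of \<open>x\<close>: it misses \<open>y\<close>, hence \<open>c\<close>,
  and then \<open>U \<inter> mH N\<close> would be a nonempty closed set of \<open>N\<close> without
  \<open>c\<close>.\<close>

lemma isR_root_not_bridge:
  assumes "isR M N c x y" "rooted_map N"
  shows "\<not> mbridge M (malp M) x"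
proof
  note d = isRD[OF assms(1)] and r = rooted_mapD[OF assms(2)]
  assume "mbridge M (malp M) x"
  then obtain U where U: "mcutset M (malp M) x U"
    using is_bridge_iff[OF rooted_mapD(4)[OF isR_rooted[OF assms]]] by blast
  have xy: "x \<in> U" "y \<notin> U" and s: "\<And>u. u \<in> U \<Longrightarrow> msig M u \<in> U"
    and a: "\<And>u. u \<in> U \<Longrightarrow> u \<noteq> x \<Longrightarrow> malp M u \<in> U"
    using U d(7) by (auto simp: cutset_def)
  have cr: "c \<noteq> mroot N" using s[OF xy(1)] xy(2) d(11) by auto
  have cU: "c \<notin> U" using s[of c] d(4) d(13)[of c] cr xy(2) by auto
  have sr: "msig N (mroot N) \<in> U" using s[OF xy(1)] d(11) cr by simp
  have "U \<inter> mH N = mH N"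
  proof (rule r(11))
    show "U \<inter> mH N \<noteq> {}" using sr r(2,7) by auto
    fix u assume u: "u \<in> U \<inter> mH N"
    then have "u \<noteq> x" using d(1) by auto
    then show "malp N u \<in> U \<inter> mH N" using a[of u] u d(9)[of u] r(8)[of u] by simp
    have "u \<noteq> c" using u cU by auto
    then show "msig N u \<in> U \<inter> mH N" using s[of u] u sr d(13)[of u] r(7)[of u] by (cases "u = mroot N") simp_all
  qed simp
  then show False using d(4) cU by auto
qed

lemma isI_bridge:
  assumes "isI M M' N c z g" "rooted_map N" "rooted_map M'"
  shows "mbridge M (malp M) z"
proof -
  note d = isID[OF assms(1)] and r = rooted_mapD[OF assms(2)] and r' = rooted_mapD[OF assms(3)]
  have "mcutset M (malp M) z (mH N \<union> {z})"
    unfolding cutset_def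
  proof (intro conjI ballI impI)
    show "malp M z \<notin> mH N \<union> {z}" using d(4,5,8) r'(2) by simp
    show "msig M u \<in> mH N \<union> {z}" if "u \<in> mH N \<union> {z}" for u
      using that d(14) r(7)[of u] r(7)[OF d(1)] d(13)[of u] by (cases "u = z"; cases "u = c") simp_all
    show "malp M u \<in> mH N \<union> {z}" if "u \<in> mH N \<union> {z}" "u \<noteq> z" for u
      using that d(12)[of u] r(8)[of u] by simp
  qed (use d(6) in auto)
  then show ?thesis using is_bridge_iff[OF rooted_mapD(4)[OF isI_rooted[OF assms]]] by blast
qed

text \<open>\<open>U\<close> is the root side of the bridge. \<open>Mh\<close> is that side with
  \<open>e\<close> taken out of its vertex, \<open>c\<close> is the corner where \<open>e\<close>
  was, and \<open>Md\<close> is the far side, rooted at the far end of the bridge.\<close>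

lemma bridge_decomp:
  assumes M: "rooted_map M" and U: "mcutset M (malp M) e U" and rU: "mroot M \<in> U"
  obtains Md Mh c where "isI M Md Mh c e id" "rooted_map Md" "rooted_map Mh"
    "mH Md = mH M - U" "mroot Md = malp M e" "mH Mh = U - {e}" "msig M c = e"
    "\<And>h. malp Md h = (if h = malp M e then h else malp M h)" "msig Md = msig M" "c \<in> mH M"
proof -
  note r = rooted_mapD[OF M]
  have UH: "\<And>u. u \<in> U \<Longrightarrow> u \<in> mH M" and e: "e \<in> U" and e'U: "malp M e \<notin> U"
    and s: "\<And>u. u \<in> U \<Longrightarrow> msig M u \<in> U" and a: "\<And>u. u \<in> U \<Longrightarrow> u \<noteq> e \<Longrightarrow> malp M u \<in> U"
    using U by (auto simp: cutset_def)
  note eH = UH[OF e]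
  define e' where "e' = malp M e"
  have e': "e' \<in> mH M" "malp M e' = e" "malp M e = e'" "e' \<notin> U" "e' \<noteq> e"
    using r(8,9)[OF eH] e'U e by (auto simp: e'_def)
  have cm: "mcutset M (malp M) e' (mH M - U)"
    unfolding e'_def by (rule cutset_compl[OF r(4,1,3) U])
  have sV: "\<And>u. u \<in> mH M - U \<Longrightarrow> msig M u \<in> mH M - U"
    and aV: "\<And>u. u \<in> mH M - U \<Longrightarrow> u \<noteq> e' \<Longrightarrow> malp M u \<in> mH M - U"
    using cm by (auto simp: cutset_def)
  have er: "e \<noteq> mroot M" using r(5) rU e'U by auto
  obtain p where p: "p \<in> mH M" "msig M p = e" using r(3) eH by (metis bij_betw_imp_surj_on imageE)
  have pU: "p \<in> U" using closed_perm_backward[OF r(1,3), of U p] UH s p e by auto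
  \<comment> \<open>If \<open>e\<close> were alone at its vertex, the far side together with
    \<open>e\<close> would be closed in \<open>M\<close> and miss the root.\<close>
  have pe: "p \<noteq> e"
  proof
    assume "p = e"
    let ?W = "(mH M - U) \<union> {e}"
    have "?W = mH M"
    proof (rule r(11))
      show "msig M u \<in> ?W" if "u \<in> ?W" for u using that sV[of u] p(2) \<open>p = e\<close> by auto
      show "malp M u \<in> ?W" if "u \<in> ?W" for u
        using that aV[of u] e' by (cases "u = e'"; cases "u = e") simp_all
    qed (use eH in auto)
    then show False using rU er r(2) by auto
  qed
  define Mh where "Mh = \<lparr>mH = U - {e}, msig = (\<lambda>h. if h = p then msig M e else msig M h), malp = malp M, mroot = mroot M\<rparr>"
  define Md where "Md = \<lparr>mH = mH M - U, msig = msig M, malp = (malp M)(e' := e'), mroot = e'\<rparr>"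
  have Mh: "rooted_map Mh"
  proof (rule rooted_mapI)
    show "finite (mH Mh)" using r(1) UH by (auto simp: Mh_def intro: finite_subset)
    show "mroot Mh \<in> mH Mh" using rU er by (simp add: Mh_def)
    have ne: "msig M h \<noteq> e" if "h \<in> U" "h \<noteq> p" for h using r(10)[OF UH[OF that(1)] p(1)] that(2) p(2) by auto
    show "msig Mh h \<in> mH Mh" if "h \<in> mH Mh" for h
      using that s[of h] s[OF e] ne[of h] ne[OF e] pe by (cases "h = p") (simp_all add: Mh_def)
    show "inj_on (msig Mh) (mH Mh)"
    proof (rule inj_onI)
      fix h k assume "h \<in> mH Mh" "k \<in> mH Mh" "msig Mh h = msig Mh k"
      then show "h = k" using r(10)[of h k] r(10)[of e k] r(10)[of h e] UH eH unfolding Mh_def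
        by (cases "h = p"; cases "k = p") simp_all
    qed
    have "malp M h \<noteq> e" if "h \<in> U" for h using r(9)[OF UH[OF that]] that e'(3,4) by auto
    then show "malp Mh h \<in> mH Mh \<and> malp Mh (malp Mh h) = h" if "h \<in> mH Mh" for h
      using that a[of h] r(9)[of h] UH[of h] by (simp add: Mh_def)
    show "malp Mh (mroot Mh) = mroot Mh" using r(5) by (simp add: Mh_def)
    show "h = mroot Mh" if "h \<in> mH Mh" "malp Mh h = h" for h using that r(6) UH by (simp add: Mh_def)
    fix W assume W: "W \<subseteq> mH Mh" "W \<noteq> {}" "\<And>u. u \<in> W \<Longrightarrow> msig Mh u \<in> W" "\<And>u. u \<in> W \<Longrightarrow> malp Mh u \<in> W"
    have WU: "\<And>u. u \<in> W \<Longrightarrow> u \<in> U \<and> u \<noteq> e" using W(1) by (auto simp: Mh_def)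
    \<comment> \<open>A closed set of \<open>Mh\<close> is completed to one of \<open>M\<close>:
      through \<open>p\<close> it reaches \<open>e\<close>, and through \<open>e\<close> the far
      side.\<close>
    let ?W = "W \<union> {h. p \<in> W \<and> (h = e \<or> h \<in> mH M - U)}"
    have "?W = mH M"
    proof (rule r(11))
      show "?W \<subseteq> mH M" using WU UH eH by auto
      show "msig M u \<in> ?W" if "u \<in> ?W" for u
      proof -
        have "msig M u \<in> ?W" if "u \<in> W" using W(3)[OF that] that p by (cases "u = p") (auto simp: Mh_def)
        moreover have "msig M e \<in> ?W" if "p \<in> W" using W(3)[OF that] by (simp add: Mh_def)
        ultimately show ?thesis using that sV by auto
      qed
      show "malp M u \<in> ?W" if "u \<in> ?W" for u
      proof -
        have "malp M u \<in> ?W" if "u \<in> W" using W(4)[OF that] by (simp add: Mh_def)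
        moreover have "malp M u \<in> ?W" if "p \<in> W" "u = e \<or> u \<in> mH M - U"
          using that aV[of u] e' by (cases "u = e"; cases "u = e'") auto
        ultimately show ?thesis using that by auto
      qed
    qed (use W in auto)
    then show "mH Mh \<subseteq> W" using UH by (auto simp: Mh_def)
  qed
  have Md: "rooted_map Md"
  proof (rule rooted_mapI)
    show "finite (mH Md)" using r(1) by (simp add: Md_def)
    show "mroot Md \<in> mH Md" using e' by (simp add: Md_def)
    show "msig Md h \<in> mH Md" if "h \<in> mH Md" for h using that sV[of h] by (simp add: Md_def)
    show "inj_on (msig Md) (mH Md)" using r(10) by (auto simp: Md_def intro!: inj_onI)
    have "malp M h \<noteq> e'" if "h \<in> mH M - U" for h using r(9)[of h] that e e'(2) by auto
    then show "malp Md h \<in> mH Md \<and> malp Md (malp Md h) = h" if "h \<in> mH Md" for h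
      using that aV[of h] r(9)[of h] by (cases "h = e'") (simp_all add: Md_def)
    show "malp Md (mroot Md) = mroot Md" by (simp add: Md_def)
    show "h = mroot Md" if "h \<in> mH Md" "malp Md h = h" for h
      using that r(6)[of h] rU by (cases "h = e'") (auto simp: Md_def)
    fix W assume W: "W \<subseteq> mH Md" "W \<noteq> {}" "\<And>u. u \<in> W \<Longrightarrow> msig Md u \<in> W" "\<And>u. u \<in> W \<Longrightarrow> malp Md u \<in> W"
    have WU: "\<And>u. u \<in> W \<Longrightarrow> u \<in> mH M - U" using W(1) by (auto simp: Md_def)
    let ?W = "W \<union> {h. e' \<in> W \<and> h \<in> U}"
    have "?W = mH M"
    proof (rule r(11))
      show "?W \<subseteq> mH M" using WU UH by auto
      show "msig M u \<in> ?W" if "u \<in> ?W" for u using that W(3)[of u] s[of u] by (auto simp: Md_def)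
      show "malp M u \<in> ?W" if "u \<in> ?W" for u
      proof -
        have "malp M u \<in> ?W" if "u \<in> W" using W(4)[OF that] that e' e by (cases "u = e'") (auto simp: Md_def)
        moreover have "malp M u \<in> ?W" if "e' \<in> W" "u \<in> U" using that a[of u] e' by (cases "u = e") auto
        ultimately show ?thesis using that by auto
      qed
    qed (use W in auto)
    then show "mH Md \<subseteq> W" by (auto simp: Md_def)
  qed
  have "isI M Md Mh p e id" unfolding isI_def
    using e e' pU pe UH eH p by (auto simp: Mh_def Md_def)
  then show ?thesis by (rule that[OF _ Md Mh]) (use p in \<open>simp_all add: Mh_def Md_def e'_def\<close>)
qed

lemma root_edge_decomp:
  assumes M: "rooted_map M" and er: "msig M (mroot M) \<noteq> mroot M"
    and nb: "\<not> mbridge M (malp M) (msig M (mroot M))"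
  obtains N c where "isR M N c (msig M (mroot M)) (malp M (msig M (mroot M)))" "rooted_map N"
proof -
  note r = rooted_mapD[OF M]
  define rt where "rt = mroot M"
  define e where "e = msig M rt"
  define e' where "e' = malp M e"
  have rt: "rt \<in> mH M" "malp M rt = rt" using r(2,5) by (auto simp: rt_def)
  have er: "e \<noteq> rt" using assms(2) by (simp add: e_def rt_def)
  have e: "e \<in> mH M" "e' \<in> mH M" "malp M e' = e" "malp M e = e'" "msig M rt = e"
    using r(7)[OF rt(1)] r(8,9)[of e] by (auto simp: e_def e'_def)
  have ee: "e' \<noteq> e" using r(6)[OF e(1)] e(4) er by (auto simp: rt_def)
  have e'r: "e' \<noteq> rt" using e(3) rt(2) er by auto
  have ncut: False if "mcutset M (malp M) e W" for W
    using nb that is_bridge_iff[OF r(4)] by (auto simp: e_def rt_def)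
  obtain p where p: "p \<in> mH M" "msig M p = e'" using r(3) e(2) by (metis bij_betw_imp_surj_on imageE)
  have pr: "p \<noteq> rt" using p e ee by auto
  \<comment> \<open>If \<open>e'\<close> were alone at its vertex, all other half-edges would form a
    cut set and the root edge would be a bridge.\<close>
  have pe': "p \<noteq> e'"
  proof
    assume pe: "p = e'"
    have "mcutset M (malp M) e (mH M - {e'})"
      unfolding cutset_def
    proof (intro conjI ballI impI)
      show "msig M u \<in> mH M - {e'}" if "u \<in> mH M - {e'}" for u
        using that r(7)[of u] r(10)[OF _ p(1), of u] p(2) pe by auto
      show "malp M u \<in> mH M - {e'}" if "u \<in> mH M - {e'}" "u \<noteq> e" for u
        using that r(8,9)[of u] e(3) by auto
    qed (use e ee in auto)
    then show False by (rule ncut)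
  qed
  \<comment> \<open>If \<open>e\<close> itself precedes \<open>e'\<close>, the root edge is a loop
    with its ends side by side; once both are gone, the corner in question is the root
    corner.\<close>
  define c where "c = (if p = e then rt else p)"
  \<comment> \<open>\<open>phi\<close> jumps to the last of the removed half-edges directly behind
    \<open>h\<close>, so that one step of \<open>msig M\<close> from there gives the successor in
    \<open>N\<close>.\<close>
  define phi where "phi = (\<lambda>h. if h = c then e' else if h = rt then e else h)"
  define N where "N = \<lparr>mH = mH M - {e, e'}, msig = (\<lambda>h. msig M (phi h)), malp = malp M, mroot = rt\<rparr>"
  have cH: "c \<in> mH M" "c \<noteq> e" "c \<noteq> e'" using p rt er e'r pe' by (auto simp: c_def)
  have phiH: "phi h \<in> mH M" if "h \<in> mH M" for h using that e by (simp add: phi_def)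
  have phr: "phi h \<noteq> rt" for h using er e'r by (simp add: phi_def)
  have php: "phi h \<noteq> p" if "h \<noteq> e" for h using that pe' pr by (auto simp: phi_def c_def)
  have sphi: "msig M (phi h) \<in> mH M - {e, e'}" if "h \<in> mH M" "h \<noteq> e" for h
    using r(7)[OF phiH[OF that(1)]] r(10)[OF phiH[OF that(1)] p(1)] r(10)[OF phiH[OF that(1)] rt(1)]
      php[OF that(2)] phr[of h] p(2) e(5) by auto
  have "rooted_map N"
  proof (rule rooted_mapI)
    show "finite (mH N)" using r(1) by (simp add: N_def)
    show "mroot N \<in> mH N" using rt er e'r by (simp add: N_def)
    show "msig N h \<in> mH N" if "h \<in> mH N" for h using that sphi[of h] by (simp add: N_def)
    show "inj_on (msig N) (mH N)"
    proof (rule inj_onI)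
      fix h k assume h: "h \<in> mH N" "k \<in> mH N" "msig N h = msig N k"
      then have "phi h = phi k" using r(10)[OF phiH[of h] phiH[of k]] by (simp add: N_def)
      moreover have "h \<noteq> e" "h \<noteq> e'" "k \<noteq> e" "k \<noteq> e'" using h(1,2) by (auto simp: N_def)
      ultimately show "h = k" using ee unfolding phi_def by metis
    qed
    show "malp N h \<in> mH N \<and> malp N (malp N h) = h" if "h \<in> mH N" for h
      using that r(8,9)[of h] e(3,4) by (auto simp: N_def)
    show "malp N (mroot N) = mroot N" using rt by (simp add: N_def)
    show "h = mroot N" if "h \<in> mH N" "malp N h = h" for h using that r(6)[of h] by (simp add: N_def rt_def)
    fix W assume W: "W \<subseteq> mH N" "W \<noteq> {}" "\<And>u. u \<in> W \<Longrightarrow> msig N u \<in> W" "\<And>u. u \<in> W \<Longrightarrow> malp N u \<in> W"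
    have WM: "\<And>u. u \<in> W \<Longrightarrow> u \<in> mH M \<and> u \<noteq> e \<and> u \<noteq> e'" using W(1) by (auto simp: N_def)
    have Ws: "\<And>u. u \<in> W \<Longrightarrow> msig M (phi u) \<in> W" and Wa: "\<And>u. u \<in> W \<Longrightarrow> malp M u \<in> W"
      using W(3,4) by (auto simp: N_def)
    let ?W = "W \<union> {h. h = e \<and> rt \<in> W \<or> h = e' \<and> c \<in> W}"
    have sub: "?W \<subseteq> mH M" using WM e by auto
    have e1: "msig M e \<in> ?W" if "rt \<in> W"
    proof (cases "p = e")
      case True then show ?thesis using that p(2) by (simp add: c_def)
    next
      case False
      then have "phi rt = e" using pr by (simp add: phi_def c_def)
      then show ?thesis using Ws[OF that] by simp
    qed
    have e2: "msig M e' \<in> ?W" if "c \<in> W" using Ws[OF that] by (simp add: phi_def)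
    have s: "msig M u \<in> ?W" if u: "u \<in> ?W" for u
    proof -
      have "msig M u \<in> ?W" if "u \<in> W"
      proof -
        consider "u = rt" | "u \<noteq> rt" "u = c" | "u \<noteq> rt" "u \<noteq> c" by blast
        then show ?thesis
        proof cases
          case 1 then show ?thesis using that e(5) by simp
        next
          case 2
          then have "u = p" by (auto simp: c_def split: if_splits)
          then show ?thesis using 2 that p(2) by simp
        next
          case 3 then show ?thesis using Ws[OF that] by (simp add: phi_def)
        qed
      qed
      then show ?thesis using u e1 e2 by blast
    qed
    \<comment> \<open>If \<open>W\<close> contains both or neither of the corners of the root edge,
      \<open>?W\<close> is closed in \<open>M\<close>. If it contains exactly one, \<open>?W\<close>
      is a cut set for that end, although the root edge is not a bridge.\<close>
    consider "rt \<in> W" "c \<in> W" | "rt \<notin> W" "c \<notin> W" | "rt \<in> W" "c \<notin> W" | "rt \<notin> W" "c \<in> W" by blast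
    then show "mH N \<subseteq> W"
    proof cases
      case 1
      have "?W = mH M"
        by (rule r(11)[OF sub _ s]) (use W(2) Wa 1 e in auto)
      then show ?thesis by (auto simp: N_def)
    next
      case 2
      have "?W = mH M"
        by (rule r(11)[OF sub _ s]) (use W(2) Wa 2 e in auto)
      then have "e \<in> W" using e 2 by auto
      then show ?thesis using WM by auto
    next
      case 3
      have "mcutset M (malp M) e ?W"
        unfolding cutset_def using sub s Wa 3 e ee WM by auto
      then show ?thesis using ncut by blast
    next
      case 4
      have "mcutset M (malp M) e' ?W"
        unfolding cutset_def using sub s Wa 4 e ee WM by auto
      then have "mcutset M (malp M) e (mH M - ?W)"
        using cutset_compl[OF r(4,1,3), of e' ?W] e(3) by simp
      then show ?thesis using ncut by blast
    qed
  qed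
  moreover have "isR M N c e e'" unfolding isR_def
  proof (intro conjI ballI impI)
    show "msig M e = (if c = mroot N then e' else msig N (mroot N))"
      using p pr by (auto simp: N_def phi_def c_def)
    show "msig M e' = msig N c" by (simp add: N_def phi_def)
    show "msig M h = (if h = c then e' else msig N h)" if "h \<in> mH N" "h \<noteq> mroot N" for h
      using that p by (auto simp: N_def phi_def c_def split: if_splits)
  qed (use e ee cH in \<open>auto simp: N_def rt_def\<close>)
  ultimately show ?thesis using that by (simp add: e_def e'_def rt_def)
qed

lemma rooted_card_1:
  assumes "rooted_map M" "msig M (mroot M) = mroot M"
  shows "mH M = {mroot M}"
  by (rule rooted_mapD(11)[OF assms(1), symmetric]) (use rooted_mapD(2,5)[OF assms(1)] assms(2) in auto)

lemma rooted_map_cases [consumes 1, case_names one bridge R]: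
  assumes M: "rooted_map M"
  obtains "mH M = {mroot M}" "msig M (mroot M) = mroot M"
  | Md Mu z where "isI M Md Mu (mroot Mu) z id" "rooted_map Md" "rooted_map Mu"
  | N c x y where "isR M N c x y" "rooted_map N"
proof -
  note r = rooted_mapD[OF M]
  let ?e = "msig M (mroot M)"
  consider "?e = mroot M" | "mbridge M (malp M) ?e"
    | "?e \<noteq> mroot M" "\<not> mbridge M (malp M) ?e" by blast
  then show ?thesis
  proof cases
    case 1 then show ?thesis using rooted_card_1[OF M] that(1) by simp
  next
    case 2
    then obtain U where U: "mcutset M (malp M) ?e U" using is_bridge_iff[OF r(4)] by blast
    have "mroot M \<in> U" by (rule closed_perm_backward[OF r(1,3)]) (use U r(2) in \<open>auto simp: cutset_def\<close>)
    from bridge_decomp[OF M U this] obtain Md Mh c where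
      I: "isI M Md Mh c ?e id" "rooted_map Md" "rooted_map Mh" "msig M c = ?e" "c \<in> mH M" by metis
    have "c = mroot Mh" using r(10)[OF I(5) r(2) I(4)] isID(7)[OF I(1)] by simp
    then show ?thesis using that(2) I by simp
  next
    case 3
    from root_edge_decomp[OF M 3] that(3) show ?thesis by metis
  qed
qed

section \<open>The labeling of a decomposed map\<close>

text \<open>Once dangling, \<open>x\<close> and \<open>y\<close> only lengthen the rotation around
  their vertices. Cut sets of \<open>M\<close> are restricted to \<open>N\<close>, and those of
  \<open>N\<close> are enlarged by whichever of \<open>x\<close> and \<open>y\<close> lies in a
  corner of the set.\<close>

lemma isR_bridge_dangling:
  assumes R: "isR M N c x y" "rooted_map N" and a: "mperm_inv M aM" "mperm_inv N aN"
    and eq: "\<And>h. h \<in> mH N \<Longrightarrow> aM h = aN h" "aM x = x" "aM y = y" and e: "e \<in> mH N"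
  shows "mbridge M aM e \<longleftrightarrow> mbridge N aN e"
proof
  note d = isRD[OF R(1)] and r = rooted_mapD[OF R(2)]
  have aN: "aN h \<in> mH N" if "h \<in> mH N" for h using a(2) that by (simp add: perm_inv_def)
  {
    assume "mbridge M aM e"
    then obtain U where U: "mcutset M aM e U" using is_bridge_iff[OF a(1)] by blast
    then have s: "\<And>u. u \<in> U \<Longrightarrow> msig M u \<in> U" and au: "\<And>u. u \<in> U \<Longrightarrow> u \<noteq> e \<Longrightarrow> aM u \<in> U"
      by (auto simp: cutset_def)
    have y: "msig N c \<in> U" if "y \<in> U" using s[OF that] d(12) by simp
    have "mcutset N aN e (U \<inter> mH N)"
      unfolding cutset_def
    proof (intro conjI ballI impI)
      fix u assume u: "u \<in> U \<inter> mH N"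
      show "aN u \<in> U \<inter> mH N" if "u \<noteq> e" using au[of u] u that eq(1)[of u] aN[of u] by simp
      show "msig N u \<in> U \<inter> mH N"
      proof (cases "u = mroot N")
        case True
        then have "msig M x \<in> U" using s[of u] s[of x] u d(10) by simp
        then show ?thesis using True d(11) y r(2,7) by (cases "c = mroot N") simp_all
      next
        case False
        then show ?thesis using s[of u] d(13)[of u] u y r(7)[of u] by (cases "u = c") simp_all
      qed
    qed (use U e eq(1)[OF e] in \<open>auto simp: cutset_def\<close>)
    then show "mbridge N aN e" using is_bridge_iff[OF a(2)] by blast
  next
    assume "mbridge N aN e"
    then obtain U where U: "mcutset N aN e U" using is_bridge_iff[OF a(2)] by blast
    then have s: "\<And>u. u \<in> U \<Longrightarrow> msig N u \<in> U" and UN: "\<And>u. u \<in> U \<Longrightarrow> u \<in> mH N"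
      and au: "\<And>u. u \<in> U \<Longrightarrow> u \<noteq> e \<Longrightarrow> aN u \<in> U" by (auto simp: cutset_def)
    let ?U = "U \<union> {h. h = x \<and> mroot N \<in> U \<or> h = y \<and> c \<in> U}"
    have "mcutset M aM e ?U"
      unfolding cutset_def
    proof (intro conjI ballI impI)
      show "?U \<subseteq> mH M" using UN d(5) by auto
      show "e \<in> ?U" using U by (simp add: cutset_def)
      show "aM e \<notin> ?U" using U eq(1)[OF e] aN[OF e] d(1,2) by (auto simp: cutset_def)
      fix u assume u: "u \<in> ?U"
      have 1: "aM u \<in> ?U" if "u \<in> U" "u \<noteq> e" using au[OF that] eq(1)[OF UN[OF that(1)]] by simp
      show "aM u \<in> ?U" if "u \<noteq> e" using u 1 that eq(2,3) by auto
      have 2: "msig M u \<in> ?U" if "u \<in> U"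
        using that s[of u] d(10) d(13)[of u] UN[of u] by (cases "u = mroot N"; cases "u = c") simp_all
      have 3: "msig M x \<in> ?U" if "mroot N \<in> U" using that s[of "mroot N"] d(11) by (cases "c = mroot N") simp_all
      have 4: "msig M y \<in> ?U" if "c \<in> U" using that s[of c] d(12) by simp
      show "msig M u \<in> ?U" using u 2 3 4 by blast
    qed
    then show "mbridge M aM e" using is_bridge_iff[OF a(1)] by blast
  }
qed

lemma bfl_goodI:
  assumes "rooted_map M" "\<And>h. h \<in> mH M \<Longrightarrow> \<exists>i<card (mH M). crn M i = h" "crn M (card (mH M)) = mroot M"
  shows "bfl_good M"
proof -
  have "crn M ` {..<card (mH M)} = mH M" using assms(2) crn_in[OF assms(1)] by fastforce
  then have "inj_on (crn M) {..<card (mH M)}" by (intro eq_card_imp_inj_on) simp_all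
  then show ?thesis using assms(3) by (simp add: bfl_good_def)
qed

lemma bfl_good_inj:
  assumes "bfl_good M" "i < card (mH M)" "j < card (mH M)"
  shows "crn M i = crn M j \<longleftrightarrow> i = j" "crn M i = mroot M \<longleftrightarrow> i = 0"
proof -
  have *: "crn M i = crn M j \<longleftrightarrow> i = j" if "i < card (mH M)" "j < card (mH M)" for i j
    using assms(1) that by (auto simp: bfl_good_def inj_on_def)
  then show "crn M i = crn M j \<longleftrightarrow> i = j" using assms(2,3) .
  have "0 < card (mH M)" using assms(2) by simp
  then show "crn M i = mroot M \<longleftrightarrow> i = 0" using *[of i 0] assms(2) by simp
qed

text \<open>The first step of the walk on \<open>M\<close> goes to \<open>x\<close> and cuts the new
  edge; from there it follows the walk on \<open>N\<close> one step late. The stop at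
  \<open>y\<close>, dangling by then, delays it by another step. The corner after \<open>x\<close>
  continues the root corner of \<open>N\<close>, whence the exception at
  \<open>i = 0\<close>.\<close>

lemma isR_labels:
  assumes R: "isR M N (crn N j) x y" "rooted_map N" and N: "bfl_good N" "j < card (mH N)"
  shows "i \<le> j \<Longrightarrow> crn M (i + 1) = (if i = 0 then x else crn N i)"
    "crn M (j + 2) = y" "j < i \<Longrightarrow> i \<le> card (mH N) \<Longrightarrow> crn M (i + 2) = crn N i" "bfl_good M"
proof -
  define c where "c = crn N j"
  note d = isRD[OF R(1), folded c_def] and r = rooted_mapD[OF R(2)]
  note M = isR_rooted[OF R] and inj = bfl_good_inj[OF N(1)]
  define sim where "sim = (\<lambda>aM aN. (\<forall>h\<in>mH N. aM h = aN h) \<and> aM x = x \<and> aM y = (y::nat))"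
  have xM: "x \<in> mH M" "y \<in> mH M" using d(5) by auto
  \<comment> \<open>Only the next half-edges have to agree, not the corners: \<open>x\<close> then
    stands for the root and \<open>y\<close> for \<open>c\<close>.\<close>
  have step: "crn M (Suc m) = crn N (Suc i) \<and> sim (inv_at M (Suc m)) (inv_at N (Suc i))"
    if e: "msig M (crn M m) = msig N (crn N i)" and s: "sim (inv_at M m) (inv_at N i)" for m i
  proof -
    define f where "f = msig N (crn N i)"
    have f: "f \<in> mH N" using r(7)[OF crn_in[OF R(2)]] by (simp add: f_def)
    note vM = bfl_valid_state[OF M, of m, unfolded bfl_valid_def] and vN = bfl_valid_state[OF R(2), of i, unfolded bfl_valid_def]
    have af: "inv_at N i f \<in> mH N" using vN f by (simp add: perm_inv_def)
    have eqf: "inv_at M m f = inv_at N i f" using s f by (simp add: sim_def)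
    have b: "mbridge M (inv_at M m) f \<longleftrightarrow> mbridge N (inv_at N i) f"
      by (rule isR_bridge_dangling[OF R]) (use vM vN s f in \<open>auto simp: sim_def\<close>)
    have c: "sim (cut (inv_at M m) f) (cut (inv_at N i) f)"
      using s f af eqf d(1,2) by (auto simp: sim_def cut_def)
    show ?thesis unfolding bfl_state_Suc bfl_step_def Let_def fst_conv snd_conv e f_def[symmetric]
      using eqf b c s by simp
  qed
  have first: "crn M (Suc 0) = x \<and> sim (inv_at M (Suc 0)) (inv_at N 0)"
  proof -
    have "msig M (mroot M) = x" using d(6,10) by simp
    moreover have "\<not> mbridge M (malp M) x" using isR_root_not_bridge[OF R] .
    moreover have "sim (cut (malp M) x) (malp N)" using d(1-3,7-9) by (auto simp: sim_def cut_def)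
    ultimately show ?thesis unfolding bfl_state_Suc bfl_step_def Let_def using d(3,7) by simp
  qed
  have sig_tl: "msig M (if i = 0 then x else crn N i) = (if i = j then y else msig N (crn N i))" if "i \<le> j" for i
    using that d(11) d(13)[of "crn N i"] inj[of i j] inj(2)[of j] N(2) crn_in[OF R(2), of i] by (auto simp: c_def)
  have phase1: "crn M (i + 1) = (if i = 0 then x else crn N i) \<and> sim (inv_at M (i + 1)) (inv_at N i)" if "i \<le> j" for i
    using that
  proof (induction i)
    case 0 then show ?case using first by simp
  next
    case (Suc i)
    then show ?case using step[of "i + 1" i] sig_tl[of i] by simp
  qed
  then show "crn M (i + 1) = (if i = 0 then x else crn N i)" if "i \<le> j" using that by blast
  have "msig M (crn M (j + 1)) = y" using phase1[of j] sig_tl[of j] by simp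
  then have phase2: "crn M (j + 2) = y \<and> sim (inv_at M (j + 2)) (inv_at N j)"
    using phase1[of j] bfl_state_Suc[of M "j + 1"] by (simp add: bfl_step_def Let_def sim_def)
  then show "crn M (j + 2) = y" by simp
  have phase3: "crn M (Suc (j + m) + 2) = crn N (Suc (j + m)) \<and> sim (inv_at M (Suc (j + m) + 2)) (inv_at N (Suc (j + m)))"
    if "Suc (j + m) \<le> card (mH N)" for m
    using that
  proof (induction m)
    case 0 then show ?case using step[of "j + 2" j] phase2 d(12) by (simp add: c_def)
  next
    case (Suc m)
    let ?i = "Suc (j + m)"
    have "crn N ?i \<noteq> mroot N" "crn N ?i \<noteq> c" using inj[of ?i j] Suc(2) N(2) by (auto simp: c_def)
    then show ?case using step[of "?i + 2" ?i] Suc d(13)[OF crn_in[OF R(2), of ?i]] by simp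
  qed
  show ph3: "crn M (i + 2) = crn N i" if "j < i" "i \<le> card (mH N)" for i
    using phase3[of "i - Suc j"] that by simp
  show "bfl_good M"
  proof (rule bfl_goodI[OF M], unfold isR_card[OF R])
    show "crn M (card (mH N) + 2) = mroot M" using ph3[of "card (mH N)"] N d(6) by (simp add: bfl_good_def)
    fix h assume "h \<in> mH M"
    then consider "h = x" | "h = y" | "h \<in> mH N" using d(5) by auto
    then show "\<exists>i<card (mH N) + 2. crn M i = h"
    proof cases
      case 1 then show ?thesis using first by (intro exI[of _ 1]) simp
    next
      case 2 then show ?thesis using phase2 N(2) by (intro exI[of _ "j + 2"]) simp
    next
      case 3
      then obtain i where i: "i < card (mH N)" "h = crn N i" using bfl_good_surj[OF N(1) R(2)] by blast
      consider "i = 0" | "0 < i" "i \<le> j" | "j < i" by linarith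
      then show ?thesis
      proof cases
        case 1 then show ?thesis using i d(6) by (intro exI[of _ 0]) simp
      next
        case 2 then show ?thesis using i phase1[of i] by (intro exI[of _ "i + 1"]) simp
      next
        case 3 then show ?thesis using i ph3[of i] by (intro exI[of _ "i + 2"]) simp
      qed
    qed
  qed
qed

text \<open>The involution \<open>aM\<close> on \<open>M\<close> restricts to \<open>aN\<close> and \<open>a'\<close> on the two sides of the attaching bridge.\<close>

definition simI :: "rmap \<Rightarrow> rmap \<Rightarrow> nat \<Rightarrow> (nat \<Rightarrow> nat) \<Rightarrow> (nat \<Rightarrow> nat) \<Rightarrow> (nat \<Rightarrow> nat) \<Rightarrow> (nat \<Rightarrow> nat) \<Rightarrow> bool" where
  "simI M' N z g aM aN a' \<longleftrightarrow> (\<forall>h\<in>mH N. aM h = aN h) \<and> aM z = g (mroot M') \<and> aM (g (mroot M')) = z \<and>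
     (\<forall>h\<in>mH M'. h \<noteq> mroot M' \<longrightarrow> aM (g h) = g (a' h))"

text \<open>The attaching edge separates the two sides whatever has been cut on them. For the other
  edges, a cut set of one side takes in the attaching edge and the whole other side if it contains
  the point of attachment; conversely a cut set of \<open>M\<close> is restricted.\<close>

lemma isI_bridges:
  assumes I: "isI M M' N c z g" "rooted_map N" "rooted_map M'"
    and a: "mperm_inv M aM" "mperm_inv N aN" "mperm_inv M' a'"
    and a'r: "a' (mroot M') = mroot M'" and sim: "simI M' N z g aM aN a'"
  shows "e \<in> mH N \<Longrightarrow> mbridge M aM e \<longleftrightarrow> mbridge N aN e"
    "e \<in> mH M' \<Longrightarrow> e \<noteq> mroot M' \<Longrightarrow> mbridge M aM (g e) \<longleftrightarrow> mbridge M' a' e"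
    "mbridge M aM z" "mbridge M aM (g (mroot M'))"
proof -
  note d = isID[OF I(1)] and r = rooted_mapD[OF I(2)] and r' = rooted_mapD[OF I(3)] and gi = isI_inj[OF I(1)]
  have sN: "\<And>h. h \<in> mH N \<Longrightarrow> aM h = aN h" and sz: "aM z = g (mroot M')" "aM (g (mroot M')) = z"
    and s': "\<And>h. h \<in> mH M' \<Longrightarrow> h \<noteq> mroot M' \<Longrightarrow> aM (g h) = g (a' h)" using sim by (auto simp: simI_def)
  have aN: "\<And>h. h \<in> mH N \<Longrightarrow> aN h \<in> mH N" and a': "\<And>h. h \<in> mH M' \<Longrightarrow> a' h \<in> mH M'"
    using a by (auto simp: perm_inv_def)
  note grN = d(5)[OF r'(2)] and grz = d(4)[OF r'(2)]
  have sgN: "msig M u \<in> mH N \<union> {z}" if "u \<in> mH N \<union> {z}" for u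
    using that d(14) r(7)[of u] r(7)[OF d(1)] d(13)[of u] by (cases "u = z"; cases "u = c") simp_all
  have "mcutset M aM z (mH N \<union> {z})" unfolding cutset_def
    using d(6) sz grN grz sgN sN aN by auto
  then show bz: "mbridge M aM z" using is_bridge_iff[OF a(1)] by blast
  have "mcutset M aM (g (mroot M')) (g ` mH M')" unfolding cutset_def
  proof (intro conjI ballI impI)
    show "aM (g (mroot M')) \<notin> g ` mH M'" unfolding sz(2) using d(4) by (metis imageE)
    fix u assume "u \<in> g ` mH M'"
    then obtain h where h: "h \<in> mH M'" "u = g h" by blast
    show "msig M u \<in> g ` mH M'" using h d(11) r'(7) by simp
    show "aM u \<in> g ` mH M'" if "u \<noteq> g (mroot M')" using h s'[of h] a'[of h] that by (metis image_eqI)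
  qed (use d(6) r'(2) in auto)
  then show "mbridge M aM (g (mroot M'))" using is_bridge_iff[OF a(1)] by blast
  show "mbridge M aM e \<longleftrightarrow> mbridge N aN e" if e: "e \<in> mH N"
  proof
    assume "mbridge M aM e"
    then obtain U where U: "mcutset M aM e U" using is_bridge_iff[OF a(1)] by blast
    then have s: "\<And>u. u \<in> U \<Longrightarrow> msig M u \<in> U" and au: "\<And>u. u \<in> U \<Longrightarrow> u \<noteq> e \<Longrightarrow> aM u \<in> U"
      by (auto simp: cutset_def)
    have "mcutset N aN e (U \<inter> mH N)"
      unfolding cutset_def
    proof (intro conjI ballI impI)
      fix u assume u: "u \<in> U \<inter> mH N"
      show "aN u \<in> U \<inter> mH N" if "u \<noteq> e" using u that au[of u] sN[of u] aN[of u] by simp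
      show "msig N u \<in> U \<inter> mH N"
        using u s[of u] s[of z] d(13)[of u] d(14) r(7)[of u] by (cases "u = c") simp_all
    qed (use U e sN[OF e] in \<open>auto simp: cutset_def\<close>)
    then show "mbridge N aN e" using is_bridge_iff[OF a(2)] by blast
  next
    assume "mbridge N aN e"
    then obtain U where U: "mcutset N aN e U" using is_bridge_iff[OF a(2)] by blast
    then have s: "\<And>u. u \<in> U \<Longrightarrow> msig N u \<in> U" and UN: "\<And>u. u \<in> U \<Longrightarrow> u \<in> mH N"
      and au: "\<And>u. u \<in> U \<Longrightarrow> u \<noteq> e \<Longrightarrow> aN u \<in> U" by (auto simp: cutset_def)
    let ?U = "U \<union> {h. c \<in> U \<and> (h = z \<or> h \<in> g ` mH M')}"
    have "mcutset M aM e ?U"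
      unfolding cutset_def
    proof (intro conjI ballI impI)
      show "?U \<subseteq> mH M" using UN d(6) by auto
      show "e \<in> ?U" using U by (simp add: cutset_def)
      show "aM e \<notin> ?U" using U sN[OF e] aN[OF e] d(2,5) by (auto simp: cutset_def)
      fix u assume u: "u \<in> ?U"
      have g: "aM (g h) \<in> ?U" if "c \<in> U" "h \<in> mH M'" for h
        using that s'[of h] sz a'[of h] by (cases "h = mroot M'") auto
      have "aM u \<in> ?U" if "u \<in> U" "u \<noteq> e" using au[OF that] sN[OF UN[OF that(1)]] by simp
      moreover have "aM z \<in> ?U" if "c \<in> U" using that sz r'(2) by simp
      ultimately show "aM u \<in> ?U" if "u \<noteq> e" using u that g by blast
      have "msig M u \<in> ?U" if "u \<in> U"
        using that s[of u] d(13)[of u] UN[of u] by (cases "u = c") simp_all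
      moreover have "msig M z \<in> ?U" if "c \<in> U" using that s d(14) by simp
      moreover have "msig M (g h) \<in> ?U" if "c \<in> U" "h \<in> mH M'" for h using that d(11) r'(7) by simp
      ultimately show "msig M u \<in> ?U" using u by blast
    qed
    then show "mbridge M aM e" using is_bridge_iff[OF a(1)] by blast
  qed
  show "mbridge M aM (g e) \<longleftrightarrow> mbridge M' a' e" if e: "e \<in> mH M'" "e \<noteq> mroot M'"
  proof
    assume "mbridge M aM (g e)"
    then obtain U where U: "mcutset M aM (g e) U" using is_bridge_iff[OF a(1)] by blast
    then have s: "\<And>u. u \<in> U \<Longrightarrow> msig M u \<in> U" and au: "\<And>u. u \<in> U \<Longrightarrow> u \<noteq> g e \<Longrightarrow> aM u \<in> U"
      by (auto simp: cutset_def)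
    let ?U = "{h \<in> mH M'. g h \<in> U}"
    have "mcutset M' a' e ?U"
      unfolding cutset_def
    proof (intro conjI ballI impI)
      fix u assume u: "u \<in> ?U"
      show "a' u \<in> ?U" if "u \<noteq> e"
        using u that au[of "g u"] s'[of u] a'[of u] gi[of u e] e a'r by (cases "u = mroot M'") simp_all
      show "msig M' u \<in> ?U" using u s[of "g u"] d(11)[of u] r'(7)[of u] by simp
    qed (use U e s'[OF e] in \<open>auto simp: cutset_def\<close>)
    then show "mbridge M' a' e" using is_bridge_iff[OF a(3)] by blast
  next
    assume "mbridge M' a' e"
    then obtain U where U: "mcutset M' a' e U" using is_bridge_iff[OF a(3)] by blast
    then have s: "\<And>u. u \<in> U \<Longrightarrow> msig M' u \<in> U" and UN: "\<And>u. u \<in> U \<Longrightarrow> u \<in> mH M'"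
      and au: "\<And>u. u \<in> U \<Longrightarrow> u \<noteq> e \<Longrightarrow> a' u \<in> U" by (auto simp: cutset_def)
    let ?U = "g ` U \<union> {h. mroot M' \<in> U \<and> (h \<in> mH N \<union> {z})}"
    have mem: "g h \<in> ?U \<longleftrightarrow> h \<in> U" if "h \<in> mH M'" for h
      using that gi UN d(4,5)[OF that] by auto
    have "mcutset M aM (g e) ?U"
      unfolding cutset_def
    proof (intro conjI ballI impI)
      show "?U \<subseteq> mH M" using UN d(6) by auto
      show "g e \<in> ?U" using U by (simp add: cutset_def)
      show "aM (g e) \<notin> ?U" using U s'[OF e] mem a'[OF e(1)] by (simp add: cutset_def)
      fix u assume u: "u \<in> ?U"
      have "aM (g h) \<in> ?U" if "h \<in> U" "g h \<noteq> g e" for h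
        using that au[of h] s'[OF UN[OF that(1)]] sz by (cases "h = mroot M'") auto
      moreover have "aM h \<in> ?U" if "mroot M' \<in> U" "h \<in> mH N \<union> {z}" for h
        using that sN[of h] aN[of h] sz by (cases "h = z") auto
      ultimately show "aM u \<in> ?U" if "u \<noteq> g e" using u that by blast
      have "msig M (g h) \<in> ?U" if "h \<in> U" for h using s[OF that] d(11)[OF UN[OF that]] by simp
      moreover have "msig M h \<in> ?U" if "mroot M' \<in> U" "h \<in> mH N \<union> {z}" for h
        using sgN[OF that(2)] that(1) by blast
      ultimately show "msig M u \<in> ?U" using u by blast
    qed
    then show "mbridge M aM (g e)" using is_bridge_iff[OF a(1)] by blast
  qed
qed

text \<open>At corner \<open>k\<close> the walk meets \<open>z\<close>, crosses the bridge, tours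
  the copy of \<open>M'\<close> and crosses back, which puts it at \<open>z\<close>; then the walk
  on \<open>N\<close> resumes. The detour takes one step for each half-edge of \<open>M'\<close> and
  one for \<open>z\<close>.\<close>

lemma isI_labels:
  assumes I: "isI M M' N (crn N k) z g" "rooted_map N" "rooted_map M'"
    and good: "bfl_good N" "bfl_good M'" and k: "k < card (mH N)"
  shows "i \<le> k \<Longrightarrow> crn M i = crn N i"
    "i < card (mH M') \<Longrightarrow> crn M (k + 1 + i) = g (crn M' i)"
    "crn M (k + 1 + card (mH M')) = z"
    "k < i \<Longrightarrow> i \<le> card (mH N) \<Longrightarrow> crn M (i + 1 + card (mH M')) = crn N i" "bfl_good M"
proof -
  define c where "c = crn N k"
  define n' where "n' = card (mH M')"
  note d = isID[OF I(1), folded c_def] and r = rooted_mapD[OF I(2)] and r' = rooted_mapD[OF I(3)]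
  note M = isI_rooted[OF I] and inj = bfl_good_inj[OF good(1)] and inj' = bfl_good_inj[OF good(2)] and gi = isI_inj[OF I(1)]
  have n'0: "0 < n'" using r'(1,2) by (auto simp: n'_def card_gt_0_iff)
  let ?sim = "simI M' N z g"
  note b = isI_bridges[OF I]
  have stepN: "crn M (Suc m) = crn N (Suc i) \<and> ?sim (inv_at M (Suc m)) (inv_at N (Suc i)) (inv_at M' l)"
    if e: "msig M (crn M m) = msig N (crn N i)" and s: "?sim (inv_at M m) (inv_at N i) (inv_at M' l)" for m i l
  proof -
    define f where "f = msig N (crn N i)"
    have f: "f \<in> mH N" using r(7)[OF crn_in[OF I(2)]] by (simp add: f_def)
    note vM = bfl_valid_state[OF M, of m, unfolded bfl_valid_def] and vN = bfl_valid_state[OF I(2), of i, unfolded bfl_valid_def]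
      and v' = bfl_valid_state[OF I(3), of l, unfolded bfl_valid_def]
    have af: "inv_at N i f \<in> mH N" using vN f by (simp add: perm_inv_def)
    have eqf: "inv_at M m f = inv_at N i f" using s f by (simp add: simI_def)
    have b: "mbridge M (inv_at M m) f \<longleftrightarrow> mbridge N (inv_at N i) f"
      by (rule b(1)[OF _ _ _ _ s f]) (use vM vN v' in auto)
    have nf: "z \<noteq> f" "z \<noteq> inv_at N i f" "\<And>h. h \<in> mH M' \<Longrightarrow> g h \<noteq> f \<and> g h \<noteq> inv_at N i f" using d(2,5) f af by metis+
    have c: "?sim (cut (inv_at M m) f) (cut (inv_at N i) f) (inv_at M' l)"
      using s f af eqf nf r'(2) by (simp add: simI_def cut_def)
    show ?thesis unfolding bfl_state_Suc bfl_step_def Let_def fst_conv snd_conv e f_def[symmetric]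
      using eqf b c s by simp
  qed
  have step': "crn M (Suc m) = g (crn M' (Suc l)) \<and> ?sim (inv_at M (Suc m)) (inv_at N i) (inv_at M' (Suc l))"
    if e: "crn M m = g (crn M' l)" and nr: "msig M' (crn M' l) \<noteq> mroot M'"
      and s: "?sim (inv_at M m) (inv_at N i) (inv_at M' l)" for m i l
  proof -
    define f where "f = msig M' (crn M' l)"
    have f: "f \<in> mH M'" using r'(7)[OF crn_in[OF I(3)]] by (simp add: f_def)
    have ef: "msig M (crn M m) = g f" using e d(11)[OF crn_in[OF I(3)]] by (simp add: f_def)
    have fr: "f \<noteq> mroot M'" using nr by (simp add: f_def)
    note vM = bfl_valid_state[OF M, of m, unfolded bfl_valid_def] and vN = bfl_valid_state[OF I(2), of i, unfolded bfl_valid_def]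
      and v' = bfl_valid_state[OF I(3), of l, unfolded bfl_valid_def]
    have af: "inv_at M' l f \<in> mH M'" "inv_at M' l (inv_at M' l f) = f" using v' f by (simp_all add: perm_inv_def)
    have afr: "inv_at M' l f \<noteq> mroot M'" using v' af(2) fr by metis
    have eqf: "inv_at M m (g f) = g (inv_at M' l f)" using s f fr by (simp add: simI_def)
    have b: "mbridge M (inv_at M m) (g f) \<longleftrightarrow> mbridge M' (inv_at M' l) f"
      by (rule b(2)[OF _ _ _ _ s f fr]) (use vM vN v' in auto)
    have nf: "z \<noteq> g f" "z \<noteq> g (inv_at M' l f)" "\<And>h. h \<in> mH N \<Longrightarrow> h \<noteq> g f \<and> h \<noteq> g (inv_at M' l f)"
      using d(4,5) f af by auto
    have c: "?sim (cut (inv_at M m) (g f)) (inv_at N i) (cut (inv_at M' l) f)"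
      using s f af eqf nf r'(2) fr afr gi by (simp add: simI_def cut_def)
    have eqf2: "g (inv_at M' l f) = g f \<longleftrightarrow> inv_at M' l f = f" using gi af f by simp
    show ?thesis unfolding bfl_state_Suc bfl_step_def Let_def fst_conv snd_conv ef f_def[symmetric]
      using eqf eqf2 b c s by simp
  qed
  have up: "crn M (Suc m) = g (mroot M') \<and> inv_at M (Suc m) = inv_at M m"
    if e: "msig M (crn M m) = z" and s: "?sim (inv_at M m) (inv_at N i) (inv_at M' l)" for m i l
  proof -
    have "mbridge M (inv_at M m) z"
      by (rule b(3)[OF _ _ _ _ s]) (use bfl_valid_state[OF M, of m] bfl_valid_state[OF I(2), of i] bfl_valid_state[OF I(3), of l] in \<open>auto simp: bfl_valid_def\<close>)
    moreover have "inv_at M m z = g (mroot M')" "g (mroot M') \<noteq> z" using s d(4) r'(2) by (simp_all add: simI_def)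
    ultimately show ?thesis unfolding bfl_state_Suc bfl_step_def Let_def fst_conv snd_conv e by simp
  qed
  have down: "crn M (Suc m) = z \<and> inv_at M (Suc m) = inv_at M m"
    if e: "msig M (crn M m) = g (mroot M')" and s: "?sim (inv_at M m) (inv_at N i) (inv_at M' l)" for m i l
  proof -
    have "mbridge M (inv_at M m) (g (mroot M'))"
      by (rule b(4)[OF _ _ _ _ s]) (use bfl_valid_state[OF M, of m] bfl_valid_state[OF I(2), of i] bfl_valid_state[OF I(3), of l] in \<open>auto simp: bfl_valid_def\<close>)
    moreover have "inv_at M m (g (mroot M')) = z" "g (mroot M') \<noteq> z" using s d(4) r'(2) by (simp_all add: simI_def)
    ultimately show ?thesis unfolding bfl_state_Suc bfl_step_def Let_def fst_conv snd_conv e by simp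
  qed
  have phase1: "crn M i = crn N i \<and> ?sim (inv_at M i) (inv_at N i) (inv_at M' 0)" if "i \<le> k" for i
    using that
  proof (induction i)
    case 0 then show ?case using d(7-10,12) by (simp add: simI_def)
  next
    case (Suc i)
    then have "crn N i \<noteq> c" using inj(1)[of i k] k by (simp add: c_def)
    then show ?case using stepN[of i i 0] Suc d(13)[OF crn_in[OF I(2), of i]] by simp
  qed
  then show "crn M i = crn N i" if "i \<le> k" using that by blast
  have "msig M (crn M k) = z" using phase1[of k] d(13)[OF d(1)] by (simp add: c_def)
  then have p1: "crn M (k + 1) = g (mroot M') \<and> ?sim (inv_at M (k + 1)) (inv_at N k) (inv_at M' 0)"
    using up[of k k 0] phase1[of k] by simp
  have phase2: "crn M (k + 1 + i) = g (crn M' i) \<and> ?sim (inv_at M (k + 1 + i)) (inv_at N k) (inv_at M' i)" if "i < n'" for i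
    using that
  proof (induction i)
    case 0 then show ?case using p1 by simp
  next
    case (Suc i)
    then have "msig M' (crn M' i) \<noteq> mroot M'"
      using bfl_good_msig_root[OF good(2) I(3), of i] by (simp add: n'_def)
    then show ?case using step'[of "k + 1 + i" i k] Suc by simp
  qed
  then show "crn M (k + 1 + i) = g (crn M' i)" if "i < card (mH M')" for i using that by (simp add: n'_def)
  \<comment> \<open>Here the walk on \<open>M'\<close> alone would end. In \<open>M\<close> the
    rotation meets the bridge from the far end and leads back to \<open>z\<close>.\<close>
  have "msig M' (crn M' (n' - 1)) = mroot M'"
    using bfl_good_msig_root[OF good(2) I(3), of "n' - 1"] n'0 by (simp add: n'_def)
  then have "msig M (crn M (k + n')) = g (mroot M')"
    using phase2[of "n' - 1"] n'0 d(11)[OF crn_in[OF I(3), of "n' - 1"]] by simp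
  then have phase3: "crn M (k + 1 + n') = z \<and> ?sim (inv_at M (k + 1 + n')) (inv_at N k) (inv_at M' (n' - 1))"
    using down[of "k + n'" k "n' - 1"] phase2[of "n' - 1"] n'0 by simp
  then show "crn M (k + 1 + card (mH M')) = z" by (simp add: n'_def)
  have phase4: "crn M (Suc (k + m) + 1 + n') = crn N (Suc (k + m)) \<and>
      ?sim (inv_at M (Suc (k + m) + 1 + n')) (inv_at N (Suc (k + m))) (inv_at M' (n' - 1))"
    if "Suc (k + m) \<le> card (mH N)" for m
    using that
  proof (induction m)
    case 0 then show ?case using stepN[of "k + 1 + n'" k "n' - 1"] phase3 d(14) by (simp add: c_def)
  next
    case (Suc m)
    let ?i = "Suc (k + m)"
    have "crn N ?i \<noteq> c" using inj[of ?i k] Suc(2) k by (auto simp: c_def)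
    then show ?case using stepN[of "?i + 1 + n'" ?i "n' - 1"] Suc d(13)[OF crn_in[OF I(2), of ?i]] by simp
  qed
  have ph4: "crn M (i + 1 + n') = crn N i" if "k < i" "i \<le> card (mH N)" for i
    using phase4[of "i - Suc k"] that by simp
  then show "crn M (i + 1 + card (mH M')) = crn N i" if "k < i" "i \<le> card (mH N)" for i
    using that by (simp add: n'_def)
  show "bfl_good M"
  proof (rule bfl_goodI[OF M], unfold isI_card[OF I] n'_def[symmetric])
    show "crn M (card (mH N) + 1 + n') = mroot M" using ph4[of "card (mH N)"] good(1) k d(7) by (simp add: bfl_good_def)
    fix h assume "h \<in> mH M"
    then consider "h = z" | l where "l \<in> mH M'" "h = g l" | "h \<in> mH N" using d(6) by auto
    then show "\<exists>i<card (mH N) + 1 + n'. crn M i = h"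
    proof cases
      case 1 then show ?thesis using phase3 k by (intro exI[of _ "k + 1 + n'"]) simp
    next
      case (2 l)
      then obtain i where i: "i < n'" "l = crn M' i" using bfl_good_surj[OF good(2) I(3)] by (auto simp: n'_def)
      then show ?thesis using 2 phase2[of i] k by (intro exI[of _ "k + 1 + i"]) simp
    next
      case 3
      then obtain i where i: "i < card (mH N)" "h = crn N i" using bfl_good_surj[OF good(1) I(2)] by blast
      show ?thesis
      proof (cases "i \<le> k")
        case True then show ?thesis using i phase1[of i] by (intro exI[of _ i]) simp
      next
        case False then show ?thesis using i ph4[of i] by (intro exI[of _ "i + 1 + n'"]) simp
      qed
    qed
  qed
qed

text \<open>\<open>rooted_map_cases\<close> speaks of corners as half-edges, not as labels, so it is
  available before labels are known to reach every corner. That the corner \<open>c\<close> of an R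
  has a label comes from the smaller map.\<close>

theorem bfl_good_rooted: "rooted_map M \<Longrightarrow> bfl_good M"
proof (induction "card (mH M)" arbitrary: M rule: less_induct)
  case less
  from \<open>rooted_map M\<close> show ?case
  proof (cases rule: rooted_map_cases)
    case one
    then have "crn M 1 = mroot M"
      using rooted_mapD(5)[OF less(2)] bfl_state_Suc[of M 0] by (simp add: bfl_step_def Let_def)
    then show ?thesis by (intro bfl_goodI[OF less(2)]) (use one in auto)
  next
    case (bridge Md Mu z)
    have pos: "card (mH Mu) > 0" using rooted_mapD(1,2)[OF bridge(3)] by (auto simp: card_gt_0_iff)
    then have "bfl_good Md" "bfl_good Mu" using less(1) bridge isI_card[OF bridge(1,3,2)] by auto
    moreover have "isI M Md Mu (crn Mu 0) z id" using bridge(1) by simp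
    ultimately show ?thesis using isI_labels(5)[of M Md Mu 0 z id] bridge pos by blast
  next
    case (R N c x y)
    then have g: "bfl_good N" using less(1) isR_card[OF R] by simp
    obtain j where "j < card (mH N)" "c = crn N j" using bfl_good_surj[OF g R(2) isRD(4)[OF R(1)]] .
    then show ?thesis using isR_labels(4) R g by blast
  qed
qed

section \<open>Commuting the two constructions\<close>

text \<open>In \<open>N\<close> the half-edge \<open>z\<close> splits the root corner of
  \<open>Nu\<close>. The part behind \<open>z\<close> is treated here, whence the case distinction
  on \<open>p\<close>; the part before it is the root corner of \<open>N\<close>, where an insertion
  creates a new root bridge.\<close>

lemma isI_isI_outer:
  assumes I: "isI N Nd Nu (mroot Nu) z g" and J: "isI M M' N (if p = mroot Nu then z else p) w g2"
    and K: "isI M1 M' Nu p w g2" and r: "rooted_map Nd" "rooted_map Nu" "rooted_map M'"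
  shows "isI M Nd M1 (mroot M1) z g"
proof -
  note i = isID[OF I] and j = isID[OF J] and k = isID[OF K] and rd = rooted_mapD[OF r(1)] and ru = rooted_mapD[OF r(2)]
    and r' = rooted_mapD[OF r(3)]
  have zN: "z \<in> mH N" using i(6) by simp
  have uN: "h \<in> mH N" if "h \<in> mH Nu" for h using i(6) that by simp
  have dN: "g h \<in> mH N" if "h \<in> mH Nd" for h using i(6) that by simp
  have zw: "z \<noteq> w" "\<And>h. h \<in> mH M' \<Longrightarrow> g2 h \<noteq> z" using j(2,5) zN by metis+
  have gw: "g h \<noteq> w" "\<And>l. l \<in> mH M' \<Longrightarrow> g2 l \<noteq> g h" if "h \<in> mH Nd" for h
    using j(2,5) dN[OF that] by metis+
  have cs: "h \<in> mH Nu \<or> h = w \<or> (\<exists>l\<in>mH M'. h = g2 l)" if "h \<in> mH M1" for h using k(6) that by auto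
  have aM: "malp M h = malp N h" if "h \<in> mH N" for h using j(12)[OF that] .
  have rp: "mroot Nu \<noteq> z" "\<And>h. h \<in> mH Nd \<Longrightarrow> g h \<noteq> p" using ru(2) i(2,5) k(1) by metis+
  show ?thesis unfolding isI_def
  proof (intro conjI ballI impI)
    show "mroot M1 \<in> mH M1" using k(6,7) ru(2) by simp
    show "z \<notin> mH M1" using cs[of z] i(2) zw by metis
    show "inj_on g (mH Nd)" "z \<notin> g ` mH Nd" using i(3,4) by auto
    have "g h \<notin> mH M1" if "h \<in> mH Nd" for h using cs[of "g h"] i(5)[OF that] gw[OF that] by metis
    then show "mH M1 \<inter> g ` mH Nd = {}" by blast
    show "mH M = mH M1 \<union> {z} \<union> g ` mH Nd" using j(6) i(6) k(6) by auto
    show "mroot M = mroot M1" using j(7) i(7) k(7) by simp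
    show "malp M z = g (mroot Nd)" using aM[OF zN] i(8) by simp
    show "malp M (g (mroot Nd)) = z" using aM[OF dN[OF rd(2)]] i(9) by simp
    show "malp M (g h) = g (malp Nd h)" if "h \<in> mH Nd" "h \<noteq> mroot Nd" for h
      using aM[OF dN[OF that(1)]] i(10)[OF that] by simp
    show "msig M (g h) = g (msig Nd h)" if "h \<in> mH Nd" for h
      using j(13)[OF dN[OF that]] i(4)[OF that] rp(2)[OF that] i(11)[OF that] by simp
    show "malp M h = malp M1 h" if "h \<in> mH M1" for h
      using cs[OF that]
    proof (elim disjE bexE)
      assume "h \<in> mH Nu" then show ?thesis using aM[OF uN] i(12) k(12) by simp
    next
      assume "h = w" then show ?thesis using j(8) k(8) by simp
    next
      fix l assume "l \<in> mH M'" "h = g2 l"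
      then show ?thesis using j(9) k(9) j(10)[of l] k(10)[of l] by (cases "l = mroot M'") simp_all
    qed
    show "msig M h = (if h = mroot M1 then z else msig M1 h)" if "h \<in> mH M1" for h
      using cs[OF that]
    proof (elim disjE bexE)
      assume h: "h \<in> mH Nu"
      then have "h \<noteq> z" using i(2) by auto
      then show ?thesis using j(13)[OF uN[OF h]] i(13)[OF h] k(7) k(13)[OF h]
        by (cases "p = mroot Nu"; cases "h = mroot Nu") simp_all
    next
      assume h: "h = w"
      then have "h \<noteq> mroot M1" using k(2,7) ru(2) by auto
      then show ?thesis using h j(14) k(14) i(14) i(13)[OF k(1)] by (cases "p = mroot Nu") simp_all
    next
      fix l assume l: "l \<in> mH M'" "h = g2 l"
      then have "h \<noteq> mroot M1" using k(5)[OF l(1)] k(7) ru(2) by auto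
      then show ?thesis using l j(11) k(11) by simp
    qed
    show "msig M z = msig M1 (mroot M1)"
      using j(13)[OF zN] i(14) k(7) k(13)[OF ru(2)] k(1) i(2) by (cases "p = mroot Nu") auto
  qed
qed

lemma isI_isI_inner:
  assumes I: "isI N Nd Nu (mroot Nu) z g" and J: "isI M M' N (g q) w g2"
    and K: "isI M1 M' Nd q w' g'" and r: "rooted_map Nd" "rooted_map Nu" "rooted_map M'"
  obtains G where "isI M M1 Nu (mroot Nu) z G"
proof -
  note i = isID[OF I] and j = isID[OF J] and k = isID[OF K] and rd = rooted_mapD[OF r(1)] and ru = rooted_mapD[OF r(2)]
    and r' = rooted_mapD[OF r(3)]
  have zN: "z \<in> mH N" using i(6) by simp
  have uN: "h \<in> mH N" if "h \<in> mH Nu" for h using i(6) that by simp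
  have dN: "g h \<in> mH N" if "h \<in> mH Nd" for h using i(6) that by simp
  \<comment> \<open>\<open>M1\<close> is built with names unrelated to those in \<open>M\<close>;
    \<open>G\<close> sends its copy of \<open>M'\<close> to the copy attached by
    \<open>J\<close>.\<close>
  define G where "G = (\<lambda>h. if h \<in> mH Nd then g h else if h = w' then w else g2 (inv_into (mH M') g' h))"
  have Gd: "G h = g h" if "h \<in> mH Nd" for h using that by (simp add: G_def)
  have Gw: "G w' = w" using k(2) by (simp add: G_def)
  have Gg: "G (g' h) = g2 h" if "h \<in> mH M'" for h using k(3,4,5) that by (simp add: G_def)
  have cs: "h \<in> mH Nd \<or> h = w' \<or> (\<exists>l\<in>mH M'. h = g' l)" if "h \<in> mH M1" for h using k(6) that by auto
  have im: "G ` mH M1 = g ` mH Nd \<union> {w} \<union> g2 ` mH M'"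
  proof -
    have "G ` mH Nd = g ` mH Nd" using Gd by auto
    moreover have "G ` g' ` mH M' = g2 ` mH M'" using Gg by (auto simp: image_image)
    ultimately show ?thesis unfolding k(6) image_Un using Gw by simp
  qed
  have "isI M M1 Nu (mroot Nu) z G" unfolding isI_def
  proof (intro conjI ballI impI)
    show "mroot Nu \<in> mH Nu" "z \<notin> mH Nu" using ru(2) i(2) by auto
    show "inj_on G (mH M1)"
    proof (rule inj_onI)
      fix h l assume h: "h \<in> mH M1" "l \<in> mH M1" "G h = G l"
      have 1: "g a \<noteq> w" "g a \<noteq> g2 b" if "a \<in> mH Nd" "b \<in> mH M'" for a b using dN[OF that(1)] j(2) j(5)[OF that(2)] by metis+
      have w: "g a \<noteq> w" if "a \<in> mH Nd" for a using dN[OF that] j(2) by auto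
      show "h = l" using cs[OF h(1)] cs[OF h(2)] h(3) Gd Gw Gg 1 w j(4) isI_inj[OF I] isI_inj[OF J] by (elim disjE bexE) metis+
    qed
    show "z \<notin> G ` mH M1" unfolding im using i(4) j(2) j(5) zN by (metis UnE imageE singletonD)
    have "h \<notin> G ` mH M1" if "h \<in> mH Nu" for h
      unfolding im using i(5) j(2) j(5) uN[OF that] that by (metis UnE imageE singletonD)
    then show "mH Nu \<inter> G ` mH M1 = {}" by blast
    show "mH M = mH Nu \<union> {z} \<union> G ` mH M1" unfolding im using j(6) i(6) by auto
    show "mroot M = mroot Nu" using j(7) i(7) by simp
    have R: "mroot M1 = mroot Nd" using k(7) .
    show "malp M z = G (mroot M1)" using j(12)[OF zN] i(8) R Gd[OF rd(2)] by simp
    show "malp M (G (mroot M1)) = z" using j(12)[OF dN[OF rd(2)]] i(9) R Gd[OF rd(2)] by simp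
    show "malp M (G h) = G (malp M1 h)" if "h \<in> mH M1" "h \<noteq> mroot M1" for h
      using cs[OF that(1)]
    proof (elim disjE bexE)
      assume h: "h \<in> mH Nd"
      then show ?thesis using j(12)[OF dN[OF h]] i(10)[OF h] that R k(12)[OF h] Gd rd(8)[OF h] by simp
    next
      assume "h = w'" then show ?thesis using j(8) k(8) Gw Gg r'(2) by simp
    next
      fix l assume "l \<in> mH M'" "h = g' l"
      then show ?thesis using j(9) k(9) j(10)[of l] k(10)[of l] Gw Gg r'(8)[of l] by (cases "l = mroot M'") simp_all
    qed
    show "msig M (G h) = G (msig M1 h)" if "h \<in> mH M1" for h
      using cs[OF that]
    proof (elim disjE bexE)
      assume h: "h \<in> mH Nd"
      then show ?thesis using j(13)[OF dN[OF h]] i(11)[OF h] isI_inj[OF I h k(1)] k(13)[OF h] Gd Gw rd(7)[OF h] by simp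
    next
      assume "h = w'" then show ?thesis using j(14) k(14) i(11)[OF k(1)] Gw Gd rd(7)[OF k(1)] by simp
    next
      fix l assume "l \<in> mH M'" "h = g' l"
      then show ?thesis using j(11) k(11) Gg r'(7) by simp
    qed
    fix h assume h: "h \<in> mH Nu"
    show "malp M h = malp Nu h" using j(12)[OF uN[OF h]] i(12)[OF h] by simp
    have "h \<noteq> g q" using h i(5) k(1) by auto
    then show "msig M h = (if h = mroot Nu then z else msig Nu h)" using j(13)[OF uN[OF h]] i(13)[OF h] by simp
  next
    have "z \<noteq> g q" using i(4) k(1) by auto
    then show "msig M z = msig Nu (mroot Nu)" using j(13)[OF zN] i(14) by simp
  qed
  then show ?thesis by (rule that)
qed

text \<open>For corners labeled up to that of \<open>c\<close>. If \<open>p = c\<close>, then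
  \<open>w\<close> comes between \<open>c\<close> and \<open>y\<close>, and \<open>y\<close> now
  lies in the corner after \<open>w\<close>. If \<open>p\<close> is the root corner, its
  continuation in \<open>N\<close> is the corner after \<open>x\<close>.\<close>

lemma isR_isI_before:
  assumes R: "isR N N' c x y" and J: "isI M M' N (if p = mroot N' then x else p) w g2"
    and K: "isI M1 M' N' p w g2" and r: "rooted_map N'" "rooted_map M'"
  shows "isR M M1 (if p = c then w else c) x y"
proof -
  note d = isRD[OF R] and j = isID[OF J] and k = isID[OF K] and rn = rooted_mapD[OF r(1)]
    and r' = rooted_mapD[OF r(2)]
  have xN: "x \<in> mH N" "y \<in> mH N" using d(5) by auto
  have uN: "h \<in> mH N" if "h \<in> mH N'" for h using d(5) that by simp
  have cs: "h \<in> mH N' \<or> h = w \<or> (\<exists>l\<in>mH M'. h = g2 l)" if "h \<in> mH M1" for h using k(6) that by auto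
  have wr: "w \<noteq> mroot N'" "w \<noteq> x" "w \<noteq> y" "w \<noteq> c" using rn(2) d(4) uN xN j(2) by metis+
  have gr: "g2 l \<noteq> mroot N'" "g2 l \<noteq> x" "g2 l \<noteq> y" "g2 l \<noteq> c" "g2 l \<noteq> w" if "l \<in> mH M'" for l
    using rn(2) d(4) uN xN j(5)[OF that] j(4)[OF that] by metis+
  have px: "p \<noteq> x" "p \<noteq> y" "mroot N' \<noteq> x" "mroot N' \<noteq> y" "c \<noteq> x" using k(1) d(1,2,4) rn(2) by auto
  show ?thesis unfolding isR_def k(7)
  proof (intro conjI ballI impI)
    show "x \<notin> mH M1" "y \<notin> mH M1" using cs d(1,2) wr gr by metis+
    show "x \<noteq> y" using d(3) .
    show "(if p = c then w else c) \<in> mH M1" using k(6) d(4) by simp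
    show "mH M = mH M1 \<union> {x, y}" using j(6) k(6) d(5) by auto
    show "mroot M = mroot N'" using j(7) d(6) by simp
    show "malp M x = y" "malp M y = x" using j(12) xN d(7,8) by auto
    show "malp M h = malp M1 h" if "h \<in> mH M1" for h
      using cs[OF that]
    proof (elim disjE bexE)
      assume "h \<in> mH N'" then show ?thesis using j(12)[OF uN] d(9) k(12) by simp
    next
      assume "h = w" then show ?thesis using j(8) k(8) by simp
    next
      fix l assume "l \<in> mH M'" "h = g2 l"
      then show ?thesis using j(9) k(9) j(10)[of l] k(10)[of l] by (cases "l = mroot M'") simp_all
    qed
    show "msig M (mroot N') = x" using j(13)[OF uN[OF rn(2)]] d(10) px by (cases "p = mroot N'") simp_all
    show "msig M x = (if (if p = c then w else c) = mroot N' then y else msig M1 (mroot N'))"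
    proof -
      have "msig M x = (if p = mroot N' then w else msig N x)" using j(13)[OF xN(1)] px(1) by auto
      then show ?thesis using d(11) k(13)[OF rn(2)] wr(1) by presburger
    qed
    show "msig M y = msig M1 (if p = c then w else c)"
      using j(13)[OF xN(2)] d(3,12) px k(13)[OF d(4)] k(14) by (cases "p = c") auto
    show "msig M h = (if h = (if p = c then w else c) then y else msig M1 h)" if "h \<in> mH M1" "h \<noteq> mroot N'" for h
      using cs[OF that(1)]
    proof (elim disjE bexE)
      assume h: "h \<in> mH N'"
      then have "h \<noteq> x" "h \<noteq> w" using d(1) k(2) by auto
      then have "msig M h = (if h = p then w else msig N h)" using j(13)[OF uN[OF h]] that(2) by (cases "p = mroot N'") auto
      then show ?thesis using d(13)[OF h that(2)] k(13)[OF h] \<open>h \<noteq> w\<close> by presburger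
    next
      assume h: "h = w"
      have "msig N (if p = mroot N' then x else p) = (if p = c then y else msig N' p)"
        using d(11) d(13)[OF k(1)] by (cases "p = mroot N'") auto
      then show ?thesis unfolding h j(14) k(14) using wr(4) by presburger
    next
      fix l assume l: "l \<in> mH M'" "h = g2 l"
      then show ?thesis using j(11) k(11) gr[OF l(1)] by simp
    qed
  qed
qed

text \<open>For corners labeled from that of \<open>c\<close> on; if \<open>p = c\<close>, this is
  the part of the corner behind \<open>y\<close>. The condition on the root will hold because the
  root has the least label.\<close>

lemma isR_isI_after:
  assumes R: "isR N N' c x y" and J: "isI M M' N (if p = c then y else p) w g2"
    and K: "isI M1 M' N' p w g2" and r: "rooted_map N'" "rooted_map M'" and pc: "p = mroot N' \<longrightarrow> c = mroot N'"
  shows "isR M M1 c x y"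
proof -
  note d = isRD[OF R] and j = isID[OF J] and k = isID[OF K] and rn = rooted_mapD[OF r(1)]
    and r' = rooted_mapD[OF r(2)]
  have xN: "x \<in> mH N" "y \<in> mH N" using d(5) by auto
  have uN: "h \<in> mH N" if "h \<in> mH N'" for h using d(5) that by simp
  have cs: "h \<in> mH N' \<or> h = w \<or> (\<exists>l\<in>mH M'. h = g2 l)" if "h \<in> mH M1" for h using k(6) that by auto
  have wr: "w \<noteq> mroot N'" "w \<noteq> x" "w \<noteq> y" "w \<noteq> c" using rn(2) d(4) uN xN j(2) by metis+
  have gr: "g2 l \<noteq> mroot N'" "g2 l \<noteq> x" "g2 l \<noteq> y" "g2 l \<noteq> c" "g2 l \<noteq> w" if "l \<in> mH M'" for l
    using rn(2) d(4) uN xN j(5)[OF that] j(4)[OF that] by metis+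
  have px: "p \<noteq> x" "p \<noteq> y" "mroot N' \<noteq> x" "mroot N' \<noteq> y" "c \<noteq> x" "c \<noteq> y" using k(1) d(1,2,4) rn(2) by auto
  show ?thesis unfolding isR_def k(7)
  proof (intro conjI ballI impI)
    show "x \<notin> mH M1" "y \<notin> mH M1" using cs d(1,2) wr gr by metis+
    show "x \<noteq> y" using d(3) .
    show "c \<in> mH M1" using k(6) d(4) by simp
    show "mH M = mH M1 \<union> {x, y}" using j(6) k(6) d(5) by auto
    show "mroot M = mroot N'" using j(7) d(6) by simp
    show "malp M x = y" "malp M y = x" using j(12) xN d(7,8) by auto
    show "malp M h = malp M1 h" if "h \<in> mH M1" for h
      using cs[OF that]
    proof (elim disjE bexE)
      assume "h \<in> mH N'" then show ?thesis using j(12)[OF uN] d(9) k(12) by simp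
    next
      assume "h = w" then show ?thesis using j(8) k(8) by simp
    next
      fix l assume "l \<in> mH M'" "h = g2 l"
      then show ?thesis using j(9) k(9) j(10)[of l] k(10)[of l] by (cases "l = mroot M'") simp_all
    qed
    show "msig M (mroot N') = x" using j(13)[OF uN[OF rn(2)]] d(10) px pc by (cases "p = c") auto
    show "msig M x = (if c = mroot N' then y else msig M1 (mroot N'))"
    proof -
      have "msig M x = msig N x" using j(13)[OF xN(1)] d(3) px(1) by auto
      then show ?thesis using d(11) k(13)[OF rn(2)] pc by presburger
    qed
    show "msig M y = msig M1 c"
      using j(13)[OF xN(2)] d(12) px k(13)[OF d(4)] by (cases "p = c") auto
    show "msig M h = (if h = c then y else msig M1 h)" if "h \<in> mH M1" "h \<noteq> mroot N'" for h
      using cs[OF that(1)]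
    proof (elim disjE bexE)
      assume h: "h \<in> mH N'"
      then have "h \<noteq> y" using d(2) by auto
      then show ?thesis using j(13)[OF uN[OF h]] d(13)[OF h that(2)] k(13)[OF h] by presburger
    next
      assume h: "h = w"
      have "msig N (if p = c then y else p) = msig N' p"
        using d(12) d(13)[OF k(1)] pc by (cases "p = c") auto
      then show ?thesis unfolding h j(14) k(14) using wr(4) by presburger
    next
      fix l assume l: "l \<in> mH M'" "h = g2 l"
      then show ?thesis using j(11) k(11) gr[OF l(1)] by simp
    qed
  qed
qed

section \<open>Isomorphism classes\<close>

lemma rooted_mR: "rooted_map N \<Longrightarrow> rooted_map (mR k N)"
  using isR_mR[of N k] isR_rooted by metis

lemma rooted_mIns: "rooted_map N \<Longrightarrow> rooted_map M' \<Longrightarrow> rooted_map (mIns M' k N)"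
  using isI_mIns[of N M' k] isI_rooted by metis

lemma card_mR: "rooted_map N \<Longrightarrow> card (mH (mR k N)) = card (mH N) + 2"
  using isR_mR[of N k] isR_card by metis

lemma card_mIns: "rooted_map N \<Longrightarrow> rooted_map M' \<Longrightarrow> card (mH (mIns M' k N)) = card (mH N) + 1 + card (mH M')"
  using isI_mIns[of N M' k] isI_card by metis

lemma isR_miso_mR:
  assumes "isR M N c x y" "rooted_map N" "iso_by f N N'" "f c = corner N' k"
  shows "miso M (mR k N')"
proof -
  obtain x' y' where "isR (mR k N') N' (corner N' k) x' y'" using isR_mR[OF rooted_map_iso[OF assms(3,2)]] .
  then show ?thesis using isR_iso_ext[OF assms(3,1)] assms(2,4) by blast
qed

lemma isI_miso_mIns:
  assumes "isI M M' N c z g" "rooted_map N" "rooted_map M'" "iso_by f N N'" "miso M' M''" "f c = corner N' k"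
  shows "miso M (mIns M'' k N')"
proof -
  obtain f' where f': "iso_by f' M' M''" using assms(5) miso_iff by blast
  obtain z' g' where "isI (mIns M'' k N') M'' N' (corner N' k) z' g'"
    using isI_mIns[OF rooted_map_iso[OF assms(4,2)] rooted_map_iso[OF f' assms(3)]] .
  then show ?thesis using isI_iso_ext[OF assms(4) f' assms(1)] assms(2,3,6) by blast
qed

lemma iso_by_id: "iso_by id M M"
  by (simp add: iso_by_def)

lemma mR_cong:
  assumes "miso N N'" "rooted_map N"
  shows "miso (mR k N) (mR k N')"
proof -
  obtain f where f: "iso_by f N N'" using assms(1) miso_iff by blast
  obtain x y where "isR (mR k N) N (corner N k) x y" using isR_mR[OF assms(2)] .
  then show ?thesis using isR_miso_mR[OF _ assms(2) f] corner_iso[OF f assms(2)] by simp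
qed

lemma mIns_cong:
  assumes "miso N N'" "miso M M'" "rooted_map N" "rooted_map M"
  shows "miso (mIns M k N) (mIns M' k N')"
proof -
  obtain f where f: "iso_by f N N'" using assms(1) miso_iff by blast
  obtain z g where "isI (mIns M k N) M N (corner N k) z g" using isI_mIns[OF assms(3,4)] .
  then show ?thesis using isI_miso_mIns[OF _ assms(3,4) f assms(2)] corner_iso[OF f assms(3)] by simp
qed

lemma corner_1 [simp]: "corner N 1 = mroot N"
  by (simp add: corner_crn)

lemma mIns_root:
  assumes "rooted_map N" "rooted_map M"
  obtains z g where "isI (mIns M 1 N) M N (mroot N) z g"
  using isI_mIns[OF assms, of 1] unfolding corner_1 by blast

lemma corner_surj:
  assumes "rooted_map N" "c \<in> mH N"
  obtains k where "1 \<le> k" "k \<le> card (mH N)" "corner N k = c"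
proof -
  obtain i where "i < card (mH N)" "c = crn N i" using bfl_good_surj[OF bfl_good_rooted assms] assms by blast
  then show ?thesis using that[of "i + 1"] by (simp add: corner_crn)
qed

lemma corner_inj:
  assumes "rooted_map N" "1 \<le> k" "k \<le> card (mH N)" "1 \<le> l" "l \<le> card (mH N)" "corner N k = corner N l"
  shows "k = l"
  using bfl_good_inj(1)[OF bfl_good_rooted[OF assms(1)], of "k - 1" "l - 1"] assms(2-) by (simp add: corner_crn)

text \<open>The restricted isomorphism matches the two corners; as labels are transported by
  isomorphisms and name corners injectively, they agree.\<close>

lemma miso_mR_unique:
  assumes "miso (mR k N) (mR k' N')" "rooted_map N" "rooted_map N'"
    "1 \<le> k" "k \<le> card (mH N)" "1 \<le> k'" "k' \<le> card (mH N')"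
  shows "k = k' \<and> miso N N'"
proof -
  obtain f where f: "iso_by f (mR k N) (mR k' N')" using assms(1) miso_iff by blast
  obtain x y where R: "isR (mR k N) N (corner N k) x y" using isR_mR[OF assms(2)] .
  obtain x' y' where R': "isR (mR k' N') N' (corner N' k') x' y'" using isR_mR[OF assms(3)] .
  note fN = isR_iso_restrict[OF f R R' assms(2,3)]
  have m: "miso N N'" using fN(1) miso_iff by blast
  then have "card (mH N) = card (mH N')" by (rule miso_card)
  then show ?thesis using fN(2) corner_iso[OF fN(1) assms(2), of k] corner_inj[OF assms(3), of k k'] assms m by simp
qed

lemma miso_mIns_unique:
  assumes "miso (mIns Md 1 Mu) (mIns Md' 1 Mu')" "rooted_map Md" "rooted_map Mu" "rooted_map Md'" "rooted_map Mu'"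
  shows "miso Md Md' \<and> miso Mu Mu'"
proof -
  obtain f where f: "iso_by f (mIns Md 1 Mu) (mIns Md' 1 Mu')" using assms(1) miso_iff by blast
  obtain z g where I: "isI (mIns Md 1 Mu) Md Mu (mroot Mu) z g" using mIns_root[OF assms(3,2)] .
  obtain z' g' where I': "isI (mIns Md' 1 Mu') Md' Mu' (mroot Mu') z' g'" using mIns_root[OF assms(5,4)] .
  show ?thesis using isI_iso_restrict[OF f I I' assms(3,2,5,4)] by simp
qed

text \<open>The edge after the root is a bridge in one map and not in the other.\<close>

lemma not_miso_mIns_mR:
  assumes "rooted_map Md" "rooted_map Mu" "rooted_map N"
  shows "\<not> miso (mIns Md 1 Mu) (mR k N)"
proof
  assume "miso (mIns Md 1 Mu) (mR k N)"
  then obtain f where f: "iso_by f (mIns Md 1 Mu) (mR k N)" using miso_iff by blast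
  let ?M = "mIns Md 1 Mu"
  obtain z g where I: "isI ?M Md Mu (mroot Mu) z g" using mIns_root[OF assms(2,1)] .
  obtain x y where R: "isR (mR k N) N (corner N k) x y" using isR_mR[OF assms(3)] .
  note r = rooted_mapD[OF isI_rooted[OF I assms(2,1)]] and r2 = rooted_mapD[OF isR_rooted[OF R assms(3)]]
  have z: "msig ?M (mroot ?M) = z" using isID(7)[OF I] isID(13)[OF I, of "mroot Mu"] rooted_mapD(2)[OF assms(2)] by simp
  then have zM: "z \<in> mH ?M" using r(2,7) by metis
  have "f z = x" using iso_byD(2)[OF f r(2)] iso_byD(4)[OF f] z isRD(6,10)[OF R] by simp
  then show False
    using is_bridge_iso[OF f isI_rooted[OF I assms(2,1)] zM r(4) r2(4)] iso_byD(3)[OF f]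
      isI_bridge[OF I assms(2,1)] isR_root_not_bridge[OF R assms(3)] by simp
qed

lemma card_pos: "rooted_map M \<Longrightarrow> 0 < card (mH M)"
  using rooted_card_msize by fastforce

lemma card_one_map: "card (mH one_map) = 1" by (simp add: one_map_def)

section \<open>The bijection\<close>

lemma phi_rel_props:
  "phi_rel M D \<Longrightarrow> rooted_map M \<and> indecomposable D \<and> length D = card (mH M) + 1"
proof (induction rule: phi_rel.induct)
  case (phi_one M)
  then show ?case using indecomposable_one_chord miso_card[of M one_map] card_one_map by (simp add: one_chord_def)
next
  case (phi_bridge Md Dd Mu Du M)
  then show ?case using indecomposable_dIns miso_card[of M "mIns Md 1 Mu"] card_mIns[of Mu Md 1] by simp
next
  case (phi_R M' D' k M)
  then have "k < length D'" using rooted_card_msize[of M'] by simp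
  then show ?case using phi_R indecomposable_dR miso_card[of M "mR k M'"] card_mR[of M' k] by simp
qed

lemma phi_rel_RI:
  assumes "phi_rel N D" "1 \<le> k" "k \<le> card (mH N)" "rooted_map M" "miso M (mR k N)"
  shows "phi_rel M (dR k D)"
  using phi_R[OF assms(1,2)] assms(3-5) rooted_card_msize(1)[of N] phi_rel_props[OF assms(1)] by simp

lemma phi_rel_iso:
  assumes "phi_rel M D" "rooted_map M'" "miso M M'"
  shows "phi_rel M' D"
proof -
  have t: "miso M' X" if "miso M X" for X
    using miso_trans[OF miso_sym[OF assms(3)] that] phi_rel_props[OF assms(1)] by simp
  show ?thesis
    using assms(1)
  proof cases
    case phi_one
    then show ?thesis using phi_rel.phi_one[OF assms(2)] t by simp
  next
    case (phi_bridge Md Dd Mu Du)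
    then show ?thesis using phi_rel.phi_bridge[OF phi_bridge(2,3) assms(2)] t by simp
  next
    case (phi_R N D' k)
    then show ?thesis using phi_rel.phi_R[OF phi_R(2-4) assms(2)] t by simp
  qed
qed

lemma phi_rel_exists: "rooted_map M \<Longrightarrow> \<exists>D. phi_rel M D"
proof (induction "card (mH M)" arbitrary: M rule: less_induct)
  case less
  from \<open>rooted_map M\<close> show ?case
  proof (cases rule: rooted_map_cases)
    case one
    have "iso_by (\<lambda>_. 0) M one_map" unfolding iso_by_def
      using one rooted_mapD(5)[OF less(2)] by (simp add: one_map_def bij_betw_def)
    then show ?thesis using phi_one[OF less(2)] miso_iff by blast
  next
    case (bridge Md Mu z)
    have "card (mH Md) < card (mH M)" "card (mH Mu) < card (mH M)" using isI_card[OF bridge(1,3,2)] by simp_all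
    then obtain Dd Du where "phi_rel Md Dd" "phi_rel Mu Du" using less(1) bridge by blast
    moreover have "miso M (mIns Md 1 Mu)"
      using isI_miso_mIns[OF bridge(1,3,2) iso_by_id miso_refl, where k=1] by (simp add: corner_crn)
    ultimately show ?thesis using phi_bridge less(2) by blast
  next
    case (R N c x y)
    then obtain D where D: "phi_rel N D" using less(1)[of N] isR_card[OF R] by auto
    obtain k where k: "1 \<le> k" "k \<le> card (mH N)" "corner N k = c" using corner_surj[OF R(2) isRD(4)[OF R(1)]] .
    have "miso M (mR k N)" using isR_miso_mR[OF R iso_by_id] k by simp
    then show ?thesis using phi_rel_RI[OF D k(1,2) less(2)] by blast
  qed
qed

text \<open>Both uniqueness proofs work because the isomorphism type of a map, and likewise an indecomposable
  diagram, determines which rule of \<open>phi_rel\<close> applies.\<close>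

lemma phi_rel_unique:
  "phi_rel M1 D1 \<Longrightarrow> phi_rel M2 D2 \<Longrightarrow> miso M1 M2 \<Longrightarrow> D1 = D2"
proof (induction arbitrary: M2 D2 rule: phi_rel.induct)
  case (phi_one M1)
  have c1: "card (mH M1) = 1" using miso_card[OF phi_one(2)] card_one_map by simp
  from phi_one.prems(1) show ?case
  proof cases
    case (phi_bridge Md Dd Mu Du)
    then show ?thesis using c1 miso_card[OF phi_one.prems(2)] miso_card[OF phi_bridge(5)] phi_rel_props card_mIns[of Mu Md 1] card_pos[of Mu]
      by simp
  next
    case (phi_R N D k)
    then show ?thesis using c1 miso_card[OF phi_one.prems(2)] miso_card[OF phi_R(6)] phi_rel_props[of N D] card_mR[of N k] by simp
  qed simp
next
  case (phi_bridge Md Dd Mu Du M1)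
  note p = phi_rel_props[OF phi_bridge.hyps(1)] phi_rel_props[OF phi_bridge.hyps(2)]
  have m: "miso (mIns Md 1 Mu) X" if "miso M2 X" for X
    using miso_trans[OF miso_sym[OF phi_bridge.hyps(4)] miso_trans[OF phi_bridge.prems(2) that]] phi_bridge.hyps(3) by simp
  from phi_bridge.prems(1) show ?case
  proof cases
    case phi_one
    then show ?thesis using miso_card[OF m[OF phi_one(3)]] card_mIns[of Mu Md 1] p card_pos[of Mu] card_one_map by simp
  next
    case b: (phi_bridge Md' Dd' Mu' Du')
    then show ?thesis using miso_mIns_unique[OF m[OF b(5)]] p phi_rel_props phi_bridge.IH by metis
  next
    case (phi_R N D k)
    then show ?thesis using not_miso_mIns_mR[of Md Mu N k] m[OF phi_R(6)] p phi_rel_props by blast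
  qed
next
  case (phi_R N D k M1)
  note p = phi_rel_props[OF phi_R.hyps(1)]
  have m: "miso (mR k N) X" if "miso M2 X" for X
    using miso_trans[OF miso_sym[OF phi_R.hyps(5)] miso_trans[OF phi_R.prems(2) that]] phi_R.hyps(4) by simp
  from phi_R.prems(1) show ?case
  proof cases
    case phi_one
    then show ?thesis using miso_card[OF m[OF phi_one(3)]] card_mR[of N k] p card_one_map by simp
  next
    case b: (phi_bridge Md' Dd' Mu' Du')
    then show ?thesis using not_miso_mIns_mR[of Md' Mu' N k] miso_sym[OF m[OF b(5)]] p rooted_mR phi_rel_props by blast
  next
    case b: (phi_R N' D' k')
    then have "k = k' \<and> miso N N'"
      using miso_mR_unique[OF m[OF b(6)]] p phi_rel_props[of N' D'] phi_R.hyps(2,3) rooted_card_msize(1)[of N] rooted_card_msize(1)[of N'] by simp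
    then show ?thesis using b phi_R.IH by simp
  qed
qed

lemma phi_rel_inj:
  "phi_rel M1 D \<Longrightarrow> phi_rel M2 D \<Longrightarrow> miso M1 M2"
proof (induction arbitrary: M2 rule: phi_rel.induct)
  case (phi_one M1)
  have c: "card (mH M2) = 1" using phi_rel_props[OF phi_one.prems] by (simp add: one_chord_def)
  from phi_one.prems have "miso M2 one_map"
  proof cases
    case (phi_bridge Md Dd Mu Du)
    then show ?thesis using c miso_card[OF phi_bridge(5)] phi_rel_props card_mIns[of Mu Md 1] card_pos[of Mu] by simp
  next
    case (phi_R N D k)
    then show ?thesis using c miso_card[OF phi_R(6)] phi_rel_props[of N D] card_mR[of N k] by simp
  qed simp
  then show ?case using phi_one miso_trans miso_sym phi_rel_props by metis
next
  case (phi_bridge Md Dd Mu Du M1)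
  note p = phi_rel_props[OF phi_bridge.hyps(1)] phi_rel_props[OF phi_bridge.hyps(2)]
  have l: "length Dd \<ge> 2" "length Du \<ge> 2" using p length_indecomposable by blast+
  have r2: "rooted_map M2" using phi_rel_props phi_bridge.prems by blast
  from phi_bridge.prems show ?case
  proof cases
    case phi_one
    then have "length (dIns Dd 1 Du) = 2" by (simp add: one_chord_def)
    then show ?thesis using l by simp
  next
    case b: (phi_bridge Md' Dd' Mu' Du')
    then have "Dd = Dd' \<and> Du = Du'" using dIns_eq_iff p phi_rel_props by blast
    then have "miso Md Md'" "miso Mu Mu'" using b phi_bridge.IH by auto
    then have "miso (mIns Md 1 Mu) (mIns Md' 1 Mu')" using mIns_cong p by blast
    then show ?thesis using miso_trans[OF phi_bridge.hyps(4) miso_trans[OF _ miso_sym[OF b(5) r2]]] by blast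
  next
    case b: (phi_R N D k)
    then have "k < length D" "indecomposable D" using phi_rel_props[of N D] rooted_card_msize[of N] by auto
    then show ?thesis using b dR_neq_dIns[of D k Dd Du] p by simp
  qed
next
  case (phi_R N D k M1)
  note p = phi_rel_props[OF phi_R.hyps(1)]
  have k: "k < length D" using phi_R.hyps(2,3) p rooted_card_msize(1)[of N] by simp
  have l: "length D \<ge> 2" using p length_indecomposable by blast
  have r2: "rooted_map M2" using phi_rel_props phi_R.prems by blast
  from phi_R.prems show ?case
  proof cases
    case phi_one
    then have "length (dR k D) = 2" by (simp add: one_chord_def)
    then show ?thesis using l by simp
  next
    case b: (phi_bridge Md' Dd' Mu' Du')
    then show ?thesis using dR_neq_dIns[of D k Dd' Du'] p k phi_R.hyps(2) phi_rel_props by metis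
  next
    case b: (phi_R N' D' k')
    then have "k = k' \<and> D = D'" using dR_eq_iff by blast
    then have "miso N N'" "k = k'" using b phi_R.IH by auto
    then have "miso (mR k N) (mR k' N')" using mR_cong p by blast
    then show ?thesis using miso_trans[OF phi_R.hyps(5) miso_trans[OF _ miso_sym[OF b(6) r2]]] by blast
  qed
qed

lemma phi_rel_surj: "indecomposable D \<Longrightarrow> \<exists>M. phi_rel M D"
proof (induction "length D" arbitrary: D rule: less_induct)
  case less
  from indecomposable_cases[OF less(2)] show ?case
  proof cases
    case 1
    have "rooted_map one_map" by (rule rooted_mapI) (auto simp: one_map_def)
    then show ?thesis using 1 phi_one miso_refl by blast
  next
    case (2 Dd Du)
    have "length Dd < length D" "length Du < length D" using 2 length_indecomposable[of Dd] length_indecomposable[of Du] by auto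
    then obtain Md Mu where M: "phi_rel Md Dd" "phi_rel Mu Du" using less(1) 2 by blast
    then have "phi_rel (mIns Md 1 Mu) D" unfolding 2
      using phi_bridge[OF M] rooted_mIns phi_rel_props miso_refl by blast
    then show ?thesis by blast
  next
    case (3 k C)
    then obtain N where N: "phi_rel N C" using less(1)[of C] by auto
    then have "phi_rel (mR k N) D" unfolding 3
      using phi_rel_RI[OF N 3(2)] rooted_mR phi_rel_props[OF N] miso_refl 3(3) by auto
    then show ?thesis by blast
  qed
qed

text \<open>At the root corner the insertion is the rule \<open>phi_bridge\<close>. At any other
  corner it can be moved into one of the parts from which \<open>N\<close> was built, and the rule
  that built \<open>N\<close> is applied afterwards.\<close>

lemma phi_rel_mIns:
  assumes "phi_rel N D" "phi_rel M' D'" "1 \<le> k" "k \<le> card (mH N)"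
  shows "phi_rel (mIns M' k N) (dIns D' k D)"
  using assms
proof (induction arbitrary: M' D' k rule: phi_rel.induct)
  case (phi_one N)
  then have "k = 1" using miso_card[OF phi_one(2)] card_one_map by simp
  then show ?case
    using phi_bridge[OF phi_one(3) phi_rel.phi_one[OF phi_one(1,2)]] rooted_mIns phi_one(1) phi_rel_props[OF phi_one(3)] miso_refl
    by blast
next
  case (phi_bridge Nd Dd Nu Du N)
  note pd = phi_rel_props[OF phi_bridge.hyps(1)] and pu = phi_rel_props[OF phi_bridge.hyps(2)]
    and p' = phi_rel_props[OF phi_bridge.prems(1)]
  have rN: "rooted_map N" "rooted_map M'" "rooted_map Nd" "rooted_map Nu" using phi_bridge p' pd pu by auto
  \<comment> \<open>\<open>N\<close> is known only up to isomorphism. The representative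
    \<open>N0\<close> has explicit parts, and \<open>MM\<close> transfers the result back.\<close>
  define N0 where "N0 = mIns Nd 1 Nu"
  have rN0: "rooted_map N0" using rooted_mIns rN by (simp add: N0_def)
  have NN0: "miso N N0" using phi_bridge.hyps(4) by (simp add: N0_def)
  define M where "M = mIns M' k N0"
  have rM: "rooted_map M" using rooted_mIns rN0 rN by (simp add: M_def)
  have MM: "miso M (mIns M' k N)"
    using miso_sym[OF mIns_cong[OF NN0 miso_refl rN(1,2), of k]] rooted_mIns rN(1,2) by (simp add: M_def)
  have phiN: "phi_rel N (dIns Dd 1 Du)" using phi_rel.phi_bridge phi_bridge.hyps by blast
  obtain z g where I: "isI N0 Nd Nu (mroot Nu) z g" using mIns_root[OF rN(4,3)] unfolding N0_def by blast
  obtain w g2 where J: "isI M M' N0 (corner N0 k) w g2" using isI_mIns[OF rN0 rN(2)] unfolding M_def by blast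
  have I0: "isI N0 Nd Nu (crn Nu 0) z g" using I by simp
  note lab = isI_labels[OF I0 rN(4,3) bfl_good_rooted[OF rN(4)] bfl_good_rooted[OF rN(3)] card_pos[OF rN(4)]]
  have cN: "card (mH N) = card (mH Nu) + 1 + card (mH Nd)" using miso_card[OF NN0] isI_card[OF I rN(4,3)] by simp
  have lD: "length Dd = card (mH Nd) + 1" "length Du = card (mH Nu) + 1" using pd pu by auto
  \<comment> \<open>Labels 2 to \<open>card (mH Nd) + 1\<close> belong to the copy of
    \<open>Nd\<close>. Larger ones belong to \<open>z\<close>, which continues the root corner of
    \<open>Nu\<close>, and to the rest of \<open>Nu\<close>.\<close>
  consider "k = 1" | "2 \<le> k" "k \<le> card (mH Nd) + 1" | "card (mH Nd) + 2 \<le> k" using phi_bridge.prems(2) by linarith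
  then show ?case
  proof cases
    case 1
    then show ?thesis
      using phi_rel.phi_bridge[OF phi_bridge.prems(1) phiN] rooted_mIns rN(1,2) miso_refl by blast
  next
    case 2
    define q where "q = crn Nd (k - 2)"
    have "k - 1 = 0 + 1 + (k - 2)" "k - 2 < card (mH Nd)" using 2 by auto
    then have "corner N0 k = g q" using lab(2)[of "k - 2"] by (simp only: corner_crn q_def)
    then have J': "isI M M' N0 (g q) w g2" using J by simp
    obtain w' g' where "isI (mIns M' (k - 1) Nd) M' Nd (corner Nd (k - 1)) w' g'" using isI_mIns[OF rN(3,2)] .
    then have K: "isI (mIns M' (k - 1) Nd) M' Nd q w' g'" using 2 by (simp add: corner_crn q_def numeral_2_eq_2)
    obtain G where G: "isI M (mIns M' (k - 1) Nd) Nu (mroot Nu) z G" using isI_isI_inner[OF I J' K rN(3,4,2)] .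
    have "phi_rel (mIns M' (k - 1) Nd) (dIns D' (k - 1) Dd)"
      using phi_bridge.IH(1)[OF phi_bridge.prems(1), of "k - 1"] 2 by auto
    moreover have "miso M (mIns (mIns M' (k - 1) Nd) 1 Nu)"
      using isI_miso_mIns[OF G rN(4) rooted_mIns[OF rN(3,2)] iso_by_id miso_refl, where k=1] by (simp add: corner_crn)
    ultimately have "phi_rel M (dIns (dIns D' (k - 1) Dd) 1 Du)"
      using phi_rel.phi_bridge phi_bridge.hyps(2) rM by blast
    moreover have "dIns D' k (dIns Dd 1 Du) = dIns (dIns D' (k - 1) Dd) 1 Du"
      using dIns_dIns_inner[of "k - 1" Dd Du D'] 2 lD by simp
    ultimately show ?thesis using phi_rel_iso[OF _ _ MM] rooted_mIns rN by simp
  next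
    case 3
    \<comment> \<open>\<open>i\<close> counts the corners of \<open>Nu\<close> from 0: of the
      \<open>k - 1\<close> steps, \<open>card (mH Nd) + 1\<close> were spent on the detour.\<close>
    define i where "i = k - 2 - card (mH Nd)"
    have k: "k = i + 2 + card (mH Nd)" "i < card (mH Nu)" using 3 phi_bridge.prems(3) cN by (auto simp: i_def)
    define p where "p = crn Nu i"
    have p: "p \<in> mH Nu" "p = mroot Nu \<longleftrightarrow> i = 0"
      using crn_in[OF rN(4)] bfl_good_inj(2)[OF bfl_good_rooted[OF rN(4)] k(2) k(2)] by (auto simp: p_def)
    have "corner N0 k = (if p = mroot Nu then z else p)"
      using lab(3) lab(4)[of i] k p(2) by (cases "i = 0") (simp_all add: corner_crn p_def)
    then have J': "isI M M' N0 (if p = mroot Nu then z else p) w g2" using J by simp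
    note j = isID[OF J']
    have sub: "mH Nu \<subseteq> mH N0" using isID(6)[OF I] by auto
    have dis: "w \<notin> mH Nu" "mH Nu \<inter> g2 ` mH M' = {}" "w \<notin> g2 ` mH M'" using j(2,4,5) sub by auto
    \<comment> \<open>\<open>M'\<close> is attached to \<open>Nu\<close> under the very names used
      in \<open>M\<close>, so that \<open>M\<close> itself, not just a copy, is an Ins over
      \<open>M1\<close>.\<close>
    obtain M1 where K: "isI M1 M' Nu p w g2"
      using ex_isI[OF p(1) dis(1) j(3) dis(3,2) rooted_mapD(2)[OF rN(2)]] .
    note rM1 = isI_rooted[OF K rN(4,2)]
    have "isI M Nd M1 (mroot M1) z g" using isI_isI_outer[OF I J' K rN(3,4,2)] .
    then have iso: "miso M (mIns Nd 1 M1)"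
      using isI_miso_mIns[OF _ rM1 rN(3) iso_by_id miso_refl, where k=1] by (simp add: corner_crn)
    have "miso M1 (mIns M' (i + 1) Nu)"
      using isI_miso_mIns[OF K rN(4,2) iso_by_id miso_refl, where k="i + 1"] by (simp add: corner_crn p_def)
    moreover have "phi_rel (mIns M' (i + 1) Nu) (dIns D' (i + 1) Du)"
      using phi_bridge.IH(2)[OF phi_bridge.prems(1), of "i + 1"] k by simp
    ultimately have "phi_rel M1 (dIns D' (i + 1) Du)"
      using phi_rel_iso rM1 miso_sym by blast
    then have "phi_rel M (dIns Dd 1 (dIns D' (i + 1) Du))"
      using phi_rel.phi_bridge phi_bridge.hyps(1) rM iso by blast
    moreover have "dIns D' k (dIns Dd 1 Du) = dIns Dd 1 (dIns D' (i + 1) Du)"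
      using dIns_dIns_outer[of "i + 1" Du Dd D'] k lD pd indecomposableD(1)[of Dd] by simp
    ultimately show ?thesis using phi_rel_iso[OF _ _ MM] rooted_mIns rN by simp
  qed
next
  case (phi_R N' D j N)
  note pn = phi_rel_props[OF phi_R.hyps(1)] and p' = phi_rel_props[OF phi_R.prems(1)]
  have rN: "rooted_map N" "rooted_map M'" "rooted_map N'" using phi_R p' pn by auto
  have j: "1 \<le> j" "j \<le> card (mH N')" using phi_R.hyps rooted_card_msize(1)[OF rN(3)] by auto
  define N0 where "N0 = mR j N'"
  have rN0: "rooted_map N0" using rooted_mR rN by (simp add: N0_def)
  have NN0: "miso N N0" using phi_R.hyps(5) by (simp add: N0_def)
  define M where "M = mIns M' k N0"
  have rM: "rooted_map M" using rooted_mIns rN0 rN by (simp add: M_def)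
  have MM: "miso M (mIns M' k N)"
    using miso_sym[OF mIns_cong[OF NN0 miso_refl rN(1,2), of k]] rooted_mIns rN(1,2) by (simp add: M_def)
  have phiN: "phi_rel N (dR j D)" using phi_rel.phi_R phi_R.hyps by blast
  define c where "c = crn N' (j - 1)"
  obtain x y where R: "isR N0 N' (crn N' (j - 1)) x y" using isR_mR[OF rN(3), of j] unfolding N0_def corner_crn by blast
  obtain w g2 where J: "isI M M' N0 (corner N0 k) w g2" using isI_mIns[OF rN0 rN(2)] unfolding M_def by blast
  have j0: "j - 1 < card (mH N')" using j by simp
  note lab = isR_labels[OF R rN(3) bfl_good_rooted[OF rN(3)] j0]
  have cN: "card (mH N) = card (mH N') + 2" using miso_card[OF NN0] isR_card[OF R rN(3)] by simp
  have lD: "length D = card (mH N') + 1" "length D' = card (mH M') + 1" using pn p' by auto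
  have sub: "mH N' \<subseteq> mH N0" using isRD(5)[OF R] by auto
  note inj = bfl_good_inj[OF bfl_good_rooted[OF rN(3)]]
  consider "k = 1" | "2 \<le> k" "k \<le> j + 1" | "j + 2 \<le> k" using phi_R.prems(2) by linarith
  then show ?case
  proof cases
    case 1
    then show ?thesis
      using phi_rel.phi_bridge[OF phi_R.prems(1) phiN] rooted_mIns rN(1,2) miso_refl by blast
  next
    case 2
    \<comment> \<open>In this range the walk on \<open>N0\<close> is one step late:
      \<open>k - 1 = i + 1\<close>.\<close>
    define i where "i = k - 2"
    have i: "k = i + 2" "i \<le> j - 1" "i < card (mH N')" using 2 j by (auto simp: i_def)
    define p where "p = crn N' i"
    have p: "p \<in> mH N'" "p = mroot N' \<longleftrightarrow> i = 0" "p = c \<longleftrightarrow> i = j - 1"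
      using crn_in[OF rN(3)] inj(2)[OF i(3) i(3)] inj(1)[OF i(3) j0] by (auto simp: p_def c_def)
    have "corner N0 k = (if p = mroot N' then x else p)"
      using lab(1)[OF i(2)] i p(2) by (simp add: corner_crn p_def)
    then have J': "isI M M' N0 (if p = mroot N' then x else p) w g2" using J by simp
    note jj = isID[OF J']
    have dis: "w \<notin> mH N'" "mH N' \<inter> g2 ` mH M' = {}" "w \<notin> g2 ` mH M'" using jj(2,4,5) sub by auto
    obtain M1 where K: "isI M1 M' N' p w g2"
      using ex_isI[OF p(1) dis(1) jj(3) dis(3,2) rooted_mapD(2)[OF rN(2)]] .
    note rM1 = isI_rooted[OF K rN(3,2)]
    note lab1 = isI_labels[OF K[unfolded p_def] rN(3,2) bfl_good_rooted[OF rN(3)] bfl_good_rooted[OF rN(2)] i(3)]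
    \<comment> \<open>The insertion precedes the second end of the root edge and adds
      \<open>card (mH M') + 1 = length D'\<close> half-edges, so the label of the corner holding
      that end grows by this amount.\<close>
    let ?k = "j + length D'"
    have "corner M1 ?k = (if p = c then w else c)"
    proof (cases "i = j - 1")
      case True
      then show ?thesis using lab1(3) p(3) j lD by (simp add: corner_crn)
    next
      case False
      then have "i < j - 1" using i by simp
      then show ?thesis using lab1(4)[of "j - 1"] p(3) j lD by (simp add: corner_crn c_def)
    qed
    moreover have "isR M M1 (if p = c then w else c) x y"
      using isR_isI_before[OF R[folded c_def] J' K rN(3,2)] .
    ultimately have "isR M M1 (corner M1 ?k) x y" by simp
    then have iso: "miso M (mR ?k M1)" using isR_miso_mR[OF _ rM1 iso_by_id] by simp
    have "miso M1 (mIns M' (i + 1) N')"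
      using isI_miso_mIns[OF K rN(3,2) iso_by_id miso_refl, where k="i + 1"] by (simp add: corner_crn p_def)
    moreover have "phi_rel (mIns M' (i + 1) N') (dIns D' (i + 1) D)"
      using phi_R.IH[OF phi_R.prems(1), of "i + 1"] i by simp
    ultimately have "phi_rel M1 (dIns D' (i + 1) D)"
      using phi_rel_iso rM1 miso_sym by blast
    then have "phi_rel M (dR ?k (dIns D' (i + 1) D))"
      using phi_rel_RI[OF _ _ _ rM iso] j isI_card[OF K rN(3,2)] lD by simp
    moreover have "dIns D' k (dR j D) = dR ?k (dIns D' (i + 1) D)"
      using dIns_dR_before[of "i + 1" j D D'] i j lD p' indecomposableD(1)[of D'] 2 by simp
    ultimately show ?thesis using phi_rel_iso[OF _ _ MM] rooted_mIns rN by simp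
  next
    case 3
    \<comment> \<open>Here the walk on \<open>N0\<close> is two steps late, and for
      \<open>i = j - 1\<close> it stands at \<open>y\<close>.\<close>
    define i where "i = k - 3"
    have i: "k = i + 3" "j - 1 \<le> i" "i < card (mH N')" using 3 j phi_R.prems(3) cN by (auto simp: i_def)
    define p where "p = crn N' i"
    have p: "p \<in> mH N'" "p = mroot N' \<longleftrightarrow> i = 0" "p = c \<longleftrightarrow> i = j - 1" "c = mroot N' \<longleftrightarrow> j - 1 = 0"
      using crn_in[OF rN(3)] inj(2)[OF i(3) i(3)] inj(1)[OF i(3) j0] inj(2)[OF j0 j0] by (auto simp: p_def c_def)
    have "corner N0 k = (if p = c then y else p)"
    proof (cases "i = j - 1")
      case True
      then show ?thesis using lab(2) i(1) p(3) by (simp add: corner_crn)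
    next
      case False
      then show ?thesis using lab(3)[of i] i p(3) by (simp add: corner_crn p_def)
    qed
    then have J': "isI M M' N0 (if p = c then y else p) w g2" using J by simp
    note jj = isID[OF J']
    have dis: "w \<notin> mH N'" "mH N' \<inter> g2 ` mH M' = {}" "w \<notin> g2 ` mH M'" using jj(2,4,5) sub by auto
    obtain M1 where K: "isI M1 M' N' p w g2"
      using ex_isI[OF p(1) dis(1) jj(3) dis(3,2) rooted_mapD(2)[OF rN(2)]] .
    note rM1 = isI_rooted[OF K rN(3,2)]
    note lab1 = isI_labels[OF K[unfolded p_def] rN(3,2) bfl_good_rooted[OF rN(3)] bfl_good_rooted[OF rN(2)] i(3)]
    have "corner M1 j = c" using lab1(1)[OF i(2)] by (simp add: corner_crn c_def)
    moreover have "p = mroot N' \<longrightarrow> c = mroot N'" using p(2,4) i(2) by linarith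
    then have "isR M M1 c x y" using isR_isI_after[OF R[folded c_def] J' K rN(3,2)] by simp
    ultimately have "isR M M1 (corner M1 j) x y" by simp
    then have iso: "miso M (mR j M1)" using isR_miso_mR[OF _ rM1 iso_by_id] by simp
    have "miso M1 (mIns M' (i + 1) N')"
      using isI_miso_mIns[OF K rN(3,2) iso_by_id miso_refl, where k="i + 1"] by (simp add: corner_crn p_def)
    moreover have "phi_rel (mIns M' (i + 1) N') (dIns D' (i + 1) D)"
      using phi_R.IH[OF phi_R.prems(1), of "i + 1"] i by simp
    ultimately have "phi_rel M1 (dIns D' (i + 1) D)"
      using phi_rel_iso rM1 miso_sym by blast
    then have "phi_rel M (dR j (dIns D' (i + 1) D))"
      using phi_rel_RI[OF _ j(1) _ rM iso] j isI_card[OF K rN(3,2)] by simp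
    moreover have "dIns D' k (dR j D) = dR j (dIns D' (i + 1) D)"
      using dIns_dR_after[of j "i + 1" D D'] i j lD by (simp add: numeral_3_eq_3)
    ultimately show ?thesis using phi_rel_iso[OF _ _ MM] rooted_mIns rN by simp
  qed
qed

section \<open>Bridgeless maps\<close>

text \<open>Passing to the complement replaces one end of a bridge by the other, so every bridge has
  a cut set containing the root.\<close>

lemma bridgeless_iff:
  assumes "rooted_map M"
  shows "bridgeless M \<longleftrightarrow> (\<forall>e U. \<not> (mcutset M (malp M) e U \<and> mroot M \<in> U))"
proof -
  note r = rooted_mapD[OF assms] and b = is_bridge_iff[OF rooted_mapD(4)[OF assms]]
  have "\<exists>e U. mcutset M (malp M) e U \<and> mroot M \<in> U"
    if "mcutset M (malp M) e U" for e U
  proof (cases "mroot M \<in> U")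
    case False
    then show ?thesis using cutset_compl[OF r(4,1,3) that] r(2) by blast
  qed (use that in blast)
  moreover have "e \<in> mH M" if "mcutset M (malp M) e U" for e U
    using that by (auto simp: cutset_def)
  ultimately show ?thesis unfolding bridgeless_def b by blast
qed

text \<open>Among the bridges of \<open>N\<close> choose one whose root side is as large as possible. The far side \<open>M2\<close> is then
  bridgeless, and it contains the far end of the root edge of \<open>M\<close>, since otherwise that bridge would
  survive in \<open>M\<close>. A bridge of the remaining map with its new root edge would also survive in \<open>M\<close>.\<close>

lemma bridgeless_decomp:
  assumes R: "isR M N c x y" "rooted_map N" and M: "bridgeless M" and N: "\<not> bridgeless N"
  obtains M2 Mh p e where "isI N M2 Mh p e id" "rooted_map M2" "rooted_map Mh" "bridgeless M2" "c \<in> mH M2"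
    "\<And>M1 x1 y1. isR M1 Mh p x1 y1 \<Longrightarrow> bridgeless M1"
proof -
  note d = isRD[OF R(1)] and r = rooted_mapD[OF R(2)]
  note rM = isR_rooted[OF R]
  let ?cut = "\<lambda>e U. mcutset N (malp N) e U \<and> mroot N \<in> U"
  have nocut: False if "mcutset M (malp M) e U" "mroot M \<in> U" for e U
    using that M bridgeless_iff[OF rM] by blast
  have "\<exists>U e. ?cut e U" using N bridgeless_iff[OF R(2)] by blast
  moreover have "card U < Suc (card (mH N))" if "\<exists>e. ?cut e U" for U
    using that r(1) by (auto simp: cutset_def less_Suc_eq_le intro: card_mono)
  ultimately obtain U e where U: "?cut e U" and max: "\<And>U' e'. ?cut e' U' \<Longrightarrow> card U' \<le> card U"
    using ex_has_greatest_nat[of "\<lambda>U. \<exists>e. ?cut e U" _ card "Suc (card (mH N))"] by (metis (no_types, lifting) less_imp_le)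
  from bridge_decomp[OF R(2) conjunct1[OF U] conjunct2[OF U]]
  obtain M2 Mh p where I: "isI N M2 Mh p e id" and r2: "rooted_map M2" and rh: "rooted_map Mh"
    and H2: "mH M2 = mH N - U" "mroot M2 = malp N e" and Hh: "mH Mh = U - {e}"
    and a2: "\<And>h. malp M2 h = (if h = malp N e then h else malp N h)" and s2: "msig M2 = msig N" by metis
  note i = isID[OF I]
  have UN: "\<And>u. u \<in> U \<Longrightarrow> u \<in> mH N" and eU: "e \<in> U" and aeU: "malp N e \<notin> U"
    and sU: "\<And>u. u \<in> U \<Longrightarrow> msig N u \<in> U" and aU: "\<And>u. u \<in> U \<Longrightarrow> u \<noteq> e \<Longrightarrow> malp N u \<in> U"
    using U by (auto simp: cutset_def)
  have b2: "bridgeless M2"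
    unfolding bridgeless_iff[OF r2]
  proof (intro allI notI)
    fix b W assume b: "mcutset M2 (malp M2) b W \<and> mroot M2 \<in> W"
    then have W: "\<And>u. u \<in> W \<Longrightarrow> u \<in> mH N \<and> u \<notin> U" "b \<in> W" "malp M2 b \<notin> W"
      "\<And>u. u \<in> W \<Longrightarrow> msig N u \<in> W" "\<And>u. u \<in> W \<Longrightarrow> u \<noteq> b \<Longrightarrow> malp M2 u \<in> W" "malp N e \<in> W"
      using H2 s2 by (auto simp: cutset_def)
    have be: "b \<noteq> malp N e" using W(2,3) a2[of b] by auto
    then have ab: "malp N b \<notin> W" "malp M2 b = malp N b" using W(3) a2[of b] by auto
    have "malp N b \<in> mH N - U" using rooted_mapD(8)[OF r2, of b] ab H2 W(1,2) by simp
    \<comment> \<open>A bridge of \<open>M2\<close> is also one of \<open>N\<close>, with a strictly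
      larger root side, against the choice of \<open>U\<close>.\<close>
    then have "mcutset N (malp N) b (U \<union> W)"
      unfolding cutset_def
    proof (intro conjI ballI impI)
      fix u assume u: "u \<in> U \<union> W"
      show "msig N u \<in> U \<union> W" using u sU W(4) by auto
      have "malp N (malp N e) = e" using r(9) UN eU by simp
      then show "malp N u \<in> U \<union> W" if "u \<noteq> b"
        using u aU[of u] W(5)[of u] a2[of u] W(6) eU that by (cases "u = e"; cases "u = malp N e") auto
    qed (use UN W ab in auto)
    then have "card (U \<union> W) \<le> card U" using max U by blast
    moreover have "finite (U \<union> W)" using UN W r(1) by (meson UnE finite_subset subsetI)
    moreover have "b \<notin> U" using W by auto
    ultimately show False using W(2) psubset_card_mono[of "U \<union> W" U] by auto
  qed
  have rU: "mroot N \<in> U" using U by simp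
  have cU: "c \<notin> U"
  proof
    assume c: "c \<in> U"
    \<comment> \<open>With both ends of the root edge attached on the root side, \<open>e\<close>
      remains a bridge of \<open>M\<close>.\<close>
    have "mcutset M (malp M) e (U \<union> {x, y})"
      unfolding cutset_def
    proof (intro conjI ballI impI)
      show "U \<union> {x, y} \<subseteq> mH M" using UN d(5) by auto
      have "malp N e \<in> mH N" using r(8) UN eU by simp
      then show "malp M e \<notin> U \<union> {x, y}" using d(9)[OF UN[OF eU]] aeU d(1,2) by auto
      fix u assume u: "u \<in> U \<union> {x, y}"
      have 1: "msig M u \<in> U \<union> {x, y}" if "u \<in> U"
        using that d(10) d(13)[OF UN[OF that]] sU[OF that] by (cases "u = mroot N"; cases "u = c") simp_all
      have 2: "msig M x \<in> U \<union> {x, y}" using d(11) sU[OF rU] by (cases "c = mroot N") simp_all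
      have 3: "msig M y \<in> U \<union> {x, y}" using d(12) sU[OF c] by simp
      show "msig M u \<in> U \<union> {x, y}" using u 1 2 3 by blast
      have "malp M u \<in> U" if "u \<in> U" "u \<noteq> e" using aU[OF that] d(9)[OF UN[OF that(1)]] by simp
      then show "malp M u \<in> U \<union> {x, y}" if "u \<noteq> e" using u that d(7,8) by blast
    qed (use eU in auto)
    then show False by (rule nocut) (use rU d(6) in simp)
  qed
  then have c2: "c \<in> mH M2" using H2 d(4) by simp
  have cp: "c \<noteq> mroot N" "c \<notin> mH Mh" "c \<noteq> e" using cU rU Hh eU by auto
  have "bridgeless M1" if R1: "isR M1 Mh p x1 y1" for M1 x1 y1
    unfolding bridgeless_iff[OF isR_rooted[OF R1 rh]]
  proof (intro allI notI)
    note d1 = isRD[OF R1] and h = rooted_mapD[OF rh]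
    fix b W assume bW: "mcutset M1 (malp M1) b W \<and> mroot M1 \<in> W"
    then have W: "W \<subseteq> mH M1" "b \<in> W" "malp M1 b \<notin> W" "\<And>u. u \<in> W \<Longrightarrow> msig M1 u \<in> W"
      "\<And>u. u \<in> W \<Longrightarrow> u \<noteq> b \<Longrightarrow> malp M1 u \<in> W" "mroot Mh \<in> W"
      using d1(6) by (auto simp: cutset_def)
    have x1: "x1 \<in> W" using W(4)[OF W(6)] d1(10) by simp
    \<comment> \<open>The root edge of \<open>M1\<close> is not a bridge, so both of its ends lie in
      \<open>W\<close>.\<close>
    have bx: "b \<noteq> x1"
      using isR_root_not_bridge[OF R1 rh] is_bridge_iff[OF rooted_mapD(4)[OF isR_rooted[OF R1 rh]]] bW by blast
    then have y1: "y1 \<in> W" using W(5)[OF x1] d1(7) by simp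
    have by1: "b \<noteq> y1" using W(3) x1 d1(8) by auto
    have bh: "b \<in> mH Mh" using W(1,2) d1(5) bx by1 by auto
    have sp: "msig Mh p \<in> W" using W(4)[OF y1] d1(12) by simp
    have sW: "msig Mh u \<in> W" if "u \<in> W" "u \<in> mH Mh" for u
    proof (cases "u = p")
      case False
      then show ?thesis using W(4)[OF that(1)] d1(13)[OF that(2)] W(4)[OF x1] d1(11) by (cases "u = mroot Mh") auto
    qed (use sp in simp)
    have aW: "malp Mh u \<in> W" if "u \<in> W" "u \<in> mH Mh" "u \<noteq> b" for u
      using W(5)[OF that(1,3)] d1(9)[OF that(2)] by simp
    have ab: "malp Mh b \<in> mH Mh" "malp Mh b \<notin> W" using h(8)[OF bh] W(3) d1(9)[OF bh] by auto
    have rr: "mroot N = mroot Mh" using i(7) .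
    \<comment> \<open>In \<open>M\<close> the root edge of \<open>M1\<close> is replaced by the
      route through \<open>e\<close>, \<open>M2\<close> and the edge \<open>{x, y}\<close>.
      Exchanging \<open>x1\<close> and \<open>y1\<close> for these in \<open>W\<close> gives the cut
      set \<open>?T\<close> of \<open>b\<close> in \<open>M\<close>.\<close>
    let ?S = "(W \<inter> mH Mh) \<union> {e} \<union> mH M2" and ?T = "(W \<inter> mH Mh) \<union> {e} \<union> mH M2 \<union> {x, y}"
    have SN: "u \<in> mH N" if "u \<in> ?S" for u using that i(6) by auto
    have SNs: "msig N u \<in> ?S" if "u \<in> ?S" for u
    proof -
      have "msig N u \<in> ?S" if "u \<in> W" "u \<in> mH Mh" using sW[OF that] h(7)[OF that(2)] i(13)[OF that(2)] by (cases "u = p") simp_all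
      moreover have "msig N e \<in> ?S" using i(14) sp h(7)[OF i(1)] by simp
      moreover have "msig N u \<in> ?S" if "u \<in> mH M2" using rooted_mapD(7)[OF r2 that] s2 by simp
      ultimately show ?thesis using that by blast
    qed
    have SNa: "malp N u \<in> ?S" if "u \<in> ?S" "u \<noteq> b" for u
    proof -
      have "malp N u \<in> ?S" if "u \<in> W" "u \<in> mH Mh" "u \<noteq> b"
        using aW[OF that] h(8)[OF that(2)] i(12)[OF that(2)] by simp
      moreover have "malp N e \<in> ?S" using H2 rooted_mapD(2)[OF r2] by simp
      moreover have "malp N u \<in> ?S" if "u \<in> mH M2"
        using rooted_mapD(8)[OF r2 that] a2[of u] r(9)[OF UN[OF eU]] by (cases "u = malp N e") auto
      ultimately show ?thesis using that by blast
    qed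
    have "mcutset M (malp M) b ?T"
      unfolding cutset_def
    proof (intro conjI ballI impI)
      show "?T \<subseteq> mH M" using SN d(5) by blast
      show "b \<in> ?T" using W(2) bh by simp
      have "malp M b = malp Mh b" using d(9)[OF SN, of b] i(12)[OF bh] W(2) bh by simp
      moreover have "malp Mh b \<noteq> e" "malp Mh b \<notin> mH M2" "malp Mh b \<noteq> x" "malp Mh b \<noteq> y"
        using ab(1) Hh H2 UN d(1,2) by auto
      ultimately show "malp M b \<notin> ?T" using ab(2) by simp
      fix u assume u: "u \<in> ?T"
      have 1: "msig M u \<in> ?T" if "u \<in> ?S"
        using that d(10) d(13)[OF SN[OF that]] SNs[OF that] by (cases "u = mroot N"; cases "u = c") simp_all
      have "mroot N \<in> ?S" using rr W(6) h(2) by simp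
      then have 2: "msig M x \<in> ?T" using d(11) cp(1) SNs[of "mroot N"] by simp
      have 3: "msig M y \<in> ?T" using d(12) SNs[of c] c2 by simp
      show "msig M u \<in> ?T" using u 1 2 3 by blast
      have 4: "malp M u \<in> ?S" if "u \<in> ?S" "u \<noteq> b" using SNa[OF that] d(9)[OF SN[OF that(1)]] by simp
      have "malp M x \<in> ?T" "malp M y \<in> ?T" using d(7,8) by simp_all
      then show "malp M u \<in> ?T" if "u \<noteq> b" using u 4 that by blast
    qed
    then show False by (rule nocut) (use d(6) rr W(6) h(2) in simp)
  qed
  then show ?thesis using that[OF I r2 rh b2 c2] by blast
qed

section \<open>Agreement of phi and theta on bridgeless maps\<close>

lemma dsize_phi: "phi_rel M D \<Longrightarrow> dsize D = msize M"
  using phi_rel_props[of M D] rooted_card_msize[of M] by (auto simp: dsize_def)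

text \<open>Connectedness is proved along the boxed products, because the rules of
  \<open>phi_rel\<close> pass through diagrams that are not connected.\<close>

lemma theta_rel_imp_phi_rel: "theta_rel M C \<Longrightarrow> phi_rel M C \<and> connected_diagram C"
proof (induction rule: theta_rel.induct)
  case (theta_one M)
  then show ?case using phi_one connected_one_chord by simp
next
  case (theta_star M1 C1 M2 C2 i M C)
  then have phi: "phi_rel M1 C1" "phi_rel M2 C2" and con: "connected_diagram C1" "connected_diagram C2" by auto
  note p1 = phi_rel_props[OF phi(1)] and p2 = phi_rel_props[OF phi(2)]
  have i: "1 \<le> i" "i \<le> card (mH M2)" "i < length C2"
    using theta_star.hyps(5,6) rooted_card_msize(1)[of M2] p2 by auto
  have l1: "length (dR l Ch) > 2" if "Ch \<noteq> []" for l Ch using that by (cases Ch) auto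
  from theta_star.hyps(8) show ?case unfolding mstar_rel_def
  proof (elim disjE exE conjE)
    assume m: "miso M1 one_map" "miso M (mR i M2)"
    \<comment> \<open>The length of \<open>C1\<close> decides which alternative of
      \<open>dstar_rel\<close> holds: a \<open>dR\<close> of a nonempty diagram has more than two
      points.\<close>
    then have "length C1 = 2" using p1 miso_card[OF m(1)] card_one_map by simp
    then have "C = dR i C2" using theta_star.hyps(9) l1 unfolding dstar_rel_def by fastforce
    then show ?thesis using phi_rel_RI[OF phi(2) i(1,2) theta_star.hyps(7) m(2)] connected_dR[OF con(2) _ i(1,3)] p2 by simp
  next
    fix l Mh assume m: "rooted_map Mh" "1 \<le> l" "l \<le> 2 * msize Mh - 1" "miso M1 (mR l Mh)" "miso M (mR (i + l) (mIns M2 l Mh))"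
    have l: "l \<le> card (mH Mh)" using m(3) rooted_card_msize(1)[OF m(1)] by simp
    have "length C1 \<noteq> 2" using p1 miso_card[OF m(4)] card_mR[OF m(1), of l] by simp
    then have "C1 \<noteq> one_chord" by (auto simp: one_chord_def)
    then obtain l' Ch where C: "is_diagram Ch" "1 \<le> l'" "l' \<le> 2 * dsize Ch - 1" "C1 = dR l' Ch" "C = dR (i + l') (dIns C2 l' Ch)"
      using theta_star.hyps(9) unfolding dstar_rel_def by blast
    obtain Dh where Dh: "phi_rel Mh Dh" using phi_rel_exists[OF m(1)] by blast
    have "phi_rel M1 (dR l Dh)" using phi_rel_RI[OF Dh m(2) l _ m(4)] p1 by simp
    \<comment> \<open>\<open>mstar_rel\<close> and \<open>dstar_rel\<close> might use different
      decompositions; uniqueness of the image of \<open>M1\<close> identifies them.\<close>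
    then have "dR l Dh = dR l' Ch" using phi_rel_unique[OF phi(1)] miso_refl C(4) by metis
    then have e: "l' = l" "Ch = Dh" using dR_eq_iff by blast+
    have "phi_rel (mIns M2 l Mh) (dIns C2 l Dh)" using phi_rel_mIns[OF Dh phi(2) m(2) l] .
    moreover have "i + l \<le> card (mH (mIns M2 l Mh))" using card_mIns[OF m(1), of M2 l] p2 i l by simp
    ultimately have "phi_rel M C" using phi_rel_RI[of "mIns M2 l Mh" _ "i + l" M] i theta_star.hyps(7) m(5) C(5) e by simp
    moreover have "connected_diagram C"
      using connected_star[of l Ch C2 i] con C e m(2) l phi_rel_props[OF Dh] p2 i by simp
    ultimately show ?thesis by simp
  qed
qed

text \<open>The induction is on size rather than on \<open>phi_rel\<close>, because the factors of a
  boxed product are bridgeless, whereas the map left by deleting the root edge may have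
  bridges.\<close>

lemma phi_rel_imp_theta_rel: "phi_rel M D \<Longrightarrow> bridgeless M \<Longrightarrow> theta_rel M D"
proof (induction "card (mH M)" arbitrary: M D rule: less_induct)
  case less
  note phi = less.prems(1) and bl = less.prems(2)
  have rM: "rooted_map M" using phi_rel_props[OF phi] by simp
  note uniq = phi_rel_unique[OF phi _ miso_refl]
  from rM show ?case
  proof (cases rule: rooted_map_cases)
    case one
    have m: "miso M one_map" unfolding miso_iff iso_by_def
      using one rooted_mapD(5)[OF rM] by (intro exI[of _ "\<lambda>_. 0"]) (simp add: one_map_def bij_betw_def)
    have "D = one_chord" using uniq[OF phi_one[OF rM m]] .
    then show ?thesis using theta_one[OF rM m] by simp
  next
    case (bridge Md Mu z)
    have "z \<in> mH M" using isID(6)[OF bridge(1)] by simp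
    then show ?thesis using isI_bridge[OF bridge(1,3,2)] bl by (simp add: bridgeless_def)
  next
    case (R N c x y)
    obtain k where k: "1 \<le> k" "k \<le> card (mH N)" "corner N k = c" using corner_surj[OF R(2) isRD(4)[OF R(1)]] .
    have mN: "miso M (mR k N)" using isR_miso_mR[OF R iso_by_id] k by simp
    obtain DN where DN: "phi_rel N DN" using phi_rel_exists[OF R(2)] by blast
    have D: "D = dR k DN" using uniq[OF phi_rel_RI[OF DN k(1,2) rM mN]] .
    have cM: "card (mH M) = card (mH N) + 2" using isR_card[OF R] .
    show ?thesis
    proof (cases "bridgeless N")
      case True
      have r1: "rooted_map one_map" by (rule rooted_mapI) (auto simp: one_map_def)
      have th: "theta_rel N DN" using less(1)[OF _ DN True] cM by simp
      have b1: "bridgeless one_map" by (auto simp: bridgeless_def is_bridge_def one_map_def)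
      have "theta_rel M (dR k DN)"
        by (rule theta_star[OF theta_one[OF r1 miso_refl] th b1 True, of k])
          (use k rooted_card_msize(1)[OF R(2)] rM mN miso_refl in \<open>auto simp: mstar_rel_def dstar_rel_def\<close>)
      then show ?thesis using D by simp
    next
      case False
      obtain M2 Mh p e where I: "isI N M2 Mh p e id" and r2: "rooted_map M2" and rh: "rooted_map Mh"
        and b2: "bridgeless M2" and c2: "c \<in> mH M2" and b1: "\<And>M1 x1 y1. isR M1 Mh p x1 y1 \<Longrightarrow> bridgeless M1"
        using bridgeless_decomp[OF R bl False] by metis
      obtain l where l: "1 \<le> l" "l \<le> card (mH Mh)" "corner Mh l = p" using corner_surj[OF rh isID(1)[OF I]] .
      obtain i where i: "1 \<le> i" "i \<le> card (mH M2)" "corner M2 i = c" using corner_surj[OF r2 c2] .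
      have I': "isI N M2 Mh (crn Mh (l - 1)) e id" using I l(3) by (simp add: corner_crn)
      \<comment> \<open>From the root, \<open>l\<close> steps lead across the bridge to the root of
        \<open>M2\<close>, and \<open>i - 1\<close> more lead to \<open>c\<close>. This is the
        origin of the index \<open>i + l\<close> in the boxed product.\<close>
      have "corner N (i + l) = c"
        using isI_labels(2)[OF I' rh r2 bfl_good_rooted[OF rh] bfl_good_rooted[OF r2], of "i - 1"] l i
        by (simp add: corner_crn add.commute)
      moreover have cN: "card (mH N) = card (mH Mh) + 1 + card (mH M2)" using isI_card[OF I rh r2] .
      ultimately have kil: "k = i + l" using corner_inj[OF R(2) k(1,2), of "i + l"] k(3) i l by simp
      obtain Dh where Dh: "phi_rel Mh Dh" using phi_rel_exists[OF rh] by blast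
      obtain D2 where D2: "phi_rel M2 D2" using phi_rel_exists[OF r2] by blast
      define M1 where "M1 = mR l Mh"
      have rM1: "rooted_map M1" using rooted_mR[OF rh] by (simp add: M1_def)
      have bM1: "bridgeless M1" using b1 isR_mR[OF rh, of l] l(3) unfolding M1_def by metis
      have phi1: "phi_rel M1 (dR l Dh)" using phi_rel_RI[OF Dh l(1,2) rM1] miso_refl by (simp add: M1_def)
      have th1: "theta_rel M1 (dR l Dh)"
        by (rule less(1)[OF _ phi1 bM1]) (use cM cN card_mR[OF rh, of l] card_pos[OF r2] in \<open>simp add: M1_def\<close>)
      have th2: "theta_rel M2 D2" by (rule less(1)[OF _ D2 b2]) (use cM cN in simp)
      have mN2: "miso N (mIns M2 l Mh)" using isI_miso_mIns[OF I rh r2 iso_by_id miso_refl] l(3) by simp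
      have DN2: "DN = dIns D2 l Dh" using phi_rel_unique[OF DN phi_rel_mIns[OF Dh D2 l(1,2)] mN2] .
      have "miso M (mR (i + l) (mIns M2 l Mh))" using miso_trans[OF mN mR_cong[OF mN2 R(2)]] kil by simp
      then have ms: "mstar_rel M1 i M2 M" unfolding mstar_rel_def M1_def
        using rh l rooted_card_msize(1)[OF rh] miso_refl by auto
      note ph = phi_rel_props[OF Dh]
      have ds: "dstar_rel (dR l Dh) i D2 D" unfolding dstar_rel_def D DN2 kil
        by (intro disjI2 exI[of _ l] exI[of _ Dh])
          (use ph indecomposableD(1,2)[of Dh] l dsize_phi[OF Dh] rooted_card_msize(1)[OF rh] in auto)
      show ?thesis
        by (rule theta_star[OF th1 th2 bM1 b2 i(1) _ rM ms ds]) (use i rooted_card_msize(1)[OF r2] in simp)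
    qed
  qed
qed

text \<open>\<open>phi_rel\<close> relates concrete maps to diagrams; the first two conjuncts make
  it a function on isomorphism classes.\<close>

theorem theorem4p3:
  shows "(\<forall>M. rooted_map M \<longrightarrow> (\<exists>!D. phi_rel M D))
    \<and> (\<forall>M M' D. phi_rel M D \<and> rooted_map M' \<and> miso M M' \<longrightarrow> phi_rel M' D)
    \<and> (\<forall>M D. phi_rel M D \<longrightarrow> rooted_map M \<and> indecomposable D \<and> dsize D = msize M)
    \<and> (\<forall>M M' D. phi_rel M D \<and> phi_rel M' D \<longrightarrow> miso M M')
    \<and> (\<forall>D. indecomposable D \<longrightarrow> (\<exists>M. rooted_map M \<and> phi_rel M D))
    \<and> (\<forall>M D. rooted_map M \<and> bridgeless M \<longrightarrow> (theta_rel M D \<longleftrightarrow> phi_rel M D))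
    \<and> (\<forall>M D. rooted_map M \<and> bridgeless M \<and> phi_rel M D \<longrightarrow> connected_diagram D)"
proof (intro conjI allI impI)
  fix M assume M: "rooted_map M"
  then obtain D where "phi_rel M D" using phi_rel_exists by blast
  then show "\<exists>!D. phi_rel M D" using phi_rel_unique miso_refl by blast
next
  fix M M' D assume "phi_rel M D \<and> rooted_map M' \<and> miso M M'"
  then show "phi_rel M' D" using phi_rel_iso by blast
next
  fix M D assume M: "phi_rel M D"
  then show "rooted_map M" "indecomposable D" "dsize D = msize M" using phi_rel_props dsize_phi by blast+
next
  fix M M' D assume "phi_rel M D \<and> phi_rel M' D"
  then show "miso M M'" using phi_rel_inj by blast
next
  fix D assume "indecomposable D"
  then show "\<exists>M. rooted_map M \<and> phi_rel M D" using phi_rel_surj phi_rel_props by blast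
next
  fix M D assume "rooted_map M \<and> bridgeless M"
  then show "theta_rel M D \<longleftrightarrow> phi_rel M D" using theta_rel_imp_phi_rel phi_rel_imp_theta_rel by blast
next
  fix M D assume "rooted_map M \<and> bridgeless M \<and> phi_rel M D"
  then show "connected_diagram D" using theta_rel_imp_phi_rel phi_rel_imp_theta_rel by blast
qed

end
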